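(* For rule $3$ on the square grid, the problem \textsc{Stability} is in $\mathbf{NC}$.
   Context: Square grid: cells are the elements of $\mathbb{Z}^2$; the neighbors $N(u)$ of $u$ are the four cells at Manhattan distance $1$. A configuration assigns to every cell a state in $\{0,1\}$ (1 = active, 0 = inactive). A freezing totalistic cellular automaton is given by $\mathcal{I}\subseteq\{1,2,3,4\}$ and acts synchronously by $F(c)_u=1$ if $c_u=1$ or $\sum_{v\in N(u)}c_v\in\mathcal{I}$, and $F(c)_u=0$ otherwise; rule $3$ means $\mathcal{I}=\{3\}$. A finite configuration of dimension $n\times n$ is $x:\{0,\dots,n-1\}^2\to\{0,1\}$, and $c(x)$ is the periodic configuration obtained by repeating $x$ in all directions. A cell $u$ with $c_u=0$ is stable for $c$ if $F^t(c)_u=0$ for all $t\ge0$. \textsc{Stability}: given $x$ and $u\in\{0,\dots,n-1\}^2$ with $x_u=0$, decide whether $u$ is stable for $c(x)$. $\mathbf{NC}$ is the class of decision problems solvable on a PRAM in time $(\log n)^{O(1)}$ with $n^{O(1)}$ processors. *)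

theory Defs
  imports Complex_Main
begin

section \<open>Freezing totalistic cellular automata on the square grid\<close>

type_synonym cell = "int \<times> int"

text \<open>State 1 (active) is \<^const>\<open>True\<close>, state 0 (inactive) is \<^const>\<open>False\<close>.\<close>
type_synonym configuration = "cell \<Rightarrow> bool"

definition neighbors :: "cell \<Rightarrow> cell set" where
  "neighbors u = {v. \<bar>fst v - fst u\<bar> + \<bar>snd v - snd u\<bar> = 1}"

lemma neighbors_eq: "neighbors (i, j) = {(i + 1, j), (i - 1, j), (i, j + 1), (i, j - 1)}"
  by (auto simp: neighbors_def)

lemma card_neighbors: "card (neighbors u) = 4"
  by (cases u) (simp add: neighbors_eq)

definition global_rule :: "nat set \<Rightarrow> configuration \<Rightarrow> configuration" where
  "global_rule I c = (\<lambda>u. c u \<or> (\<Sum>v\<in>neighbors u. of_bool (c v)) \<in> I)"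

definition stable :: "nat set \<Rightarrow> configuration \<Rightarrow> cell \<Rightarrow> bool" where
  "stable I c u \<longleftrightarrow> \<not> c u \<and> (\<forall>t. \<not> (global_rule I ^^ t) c u)"

text \<open>
  An \<open>n \<times> n\<close> configuration is a function on pairs of naturals of which only the values on
  \<open>{0..<n} \<times> {0..<n}\<close> are used.
\<close>
definition periodic :: "nat \<Rightarrow> (nat \<times> nat \<Rightarrow> bool) \<Rightarrow> configuration" where
  "periodic n x = (\<lambda>(i, j). x (nat (i mod int n), nat (j mod int n)))"


section \<open>The decision problem\<close>

text \<open>
  The instance \<open>(n, x, u)\<close> is the bit string of length \<open>2 * n^2\<close> that lists the values of \<open>x\<close> in
  row-major order, followed by the indicator of the cell \<open>u\<close> in the same order.
\<close>
definition encode :: "nat \<Rightarrow> (nat \<times> nat \<Rightarrow> bool) \<Rightarrow> nat \<times> nat \<Rightarrow> bool list" where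
  "encode n x u =
     map x (List.product [0..<n] [0..<n]) @ map (\<lambda>v. v = u) (List.product [0..<n] [0..<n])"

definition stability :: "nat set \<Rightarrow> bool list set" where
  "stability I = {encode n x (i, j) | n x i j.
     i < n \<and> j < n \<and> \<not> x (i, j) \<and> stable I (periodic n x) (int i, int j)}"


section \<open>Parallel random access machines and the class NC\<close>

text \<open>
  A synchronous PRAM with concurrent reads and exclusive writes (CREW). All processors run the same
  program, each with its own program counter and its own local registers; shared memory cells and
  registers hold natural numbers. There is deliberately no unit-cost multiplication: with the
  operations below, numbers grow by at most one bit per step.
\<close>
datatype instr =
    Const nat nat      \<comment> \<open>\<open>Const r k\<close>: \<open>r := k\<close>\<close>
  | Add nat nat nat    \<comment> \<open>\<open>Add r a b\<close>: \<open>r := a + b\<close>\<close>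
  | Sub nat nat nat    \<comment> \<open>\<open>Sub r a b\<close>: \<open>r := a - b\<close>, truncated at 0\<close>
  | Half nat nat       \<comment> \<open>\<open>Half r a\<close>: \<open>r := a div 2\<close>\<close>
  | Load nat nat       \<comment> \<open>\<open>Load r a\<close>: \<open>r := shared[a]\<close>\<close>
  | Store nat nat      \<comment> \<open>\<open>Store a b\<close>: \<open>shared[a] := b\<close>\<close>
  | JumpZ nat nat      \<comment> \<open>\<open>JumpZ a l\<close>: continue at instruction \<open>l\<close> if \<open>a = 0\<close>\<close>

type_synonym program = "instr list"

text \<open>The first argument of \<open>pc\<close> and \<open>reg\<close> is the index of the processor.\<close>
record state =
  pc :: "nat \<Rightarrow> nat"
  reg :: "nat \<Rightarrow> nat \<Rightarrow> nat"
  shared :: "nat \<Rightarrow> nat"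

text \<open>
  Initially, shared memory holds the input length in cell 0 and the input bits in the cells
  following it, and register 0 of every processor holds its index. Everything else is 0.
\<close>
definition initial :: "bool list \<Rightarrow> state" where
  "initial w =
     \<lparr>pc = (\<lambda>p. 0),
      reg = (\<lambda>p r. if r = 0 then p else 0),
      shared = (\<lambda>a. if a = 0 then length w
                    else if a \<le> length w then of_bool (w ! (a - 1)) else 0)\<rparr>"

text \<open>A processor has halted once its program counter has left the program.\<close>
definition running :: "program \<Rightarrow> state \<Rightarrow> nat \<Rightarrow> bool" where
  "running prog s p \<longleftrightarrow> pc s p < length prog"

fun next_pc :: "instr \<Rightarrow> (nat \<Rightarrow> nat) \<Rightarrow> nat \<Rightarrow> nat" where
  "next_pc (JumpZ a l) \<rho> i = (if \<rho> a = 0 then l else Suc i)"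
| "next_pc _ \<rho> i = Suc i"

fun next_reg :: "instr \<Rightarrow> (nat \<Rightarrow> nat) \<Rightarrow> (nat \<Rightarrow> nat) \<Rightarrow> nat \<Rightarrow> nat" where
  "next_reg (Const r k) m \<rho> = \<rho>(r := k)"
| "next_reg (Add r a b) m \<rho> = \<rho>(r := \<rho> a + \<rho> b)"
| "next_reg (Sub r a b) m \<rho> = \<rho>(r := \<rho> a - \<rho> b)"
| "next_reg (Half r a) m \<rho> = \<rho>(r := \<rho> a div 2)"
| "next_reg (Load r a) m \<rho> = \<rho>(r := m (\<rho> a))"
| "next_reg (Store a b) m \<rho> = \<rho>"
| "next_reg (JumpZ a l) m \<rho> = \<rho>"

definition writes :: "program \<Rightarrow> state \<Rightarrow> nat \<Rightarrow> nat \<Rightarrow> nat \<Rightarrow> bool" where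
  "writes prog s p a v \<longleftrightarrow> running prog s p \<and>
     (\<exists>ra rb. prog ! pc s p = Store ra rb \<and> a = reg s p ra \<and> v = reg s p rb)"

definition exclusive_write :: "program \<Rightarrow> nat \<Rightarrow> state \<Rightarrow> bool" where
  "exclusive_write prog P s \<longleftrightarrow>
     (\<forall>p<P. \<forall>q<P. \<forall>a v v'. writes prog s p a v \<and> writes prog s q a v' \<longrightarrow> p = q)"

text \<open>
  One synchronous step of the processors \<open>0, \<dots>, P - 1\<close>; all reads precede all writes. The new
  contents of a shared cell are meaningful only under \<^const>\<open>exclusive_write\<close>, which
  \<open>decides_input\<close> below requires of every step of the computation.
\<close>
definition step :: "program \<Rightarrow> nat \<Rightarrow> state \<Rightarrow> state" where
  "step prog P s =
     \<lparr>pc = (\<lambda>p. if p < P \<and> running prog s p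
                then next_pc (prog ! pc s p) (reg s p) (pc s p) else pc s p),
      reg = (\<lambda>p. if p < P \<and> running prog s p
                 then next_reg (prog ! pc s p) (shared s) (reg s p) else reg s p),
      shared = (\<lambda>a. if \<exists>p<P. \<exists>v. writes prog s p a v
                    then THE v. \<exists>p<P. writes prog s p a v else shared s a)\<rparr>"

text \<open>The answer is read off from shared cell 0 when all processors have halted.\<close>
definition decides_input :: "program \<Rightarrow> nat \<Rightarrow> real \<Rightarrow> bool list \<Rightarrow> bool \<Rightarrow> bool" where
  "decides_input prog P T w b \<longleftrightarrow>
     (\<exists>t. real t \<le> T \<and>
        (\<forall>s<t. exclusive_write prog P ((step prog P ^^ s) (initial w))) \<and>
        (\<forall>p<P. \<not> running prog ((step prog P ^^ t) (initial w)) p) \<and>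
        (shared ((step prog P ^^ t) (initial w)) 0 = 1 \<longleftrightarrow> b))"

text \<open>
  One fixed program for all inputs, with the number of processors an explicit polynomial in the
  input length, so that the class is uniform. The additive constants cover short inputs.
\<close>
definition NC :: "bool list set set" where
  "NC = {L. \<exists>prog c d k. \<forall>w.
     decides_input prog (length w ^ d + d)
       (real c * log 2 (real (length w)) ^ k + real c) w (w \<in> L)}"

end

theory Submission
  imports Defs "HOL-Library.Discrete_Functions"
begin

text \<open>
  Under rule 3 the inactive cells evolve by synchronous removal of the leaves of the graph that they induce. For an
  inactive cell \<open>u\<close> let \<open>h d\<close> be the maximal length of a non-backtracking walk of inactive cells that starts
  at \<open>u\<close> in direction \<open>d\<close>, possibly infinite. Then \<open>u\<close> becomes active if and only if the maximum of the four
  numbers \<open>h d\<close> is attained exactly once: its time is one more than the second largest value, while two equal finite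
  maxima make \<open>u\<close> the centre of its tree, whose last neighbors, at least two if any, vanish simultaneously.
  On the torus these walks are walks in the finite graph of darts (cell and direction), so that the numbers are
  computed up to a cutoff by repeated squaring of a max-plus matrix, with one processor for every pair of nodes and every
  position in a binary tree over the intermediate nodes. All rounds of all squarings are the same local update, since the
  entries always remain lengths of actual walks.
\<close>

section \<open>Lockstep programs\<close>

text \<open>\<open>NC\<close> asks for one program for all lengths, on a machine without
  multiplication whose control flow may diverge between processors. Hence sizes are powers of two:
  with \<open>V = 2 ^ E\<close> above the input length and \<open>N = 16 * V\<close> nodes, fields
  of a processor index are cut out by shifts. Loop counts agree on all processors, and each
  processor writes only the cell with its own index, so writes are exclusive. The 16 kinds of nodes
  are four directions, a sink, four sources and the kind of the summing row, rounded up to a power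
  of two. The cutoff is \<open>N\<close>: the sets of darts that start a walk of a given length
  shrink with the length and are constant from length \<open>4 * (n * n) + 1\<close> on, which is
  below \<open>N\<close>. Longer walks thus count as infinite, and comparing capped lengths loses
  nothing. An entry of the table need not be the exact maximum: it is the length of some walk and at
  least every length up to \<open>N\<close> that occurs. Words that encode no instance must be
  rejected too. An integer square root tests the length, and a row of sums tests that exactly one
  cell is queried and that it is inactive.\<close>

datatype op = Op instr | Sel nat nat nat nat

datatype com = Block "op list" | Put nat | Seq com com (infixr ";;" 60) | While nat com

text \<open>Register 1 is the zero of the machine: compiled code copies with
  \<open>Add r a 1\<close> and jumps unconditionally with \<open>JumpZ 1 l\<close>. A selection
  clears it first, so the reset is part of its semantics.\<close>

fun op_sem :: "op \<Rightarrow> (nat \<Rightarrow> nat) \<Rightarrow> (nat \<Rightarrow> nat) \<Rightarrow> nat \<Rightarrow> nat" where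
  "op_sem (Op i) m \<rho> = next_reg i m \<rho>"
| "op_sem (Sel r c a b) m \<rho> = \<rho>(1 := 0, r := (\<rho>(1 := 0)) (if (\<rho>(1 := 0)) c = 0 then a else b))"

fun block_sem :: "op list \<Rightarrow> (nat \<Rightarrow> nat) \<Rightarrow> (nat \<Rightarrow> nat) \<Rightarrow> nat \<Rightarrow> nat" where
  "block_sem [] m \<rho> = \<rho>"
| "block_sem (x # xs) m \<rho> = block_sem xs m (op_sem x m \<rho>)"

fun op_ok :: "op \<Rightarrow> bool" where
  "op_ok (Op (Store a b)) = False"
| "op_ok (Op (JumpZ a l)) = False"
| "op_ok (Op i) = True"
| "op_ok (Sel r c a b) = (r \<noteq> 1)"

fun com_ok :: "com \<Rightarrow> bool" where
  "com_ok (Block xs) = list_all op_ok xs"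
| "com_ok (Put v) = True"
| "com_ok (c1 ;; c2) = (com_ok c1 \<and> com_ok c2)"
| "com_ok (While r c) = com_ok c"

text \<open>
  Both branches of a selection take the same number of steps, so that processors taking different
  branches are in lockstep again afterwards.
\<close>
fun op_code :: "nat \<Rightarrow> op \<Rightarrow> program" where
  "op_code i (Op x) = [x]"
| "op_code i (Sel r c a b) =
     [Const 1 0, JumpZ c (i + 4), Add r b 1, JumpZ 1 (i + 6), Add r a 1, JumpZ 1 (i + 6)]"

fun block_code :: "nat \<Rightarrow> op list \<Rightarrow> program" where
  "block_code i [] = []"
| "block_code i (x # xs) = op_code i x @ block_code (i + length (op_code i x)) xs"

fun code :: "nat \<Rightarrow> com \<Rightarrow> program" where
  "code i (Block xs) = block_code i xs"
| "code i (Put v) = [Store 0 v]"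
| "code i (c1 ;; c2) = code i c1 @ code (i + length (code i c1)) c2"
| "code i (While r c) =
     [JumpZ r (i + length (code (Suc i) c) + 3)] @ code (Suc i) c @ [Const 1 0, JumpZ 1 i]"

text \<open>Time is an upper bound: every operation is charged 4 steps, the cost of a selection.
  Loop tests have to agree on all processors, which keeps them in lockstep, and \<open>Put\<close>
  addresses memory by register 0, the index of the processor. An iteration costs 3 further steps:
  the test, the reset of register 1 and the jump back.\<close>

inductive exec ::
  "nat \<Rightarrow> com \<Rightarrow> (nat \<Rightarrow> nat \<Rightarrow> nat) \<times> (nat \<Rightarrow> nat) \<Rightarrow> nat \<Rightarrow> (nat \<Rightarrow> nat \<Rightarrow> nat) \<times> (nat \<Rightarrow> nat) \<Rightarrow> bool"
  for P where
  Block: "exec P (Block xs) (R, m) (4 * length xs) (\<lambda>p. block_sem xs m (R p), m)"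
| Put: "(\<And>p. R p 0 = p) \<Longrightarrow> exec P (Put v) (R, m) 1 (R, \<lambda>a. if a < P then R a v else m a)"
| Seq: "exec P c1 s t1 s' \<Longrightarrow> exec P c2 s' t2 s'' \<Longrightarrow> exec P (c1 ;; c2) s (t1 + t2) s''"
| WhileFalse: "(\<And>p. R p r = 0) \<Longrightarrow> exec P (While r c) (R, m) 1 (R, m)"
| WhileTrue: "(\<And>p. R p r \<noteq> 0) \<Longrightarrow> exec P c (R, m) t1 (R', m') \<Longrightarrow>
    exec P (While r c) (\<lambda>p. (R' p)(1 := 0), m') t2 s'' \<Longrightarrow>
    exec P (While r c) (R, m) (t1 + 3 + t2) s''"
| Weaken: "exec P c s t s' \<Longrightarrow> t \<le> t' \<Longrightarrow> exec P c s t' s'"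

section \<open>Soundness of the compiled code\<close>

definition config :: "nat \<Rightarrow> (nat \<Rightarrow> nat) \<Rightarrow> (nat \<Rightarrow> nat \<Rightarrow> nat) \<Rightarrow> (nat \<Rightarrow> nat) \<Rightarrow> state \<Rightarrow> bool" where
  "config P I R m s \<longleftrightarrow> (\<forall>p<P. pc s p = I p \<and> reg s p = R p) \<and> shared s = m"

definition reaches :: "program \<Rightarrow> nat \<Rightarrow> state \<Rightarrow> nat \<Rightarrow> state \<Rightarrow> bool" where
  "reaches prog P s t s' \<longleftrightarrow>
     (step prog P ^^ t) s = s' \<and> (\<forall>k<t. exclusive_write prog P ((step prog P ^^ k) s))"

lemma reaches_0: "reaches prog P s 0 s"
  by (simp add: reaches_def)

lemma reaches_trans:
  assumes "reaches prog P s t s'" "reaches prog P s' t' s''"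
  shows "reaches prog P s (t + t') s''"
  unfolding reaches_def
proof (intro conjI allI impI)
  show "(step prog P ^^ (t + t')) s = s''"
    using assms by (simp add: reaches_def add.commute[of t t'] funpow_add)
next
  fix k assume k: "k < t + t'"
  show "exclusive_write prog P ((step prog P ^^ k) s)"
  proof (cases "k < t")
    case True
    then show ?thesis using assms(1) by (simp add: reaches_def)
  next
    case False
    then have "(step prog P ^^ k) s = (step prog P ^^ (k - t)) ((step prog P ^^ t) s)"
      by (metis add.commute comp_apply funpow_add le_add_diff_inverse linorder_not_less)
    then show ?thesis using assms False k by (auto simp: reaches_def)
  qed
qed

fun no_store :: "instr \<Rightarrow> bool" where
  "no_store (Store a b) = False"
| "no_store _ = True"

text \<open>The program counter \<open>I p\<close> depends on the processor because processors stand
  on different branches in the middle of a selection.\<close>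

lemma reaches_local_step:
  assumes c: "config P I R m s"
    and I: "\<And>p. p < P \<Longrightarrow> I p < length prog \<and> no_store (prog ! I p)"
  shows "\<exists>s'. reaches prog P s 1 s' \<and>
    config P (\<lambda>p. next_pc (prog ! I p) (R p) (I p)) (\<lambda>p. next_reg (prog ! I p) m (R p)) m s'"
proof -
  have nw: "\<not> writes prog s p a v" if "p < P" for p a v
    using c I[OF that] that by (auto simp: writes_def config_def)
  then have nw': "(\<exists>p<P. \<exists>v. writes prog s p a v) \<longleftrightarrow> False" for a
    by blast
  have "config P (\<lambda>p. next_pc (prog ! I p) (R p) (I p)) (\<lambda>p. next_reg (prog ! I p) m (R p)) m (step prog P s)"
    unfolding config_def step_def nw' using c I by (simp add: config_def running_def)
  moreover have "reaches prog P s 1 (step prog P s)"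
    using nw by (auto simp: reaches_def exclusive_write_def)
  ultimately show ?thesis by blast
qed

lemma reaches_store:
  assumes c: "config P (\<lambda>_. i) R m s" and R: "\<And>p. R p 0 = p"
    and i: "i < length prog" "prog ! i = Store 0 v"
  shows "\<exists>s'. reaches prog P s 1 s' \<and> config P (\<lambda>_. Suc i) R (\<lambda>a. if a < P then R a v else m a) s'"
proof -
  have w: "writes prog s p a b \<longleftrightarrow> a = p \<and> b = R p v" if "p < P" for p a b
    using c i R that by (auto simp: writes_def config_def running_def)
  have 1: "(\<exists>p<P. \<exists>b. writes prog s p a b) \<longleftrightarrow> a < P" for a
    using w by auto
  have 2: "(THE b. \<exists>p<P. writes prog s p a b) = R a v" if "a < P" for a
    using w that by (intro the_equality) auto
  have "config P (\<lambda>_. Suc i) R (\<lambda>a. if a < P then R a v else m a) (step prog P s)"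
    using c i 1 2 by (auto simp: config_def step_def running_def)
  moreover have "reaches prog P s 1 (step prog P s)"
    using w by (auto simp: reaches_def exclusive_write_def)
  ultimately show ?thesis by blast
qed

definition code_at :: "program \<Rightarrow> nat \<Rightarrow> program \<Rightarrow> bool" where
  "code_at prog i cs \<longleftrightarrow> (\<forall>k<length cs. i + k < length prog \<and> prog ! (i + k) = cs ! k)"

lemma code_at_Nil [simp]: "code_at prog i []"
  by (simp add: code_at_def)

lemma code_at_append [simp]:
  "code_at prog i (xs @ ys) \<longleftrightarrow> code_at prog i xs \<and> code_at prog (i + length xs) ys"
proof
  assume l: "code_at prog i (xs @ ys)"
  have "i + length xs + k < length prog \<and> prog ! (i + length xs + k) = ys ! k" if "k < length ys" for k
    using l[unfolded code_at_def, rule_format, of "length xs + k"] that by (simp add: add.assoc)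
  moreover have "i + k < length prog \<and> prog ! (i + k) = xs ! k" if "k < length xs" for k
    using l[unfolded code_at_def, rule_format, of k] that by (simp add: nth_append)
  ultimately show "code_at prog i xs \<and> code_at prog (i + length xs) ys"
    by (simp add: code_at_def)
next
  assume r: "code_at prog i xs \<and> code_at prog (i + length xs) ys"
  show "code_at prog i (xs @ ys)"
    unfolding code_at_def
  proof (intro allI impI)
    fix k assume "k < length (xs @ ys)"
    then show "i + k < length prog \<and> prog ! (i + k) = (xs @ ys) ! k"
      using r[unfolded code_at_def, THEN conjunct1, rule_format, of k]
        r[unfolded code_at_def, THEN conjunct2, rule_format, of "k - length xs"]
      by (cases "k < length xs") (auto simp: nth_append)
  qed
qed

lemma code_at_Cons [simp]:
  "code_at prog i (x # xs) \<longleftrightarrow> i < length prog \<and> prog ! i = x \<and> code_at prog (Suc i) xs"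
  using code_at_append[of prog i "[x]" xs] by (simp add: code_at_def)

lemma reaches_sel:
  assumes at: "code_at prog i (op_code i (Sel r c a b))" and r: "r \<noteq> 1"
    and cfg: "config P (\<lambda>_. i) R m s"
  shows "\<exists>s'. reaches prog P s 4 s' \<and> config P (\<lambda>_. i + 6) (\<lambda>p. op_sem (Sel r c a b) m (R p)) m s'"
proof -
  let ?R1 = "\<lambda>p. (R p)(1 := 0)"
  \<comment> \<open>The branches start at offsets 4 and 2. Each consists of a copy and a jump to
    offset 6, taken because \<open>r\<close> is not register 1, which therefore is still 0.\<close>
  let ?br = "\<lambda>p. if ?R1 p c = 0 then i + 4 else i + 2"
  let ?R3 = "\<lambda>p. op_sem (Sel r c a b) m (R p)"
  from at have l: "i + 5 < length prog" and p0: "prog ! i = Const 1 0"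
    and p1: "prog ! (Suc i) = JumpZ c (i + 4)" and p2: "prog ! (i + 2) = Add r b 1"
    and p3: "prog ! (i + 3) = JumpZ 1 (i + 6)" and p4: "prog ! (i + 4) = Add r a 1"
    and p5: "prog ! (i + 5) = JumpZ 1 (i + 6)"
    by (auto simp: numeral_eq_Suc)
  obtain s1 where s1: "reaches prog P s 1 s1" "config P (\<lambda>_. Suc i) ?R1 m s1"
    using reaches_local_step[OF cfg, of prog] l p0 by auto
  have "\<exists>s'. reaches prog P s1 1 s' \<and> config P ?br ?R1 m s'"
  proof -
    have 1: "(\<lambda>p. next_pc (prog ! Suc i) (?R1 p) (Suc i)) = ?br"
      using p1 by auto
    have 2: "(\<lambda>p. next_reg (prog ! Suc i) m (?R1 p)) = ?R1"
      using p1 by auto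
    show ?thesis
      using reaches_local_step[OF s1(2), of prog, unfolded 1 2] l p1 by auto
  qed
  then obtain s2 where s2: "reaches prog P s1 1 s2" and c2: "config P ?br ?R1 m s2"
    by blast
  have "\<exists>s'. reaches prog P s2 1 s' \<and> config P (\<lambda>p. Suc (?br p)) ?R3 m s'"
  proof -
    have 1: "(\<lambda>p. next_pc (prog ! ?br p) (?R1 p) (?br p)) = (\<lambda>p. Suc (?br p))"
      using p2 p4 by auto
    have 2: "(\<lambda>p. next_reg (prog ! ?br p) m (?R1 p)) = ?R3"
      using p2 p4 r by (auto simp: fun_eq_iff)
    show ?thesis
      using reaches_local_step[OF c2, of prog, unfolded 1 2] l p2 p4 by auto
  qed
  then obtain s3 where s3: "reaches prog P s2 1 s3" and c3: "config P (\<lambda>p. Suc (?br p)) ?R3 m s3"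
    by blast
  have "\<exists>s'. reaches prog P s3 1 s' \<and> config P (\<lambda>p. i + 6) ?R3 m s'"
  proof -
    have at3: "prog ! Suc (?br p) = JumpZ 1 (i + 6)" for p
      using p3 p5 by (auto simp: numeral_eq_Suc)
    have 1: "(\<lambda>p. next_pc (prog ! Suc (?br p)) (?R3 p) (Suc (?br p))) = (\<lambda>p. i + 6)"
      unfolding at3 using r by auto
    have 2: "(\<lambda>p. next_reg (prog ! Suc (?br p)) m (?R3 p)) = ?R3"
      unfolding at3 by simp
    show ?thesis
      using reaches_local_step[OF c3, of prog, unfolded 1 2] l at3 by auto
  qed
  then obtain s4 where s4: "reaches prog P s3 1 s4" "config P (\<lambda>p. i + 6) ?R3 m s4"
    by blast
  show ?thesis
    using reaches_trans[OF reaches_trans[OF reaches_trans[OF s1(1) s2] s3] s4(1)] s4(2)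
    by (auto simp: numeral_eq_Suc)
qed

lemma reaches_op:
  assumes "code_at prog i (op_code i x)" "op_ok x" "config P (\<lambda>_. i) R m s"
  shows "\<exists>t s'. t \<le> 4 \<and> reaches prog P s t s' \<and>
    config P (\<lambda>_. i + length (op_code i x)) (\<lambda>p. op_sem x m (R p)) m s'"
proof (cases x)
  case (Op y)
  have "no_store y" "next_pc y \<rho> i = Suc i" for \<rho>
    using assms(2) Op by (cases y; simp)+
  then have "\<exists>s'. reaches prog P s 1 s' \<and> config P (\<lambda>_. Suc i) (\<lambda>p. next_reg y m (R p)) m s'"
    using reaches_local_step[OF assms(3), of prog] assms(1) Op by auto
  then obtain s' where "reaches prog P s 1 s'" "config P (\<lambda>_. Suc i) (\<lambda>p. next_reg y m (R p)) m s'"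
    by blast
  then show ?thesis using Op by (intro exI[of _ "1::nat"] exI[of _ s']) auto
next
  case (Sel r c a b)
  then obtain s' where "reaches prog P s 4 s'"
    "config P (\<lambda>_. i + 6) (\<lambda>p. op_sem (Sel r c a b) m (R p)) m s'"
    using reaches_sel[of prog i r c a b P R m s] assms by fastforce
  then show ?thesis using Sel by (intro exI[of _ "4::nat"] exI[of _ s']) (auto simp: numeral_eq_Suc)
qed

lemma reaches_block:
  assumes "code_at prog i (block_code i xs)" "list_all op_ok xs" "config P (\<lambda>_. i) R m s"
  shows "\<exists>t s'. t \<le> 4 * length xs \<and> reaches prog P s t s' \<and>
    config P (\<lambda>_. i + length (block_code i xs)) (\<lambda>p. block_sem xs m (R p)) m s'"
  using assms
proof (induction xs arbitrary: i R s)
  case Nil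
  then show ?case using reaches_0 by fastforce
next
  case (Cons x xs)
  obtain t1 s1 where 1: "t1 \<le> 4" "reaches prog P s t1 s1"
    "config P (\<lambda>_. i + length (op_code i x)) (\<lambda>p. op_sem x m (R p)) m s1"
    using reaches_op[of prog i x P R m s] Cons.prems by auto
  obtain t2 s2 where 2: "t2 \<le> 4 * length xs" "reaches prog P s1 t2 s2"
    "config P (\<lambda>_. i + length (op_code i x) + length (block_code (i + length (op_code i x)) xs))
       (\<lambda>p. block_sem xs m (op_sem x m (R p))) m s2"
    using Cons.IH[OF _ _ 1(3)] Cons.prems by auto
  then show ?case
    using reaches_trans[OF 1(2) 2(2)] 1(1)
    by (intro exI[of _ "t1 + t2"] exI[of _ s2]) (auto simp: add.assoc)
qed

lemma exec_sound:
  assumes "exec P c s t s'" "code_at prog i (code i c)" "com_ok c"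
    "config P (\<lambda>_. i) (fst s) (snd s) \<sigma>"
  shows "\<exists>t' \<sigma>'. t' \<le> t \<and> reaches prog P \<sigma> t' \<sigma>' \<and>
    config P (\<lambda>_. i + length (code i c)) (fst s') (snd s') \<sigma>'"
  using assms
proof (induction arbitrary: i \<sigma> rule: exec.induct)
  case (Block xs R m)
  then show ?case using reaches_block[of prog i xs P R m \<sigma>] by simp
next
  case (Put R v m)
  then show ?case using reaches_store[of P i R m \<sigma> prog v] by fastforce
next
  case (Seq c1 s t1 s' c2 t2 s'')
  obtain t1' \<sigma>1 where 1: "t1' \<le> t1" "reaches prog P \<sigma> t1' \<sigma>1"
    "config P (\<lambda>_. i + length (code i c1)) (fst s') (snd s') \<sigma>1"
    using Seq.IH(1)[OF _ _ Seq.prems(3)] Seq.prems by auto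
  obtain t2' \<sigma>2 where 2: "t2' \<le> t2" "reaches prog P \<sigma>1 t2' \<sigma>2"
    "config P (\<lambda>_. i + length (code i c1) + length (code (i + length (code i c1)) c2)) (fst s'') (snd s'') \<sigma>2"
    using Seq.IH(2)[OF _ _ 1(3)] Seq.prems by auto
  show ?case
    using reaches_trans[OF 1(2) 2(2)] 1(1) 2
    by (intro exI[of _ "t1' + t2'"] exI[of _ \<sigma>2]) (auto simp: add.assoc)
next
  case (WhileFalse R r c m)
  let ?e = "i + length (code (Suc i) c) + 3"
  have "\<exists>s'. reaches prog P \<sigma> 1 s' \<and> config P (\<lambda>_. ?e) R m s'"
    using reaches_local_step[OF WhileFalse.prems(3), of prog] WhileFalse by auto
  then obtain s' where "reaches prog P \<sigma> 1 s'" "config P (\<lambda>_. ?e) R m s'" by blast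
  then show ?case
    by (intro exI[of _ "1::nat"] exI[of _ s']) (auto simp: numeral_eq_Suc)
next
  case (WhileTrue R r c m t1 R' m' t2 s'')
  let ?j = "Suc i + length (code (Suc i) c)"
  have at: "code_at prog (Suc i) (code (Suc i) c)" "com_ok c" "i < length prog" "Suc ?j < length prog"
    "prog ! i = JumpZ r (i + length (code (Suc i) c) + 3)" "prog ! ?j = Const 1 0" "prog ! Suc ?j = JumpZ 1 i"
    using WhileTrue.prems by auto
  have "\<exists>s'. reaches prog P \<sigma> 1 s' \<and> config P (\<lambda>_. Suc i) R m s'"
    using reaches_local_step[OF WhileTrue.prems(3), of prog] WhileTrue.hyps(1) at by auto
  then obtain \<sigma>1 where 1: "reaches prog P \<sigma> 1 \<sigma>1" "config P (\<lambda>_. Suc i) R m \<sigma>1" by blast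
  obtain t1' \<sigma>2 where 2: "t1' \<le> t1" "reaches prog P \<sigma>1 t1' \<sigma>2" "config P (\<lambda>_. ?j) R' m' \<sigma>2"
    using WhileTrue.IH(1)[of "Suc i" \<sigma>1] at 1 by auto
  have "\<exists>s'. reaches prog P \<sigma>2 1 s' \<and> config P (\<lambda>_. Suc ?j) (\<lambda>p. (R' p)(1 := 0)) m' s'"
    using reaches_local_step[OF 2(3), of prog] at by auto
  then obtain \<sigma>3 where 3: "reaches prog P \<sigma>2 1 \<sigma>3" "config P (\<lambda>_. Suc ?j) (\<lambda>p. (R' p)(1 := 0)) m' \<sigma>3"
    by blast
  have "\<exists>s'. reaches prog P \<sigma>3 1 s' \<and> config P (\<lambda>_. i) (\<lambda>p. (R' p)(1 := 0)) m' s'"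
    using reaches_local_step[OF 3(2), of prog] at by auto
  then obtain \<sigma>4 where 4: "reaches prog P \<sigma>3 1 \<sigma>4" "config P (\<lambda>_. i) (\<lambda>p. (R' p)(1 := 0)) m' \<sigma>4"
    by blast
  obtain t2' \<sigma>5 where 5: "t2' \<le> t2" "reaches prog P \<sigma>4 t2' \<sigma>5"
    "config P (\<lambda>_. i + length (code i (While r c))) (fst s'') (snd s'') \<sigma>5"
    using WhileTrue.IH(2)[of i \<sigma>4, OF WhileTrue.prems(1,2)] 4(2) by (simp only: fst_conv snd_conv) blast
  show ?case
    using reaches_trans[OF reaches_trans[OF reaches_trans[OF reaches_trans[OF 1(1) 2(2)] 3(1)] 4(1)] 5(2)]
      2(1) 5(1,3)
    by (intro exI[of _ "1 + t1' + 1 + 1 + t2'"] exI[of _ \<sigma>5]) auto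
next
  case (Weaken c s t s' t')
  then show ?case by (meson order_trans)
qed

lemma decides_input_code:
  assumes ex: "exec P c (\<lambda>p r. if r = 0 then p else 0, shared (initial w)) t (R, m)"
    and ok: "com_ok c" and t: "real t \<le> T" and m: "m 0 = 1 \<longleftrightarrow> b"
  shows "decides_input (code 0 c) P T w b"
proof -
  have "code_at (code 0 c) 0 (code 0 c)" by (simp add: code_at_def)
  moreover have "config P (\<lambda>_. 0) (\<lambda>p r. if r = 0 then p else 0) (shared (initial w)) (initial w)"
    by (simp add: config_def initial_def)
  ultimately obtain t' \<sigma>' where "t' \<le> t" "reaches (code 0 c) P (initial w) t' \<sigma>'"
    "config P (\<lambda>_. length (code 0 c)) R m \<sigma>'"
    using exec_sound[OF ex, of "code 0 c" 0 "initial w"] ok by auto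
  then show ?thesis
    unfolding decides_input_def
    using t m by (intro exI[of _ t']) (auto simp: reaches_def config_def running_def)
qed

text \<open>\<open>S i\<close> is the state at the i-th arrival at the loop head; the reset of
  register 1 comes from the jump back.\<close>

lemma exec_while:
  assumes "\<And>i p. i < k \<Longrightarrow> fst (S i) p r \<noteq> 0" "\<And>p. fst (S k) p r = 0"
    and "\<And>i. i < k \<Longrightarrow> \<exists>R m. exec P c (S i) t (R, m) \<and> S (Suc i) = (\<lambda>p. (R p)(1 := 0), m)"
  shows "exec P (While r c) (S 0) (k * (t + 3) + 1) (S k)"
  using assms
proof (induction k arbitrary: S)
  case 0
  then show ?case using exec.WhileFalse[of "fst (S 0)" r P c "snd (S 0)"] by simp
next
  case (Suc k)
  obtain R m where 1: "exec P c (S 0) t (R, m)" "S 1 = (\<lambda>p. (R p)(1 := 0), m)"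
    using Suc.prems(3)[of 0] unfolding One_nat_def by blast
  have "exec P (While r c) (S 1) (k * (t + 3) + 1) (S (Suc k))"
    using Suc.IH[of "\<lambda>i. S (Suc i)"] Suc.prems by simp
  then have "exec P (While r c) (fst (S 0), snd (S 0)) (t + 3 + (k * (t + 3) + 1)) (S (Suc k))"
    using 1 Suc.prems(1)[of 0] by (intro exec.WhileTrue[where R' = R and m' = m]) auto
  then show ?case by (simp add: algebra_simps)
qed

section \<open>Rule 3 removes leaves\<close>

definition shift :: "nat \<Rightarrow> cell \<Rightarrow> cell" where
  "shift d u =
     (if d = 0 then (fst u + 1, snd u) else if d = 1 then (fst u, snd u + 1)
      else if d = 2 then (fst u, snd u - 1) else (fst u - 1, snd u))"

lemma shift_opposite: "d < 4 \<Longrightarrow> shift (3 - d) (shift d u) = u"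
  by (auto simp: shift_def)

lemma less_4_cases: "(d::nat) < 4 \<longleftrightarrow> d = 0 \<or> d = 1 \<or> d = 2 \<or> d = 3"
  by auto

lemma bij_betw_shift: "bij_betw (\<lambda>d. shift d u) {..<4} (neighbors u)"
proof (cases u)
  case (Pair i j)
  have "{..<4::nat} = {0, 1, 2, 3}" by auto
  then show ?thesis
    using Pair by (auto simp: bij_betw_def inj_on_def shift_def neighbors_eq)
qed

text \<open>With four neighbors, three active ones leave exactly one inactive: the inactive cells
  that change are the vertices of degree 1 in the inactive graph, and isolated ones persist.\<close>

lemma three_neighbors_iff:
  "(\<Sum>v\<in>neighbors u. of_bool (c v)) \<in> {3::nat} \<longleftrightarrow> card {d. d < 4 \<and> \<not> c (shift d u)} = 1"
proof -
  have "(\<Sum>v\<in>neighbors u. of_bool (c v)) = (\<Sum>d<4. of_bool (c (shift d u)) :: nat)"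
    by (rule sum.reindex_bij_betw[OF bij_betw_shift, symmetric])
  also have "\<dots> = card {d \<in> {..<4}. c (shift d u)}"
    by (simp add: Int_def)
  finally have 1: "(\<Sum>v\<in>neighbors u. of_bool (c v)) = card {d \<in> {..<4}. c (shift d u)}" .
  have "card {d \<in> {..<4::nat}. c (shift d u)} + card {d \<in> {..<4}. \<not> c (shift d u)} = card {..<4::nat}"
    by (subst card_Un_disjoint[symmetric]) (auto intro!: arg_cong[where f = card] simp del: card_lessThan)
  then show ?thesis using 1 by auto
qed

text \<open>
  \<open>branch c s u d\<close>: some non-backtracking walk through \<open>s\<close> edges of the graph of inactive cells
  starts at \<open>u\<close> in direction \<open>d\<close>. The direction opposite to \<open>d\<close> is \<open>3 - d\<close>.
\<close>
fun branch :: "configuration \<Rightarrow> nat \<Rightarrow> cell \<Rightarrow> nat \<Rightarrow> bool" where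
  "branch c 0 u d = True"
| "branch c (Suc s) u d =
     (\<not> c u \<and> \<not> c (shift d u) \<and> (s = 0 \<or> (\<exists>e<4. e \<noteq> 3 - d \<and> branch c s (shift d u) e)))"

lemma branch_antimono: "branch c s u d \<Longrightarrow> r \<le> s \<Longrightarrow> branch c r u d"
proof (induction s arbitrary: r u d)
  case (Suc s)
  show ?case
  proof (cases r)
    case (Suc r')
    have *: "branch c r' (shift d u) e" if "branch c s (shift d u) e" for e
      using Suc.IH[of "shift d u" e r'] that Suc.prems(2) Suc by simp
    show ?thesis
    proof (cases "r' = 0")
      case False
      then have "s \<noteq> 0" using Suc.prems(2) Suc by auto
      then show ?thesis using Suc.prems(1) Suc * by (simp only: branch.simps) blast
    qed (use Suc.prems(1) Suc in simp)
  qed simp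
qed simp

lemma card_ne_1_other:
  assumes "card {d. d < (4::nat) \<and> Q d} \<noteq> 1" "e < 4" "Q e"
  shows "\<exists>d<4. d \<noteq> e \<and> Q d"
proof (rule ccontr)
  assume "\<not> ?thesis"
  then have "{d. d < 4 \<and> Q d} = {e}" using assms by auto
  then show False using assms by simp
qed

lemma ex_neq_less_4: "\<exists>e<4. e \<noteq> (d::nat)"
  by (rule exI[of _ "if d = 0 then 1 else 0"]) auto

text \<open>The induction step in time: the hypotheses on \<open>u\<close> say that it is still
  inactive at time \<open>t\<close>, the left side says the same of its neighbor \<open>v\<close>. A
  leaf removed at \<open>v\<close> must come from a shortage of branches leading away from
  \<open>u\<close>, because the survival of \<open>u\<close> always provides a long enough branch
  from \<open>v\<close> back through \<open>u\<close>.\<close>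

lemma branch_neighbor_iff:
  assumes u: "\<not> c u" "\<And>s. 1 \<le> s \<Longrightarrow> s \<le> t \<Longrightarrow> card {d. d < 4 \<and> branch c s u d} \<noteq> 1"
    and d: "d < 4" and v: "v = shift d u"
  shows "\<not> c v \<and> (\<forall>s. 1 \<le> s \<and> s \<le> t \<longrightarrow> card {e. e < 4 \<and> branch c s v e} \<noteq> 1) \<longleftrightarrow>
    branch c (Suc t) u d"
proof
  have vu: "shift (3 - d) v = u" using d v shift_opposite by simp
  assume b: "branch c (Suc t) u d"
  have "card {e. e < 4 \<and> branch c s v e} \<noteq> 1" if s: "1 \<le> s" "s \<le> t" for s
  proof -
    obtain e where e: "e < 4" "e \<noteq> 3 - d" "branch c s v e"
      using b s v branch_antimono[of c t v _ s] by auto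
    obtain s' where s': "s = Suc s'" using s by (cases s) auto
    have "\<exists>e<4. e \<noteq> d \<and> branch c s' u e"
    proof (cases s')
      case 0
      then show ?thesis using ex_neq_less_4 by simp
    next
      case (Suc s'')
      have "branch c s' u d" using b s s' by (intro branch_antimono[OF b]) auto
      then show ?thesis using card_ne_1_other[OF u(2)[of s'], of d] d s s' Suc by auto
    qed
    then have "branch c s v (3 - d)"
      using s' vu u(1) b v d by auto
    then have "e \<in> {e. e < 4 \<and> branch c s v e}" "3 - d \<in> {e. e < 4 \<and> branch c s v e}"
      using e by auto
    with e(2) show ?thesis by (metis card_1_singletonE singletonD)
  qed
  then show "\<not> c v \<and> (\<forall>s. 1 \<le> s \<and> s \<le> t \<longrightarrow> card {e. e < 4 \<and> branch c s v e} \<noteq> 1)"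
    using b v by auto
next
  have vu: "shift (3 - d) v = u" using d v shift_opposite by simp
  assume a: "\<not> c v \<and> (\<forall>s. 1 \<le> s \<and> s \<le> t \<longrightarrow> card {e. e < 4 \<and> branch c s v e} \<noteq> 1)"
  show "branch c (Suc t) u d"
  proof (rule ccontr)
    assume nb: "\<not> branch c (Suc t) u d"
    let ?Q = "\<lambda>j. \<not> (\<exists>e<4. e \<noteq> 3 - d \<and> branch c j v e)"
    have Qt: "?Q t" and t: "t \<noteq> 0" using nb a u v by auto
    \<comment> \<open>The least length that branches at \<open>v\<close> avoiding \<open>u\<close>
      miss. Length \<open>j - 1\<close> is still attained, so \<open>u\<close> has a branch through
      \<open>v\<close> and hence another of length \<open>j - 1\<close> away from \<open>v\<close>.
      Then \<open>3 - d\<close> is the only direction at \<open>v\<close> with a branch of length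
      \<open>j\<close>.\<close>
    define j where "j = (LEAST j. ?Q j)"
    have Qj: "?Q j" using LeastI[of ?Q, OF Qt] unfolding j_def .
    have jt: "j \<le> t" using Least_le[of ?Q, OF Qt] unfolding j_def .
    have j0: "j \<noteq> 0" using Qj ex_neq_less_4 by (metis branch.simps(1))
    then obtain j' where j': "j = Suc j'" by (cases j) auto
    have "\<exists>e<4. e \<noteq> 3 - d \<and> branch c j' v e"
      using not_less_Least[of j' ?Q] j' unfolding j_def by auto
    then have "branch c (Suc j') u d" using u a v by auto
    then have bj: "branch c j' u d" by (rule branch_antimono) simp
    have "\<exists>e<4. e \<noteq> d \<and> branch c j' u e"
    proof (cases j')
      case 0
      then show ?thesis using ex_neq_less_4 by simp
    next
      case (Suc j'')
      then show ?thesis using card_ne_1_other[OF u(2)[of j'], of d] d jt j' bj by auto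
    qed
    then have "branch c j v (3 - d)" using j' vu u(1) a d by auto
    then have "{e. e < 4 \<and> branch c j v e} = {3 - d}" using Qj by auto
    then have "card {e. e < 4 \<and> branch c j v e} = 1" by simp
    then show False using a j0 jt by auto
  qed
qed

lemma all_le_Suc: "(\<forall>s. 1 \<le> s \<and> s \<le> Suc t \<longrightarrow> Q s) \<longleftrightarrow> (\<forall>s. 1 \<le> s \<and> s \<le> t \<longrightarrow> Q s) \<and> Q (Suc t)"
  by (auto simp: le_Suc_eq)

text \<open>The neighbors of a surviving \<open>u\<close> that are inactive at time \<open>t\<close>
  are those in directions with a branch of length \<open>t + 1\<close>. So an initially inactive
  cell turns active at the first \<open>s\<close> for which exactly one direction has a branch of
  length \<open>s\<close>.\<close>

lemma inactive_iff:
  "\<not> (global_rule {3} ^^ t) c u \<longleftrightarrow>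
     \<not> c u \<and> (\<forall>s. 1 \<le> s \<and> s \<le> t \<longrightarrow> card {d. d < 4 \<and> branch c s u d} \<noteq> 1)"
proof (induction t arbitrary: u)
  case (Suc t)
  let ?F = "(global_rule {3} ^^ t) c"
  have "\<not> (global_rule {3} ^^ Suc t) c u \<longleftrightarrow> \<not> ?F u \<and> card {d. d < 4 \<and> \<not> ?F (shift d u)} \<noteq> 1"
    by (simp add: global_rule_def three_neighbors_iff[simplified])
  also have "\<dots> \<longleftrightarrow> \<not> ?F u \<and> card {d. d < 4 \<and> branch c (Suc t) u d} \<noteq> 1"
  proof (rule conj_cong[OF refl])
    assume "\<not> ?F u"
    then have "\<not> ?F (shift d u) \<longleftrightarrow> branch c (Suc t) u d" if "d < 4" for d
      using branch_neighbor_iff[of c u t d "shift d u"] that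
      unfolding Suc.IH by blast
    then show "(card {d. d < 4 \<and> \<not> ?F (shift d u)} \<noteq> 1) =
      (card {d. d < 4 \<and> branch c (Suc t) u d} \<noteq> 1)"
      by (metis (mono_tags, lifting) Collect_cong)
  qed
  also have "\<dots> \<longleftrightarrow> \<not> c u \<and> (\<forall>s. 1 \<le> s \<and> s \<le> Suc t \<longrightarrow> card {d. d < 4 \<and> branch c s u d} \<noteq> 1)"
    unfolding Suc.IH all_le_Suc[of t "\<lambda>s. card {d. d < 4 \<and> branch c s u d} \<noteq> 1"] by blast
  finally show ?case .
next
  case 0
  have "\<not> (1 \<le> s \<and> s \<le> 0)" for s :: nat by simp
  then show ?case unfolding funpow_0 by blast
qed

lemma stable_iff:
  "stable {3} c u \<longleftrightarrow> \<not> c u \<and> (\<forall>s\<ge>1. card {d. d < 4 \<and> branch c s u d} \<noteq> 1)"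
  unfolding stable_def inactive_iff by blast

section \<open>The torus\<close>

definition torus_index :: "nat \<Rightarrow> cell \<Rightarrow> nat" where
  "torus_index n u = nat (fst u mod int n) * n + nat (snd u mod int n)"

definition wrap :: "nat \<Rightarrow> nat \<Rightarrow> nat" where
  "wrap n z = (if z < n * n then z else z - n * n)"

text \<open>Phrased with addition, truncated subtraction, comparison and the single remainder
  \<open>v mod n\<close>, since the machine evaluates this very formula. Additions come before
  subtractions, so that on valid indices nothing is truncated.\<close>

definition torus_shift :: "nat \<Rightarrow> nat \<Rightarrow> nat \<Rightarrow> nat" where
  "torus_shift n d v =
     (if d = 0 then wrap n (v + n)
      else if d = 1 then if v mod n + 1 = n then v + 1 - n else v + 1
      else if d = 2 then if v mod n = 0 then v + n - 1 else v - 1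
      else wrap n (v + n * n - n))"

lemma torus_index_less: "0 < n \<Longrightarrow> torus_index n u < n * n"
proof -
  assume n: "0 < n"
  then have "nat (fst u mod int n) < n" "nat (snd u mod int n) < n"
    by (auto simp: nat_less_iff)
  then have "nat (fst u mod int n) * n + nat (snd u mod int n) < nat (fst u mod int n) * n + n"
    by simp
  also have "\<dots> = Suc (nat (fst u mod int n)) * n" by simp
  also have "\<dots> \<le> n * n" using \<open>nat (fst u mod int n) < n\<close> by (intro mult_le_mono1) simp
  finally show ?thesis by (simp add: torus_index_def)
qed

lemma nat_Suc_mod:
  assumes "0 < n"
  shows "nat ((i + 1) mod int n) = (if nat (i mod int n) + 1 = n then 0 else nat (i mod int n) + 1)"
proof -
  have "(i + 1) mod int n = (i mod int n + 1) mod int n" by (simp add: mod_add_left_eq)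
  moreover have "0 \<le> i mod int n" "i mod int n < int n" using assms by auto
  ultimately show ?thesis by (cases "i mod int n + 1 = int n") (auto simp: nat_add_distrib)
qed

lemma nat_pred_mod:
  assumes "0 < n"
  shows "nat ((i - 1) mod int n) = (if nat (i mod int n) = 0 then n - 1 else nat (i mod int n) - 1)"
proof -
  have "(i - 1) mod int n = (i mod int n - 1) mod int n" by (simp add: mod_diff_left_eq)
  moreover have "0 \<le> i mod int n" "i mod int n < int n" using assms by auto
  moreover have "(- 1) mod int n = int n - 1" using assms by (simp add: zmod_minus1)
  ultimately show ?thesis by (cases "i mod int n = 0") (auto simp: nat_diff_distrib)
qed

lemma torus_shift_index:
  assumes n: "0 < n" and d: "d < 4"
  shows "torus_shift n d (torus_index n u) = torus_index n (shift d u)"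
proof -
  define i j where ij: "i = nat (fst u mod int n)" "j = nat (snd u mod int n)"
  have b: "i < n" "j < n" using n by (auto simp: ij nat_less_iff)
  have v: "torus_index n u = i * n + j" by (simp add: torus_index_def ij)
  have m: "(i * n + j) mod n = j" using b by simp
  have lt: "(i * n + j + n < n * n) = (i + 1 < n)"
  proof
    assume "i * n + j + n < n * n"
    then have "(i + 1) * n < n * n" by (simp add: algebra_simps)
    then show "i + 1 < n" by (simp only: mult_less_cancel2)
  next
    assume "i + 1 < n"
    then have "(i + 2) * n \<le> n * n" by (intro mult_le_mono1) simp
    then have "i * n + 2 * n \<le> n * n" by (simp only: add_mult_distrib)
    then show "i * n + j + n < n * n" using b by linarith
  qed
  consider "d = 0" | "d = 1" | "d = 2" | "d = 3" using d less_4_cases[of d] by blast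
  then show ?thesis
  proof cases
    case 1
    have "torus_index n (shift d u) = (if i + 1 = n then 0 else i + 1) * n + j"
      unfolding ij nat_Suc_mod[OF n, symmetric] using 1 by (simp add: torus_index_def shift_def)
    moreover have "torus_shift n d (torus_index n u) = (if i + 1 < n then i * n + j + n else i * n + j + n - n * n)"
      using 1 lt by (simp add: torus_shift_def v wrap_def)
    moreover have "i * n + j + n - n * n = j" if "i + 1 = n"
    proof -
      have "i * n + n = n * n" using that by (metis add_mult_distrib mult_1)
      then show ?thesis by linarith
    qed
    moreover have "(i + 1) * n + j = i * n + j + n" by simp
    ultimately show ?thesis
    proof (cases "i + 1 = n")
      case False
      then have "i + 1 < n" using b by simp
      then show ?thesis
        using \<open>torus_index n (shift d u) = _\<close> \<open>torus_shift n d (torus_index n u) = _\<close> by simp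
    qed simp
  next
    case 2
    have "torus_index n (shift d u) = i * n + (if j + 1 = n then 0 else j + 1)"
      unfolding ij nat_Suc_mod[OF n, symmetric] using 2 by (simp add: torus_index_def shift_def)
    moreover have "torus_shift n d (i * n + j) = (if j + 1 = n then i * n + j + 1 - n else i * n + j + 1)"
      using 2 m by (simp add: torus_shift_def)
    ultimately show ?thesis by (cases "j + 1 = n") (simp_all add: v)
  next
    case 3
    have "torus_index n (shift d u) = i * n + (if j = 0 then n - 1 else j - 1)"
      unfolding ij nat_pred_mod[OF n, symmetric] using 3 by (simp add: torus_index_def shift_def)
    moreover have "torus_shift n d (i * n + j) = (if j = 0 then i * n + j + n - 1 else i * n + j - 1)"
      using 3 m by (simp add: torus_shift_def)
    ultimately show ?thesis using n by (cases "j = 0") (simp_all add: v)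
  next
    case 4
    have 0: "torus_index n (shift d u) = (if i = 0 then n - 1 else i - 1) * n + j"
      unfolding ij nat_pred_mod[OF n, symmetric] using 4 by (simp add: torus_index_def shift_def)
    show ?thesis
    proof (cases i)
      case 0
      have "j + n * n - n = (n - 1) * n + j"
        using n by (cases n) auto
      moreover have "j + n * n - n < n * n" using b by (cases n) auto
      ultimately show ?thesis using 4 0 \<open>torus_index n (shift d u) = _\<close>
        by (simp add: torus_shift_def v wrap_def)
    next
      case (Suc i')
      have "i * n + j + n * n - n = n * n + (i' * n + j)" using Suc by (simp add: algebra_simps)
      then show ?thesis using 4 0 Suc by (simp add: torus_shift_def v wrap_def)
    qed
  qed
qed

section \<open>Branches on the torus and their stabilization\<close>

fun torus_branch :: "nat \<Rightarrow> (nat \<Rightarrow> bool) \<Rightarrow> nat \<Rightarrow> nat \<Rightarrow> nat \<Rightarrow> bool" where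
  "torus_branch n X 0 v d = True"
| "torus_branch n X (Suc s) v d =
     (\<not> X v \<and> \<not> X (torus_shift n d v) \<and>
      (s = 0 \<or> (\<exists>e<4. e \<noteq> 3 - d \<and> torus_branch n X s (torus_shift n d v) e)))"

lemma branch_torus:
  assumes "0 < n" "\<And>u. c u = X (torus_index n u)"
  shows "d < 4 \<Longrightarrow> branch c s u d = torus_branch n X s (torus_index n u) d"
proof (induction s arbitrary: u d)
  case (Suc s)
  have "(\<exists>e<4. e \<noteq> 3 - d \<and> branch c s (shift d u) e) \<longleftrightarrow>
    (\<exists>e<4. e \<noteq> 3 - d \<and> torus_branch n X s (torus_index n (shift d u)) e)"
    using Suc.IH[of _ "shift d u"] by blast
  then show ?case
    unfolding branch.simps torus_branch.simps assms(2) torus_shift_index[OF assms(1) Suc.prems] by (rule arg_cong2[OF refl])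
qed simp

text \<open>Each strict inclusion costs an element, so two consecutive sets agree early; as each set
  is a function of its predecessor, the sequence is constant from there on.\<close>

lemma decseq_stabilizes:
  fixes A :: "nat \<Rightarrow> 'a set"
  assumes fin: "finite (A 0)" and dec: "\<And>s. A (Suc s) \<subseteq> A s" and step: "\<And>s. A (Suc s) = G (A s)"
    and m: "card (A 0) \<le> m" "m \<le> s"
  shows "A s = A m"
proof -
  have sub: "A s \<subseteq> A 0" for s using dec by (induction s) auto
  have stay: "A (k + i) = A k" if "A (Suc k) = A k" for k i
    using that by (induction i) (simp_all add: step)
  have "\<exists>k\<le>m. A (Suc k) = A k"
  proof (rule ccontr)
    assume "\<not> ?thesis"
    then have ps: "A (Suc k) \<subset> A k" if "k \<le> m" for k using dec that by blast
    have "k \<le> Suc m \<Longrightarrow> card (A k) + k \<le> card (A 0)" for k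
    proof (induction k)
      case (Suc k)
      have "card (A (Suc k)) < card (A k)"
        using ps[of k] Suc.prems finite_subset[OF sub fin] by (intro psubset_card_mono) auto
      then show ?case using Suc by simp
    qed simp
    from this[of "Suc m"] m show False by simp
  qed
  then obtain k where "k \<le> m" "A (Suc k) = A k" by blast
  then show ?thesis using stay[of k "s - k"] stay[of k "m - k"] m by simp
qed

lemma torus_branch_antimono: "torus_branch n X (Suc s) v d \<Longrightarrow> torus_branch n X s v d"
  by (induction s arbitrary: v d) auto

lemma torus_shift_less:
  assumes "v < n * n" "d < 4" shows "torus_shift n d v < n * n"
proof -
  have n: "0 < n" using assms(1) by (cases n) auto
  have "v = torus_index n (int (v div n), int (v mod n))"
    using assms n by (simp add: torus_index_def less_mult_imp_div_less flip: of_nat_mod)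
  then show ?thesis using torus_shift_index[OF n assms(2)] torus_index_less[OF n] by metis
qed

lemma torus_branch_stabilizes:
  assumes "v < n * n" "d < 4" "4 * (n * n) + 1 \<le> m" "m \<le> s"
  shows "torus_branch n X s v d = torus_branch n X m v d"
proof -
  \<comment> \<open>Length \<open>s\<close> corresponds to \<open>A (s - 1)\<close>. This shift is
    the 1 added to the number \<open>4 * (n * n)\<close> of darts in the bound.\<close>
  define A where "A = (\<lambda>s. {(v, d). v < n * n \<and> d < 4 \<and> torus_branch n X (Suc s) v d})"
  have "finite ({..<n * n} \<times> {..<4::nat})" by simp
  moreover have sub: "A 0 \<subseteq> {..<n * n} \<times> {..<4}" by (auto simp: A_def)
  ultimately have "finite (A 0)" "card (A 0) \<le> card ({..<n * n} \<times> {..<4::nat})"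
    by (rule finite_subset[rotated]) (rule card_mono, simp, rule sub)
  moreover have "A (Suc s) \<subseteq> A s" for s
    using torus_branch_antimono unfolding A_def by blast
  moreover have "A (Suc s) = (\<lambda>B. {(v, d). v < n * n \<and> d < 4 \<and> \<not> X v \<and> \<not> X (torus_shift n d v) \<and>
      (\<exists>e<4. e \<noteq> 3 - d \<and> (torus_shift n d v, e) \<in> B)}) (A s)" for s
    using torus_shift_less by (auto simp: A_def)
  ultimately have "A (s - 1) = A (m - 1)"
    using assms by (intro decseq_stabilizes) auto
  then have "(v, d) \<in> A (s - 1) \<longleftrightarrow> (v, d) \<in> A (m - 1)" by simp
  moreover have "Suc (s - 1) = s" "Suc (m - 1) = m" using assms(3,4) by linarith+
  ultimately show ?thesis using assms by (simp add: A_def del: torus_branch.simps)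
qed

text \<open>Makes the criterion finite: for every length from \<open>m\<close> on, the set of
  directions with a branch is the one at \<open>m - 1\<close>.\<close>

lemma stable_torus_iff:
  assumes n: "0 < n" and X: "\<And>u. c u = X (torus_index n u)" and m: "4 * (n * n) + 1 < m"
  shows "stable {3} c u \<longleftrightarrow> \<not> X (torus_index n u) \<and>
    (\<forall>s. 1 \<le> s \<and> s < m \<longrightarrow> card {d. d < 4 \<and> torus_branch n X s (torus_index n u) d} \<noteq> 1)"
proof -
  let ?B = "\<lambda>s. {d. d < 4 \<and> torus_branch n X s (torus_index n u) d}"
  have "?B s = ?B (m - 1)" if "m \<le> s" for s
  proof -
    have "torus_branch n X s (torus_index n u) d = torus_branch n X (m - 1) (torus_index n u) d"
      if "d < 4" for d
      using torus_index_less[OF n] that m \<open>m \<le> s\<close> by (intro torus_branch_stabilizes) auto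
    then show ?thesis by blast
  qed
  then have "card (?B s) \<noteq> 1" if "\<forall>s. 1 \<le> s \<and> s < m \<longrightarrow> card (?B s) \<noteq> 1" "1 \<le> s" for s
    using that m by (cases "s < m") auto
  moreover have "{d. d < 4 \<and> branch c s u d} = ?B s" for s
    using branch_torus[of n c X, OF n X] by blast
  ultimately show ?thesis
    unfolding stable_iff X by auto
qed

section \<open>Longest walks by repeated squaring\<close>

locale walk_table =
  fixes W N :: nat and E :: "(nat \<times> nat) set" and q :: nat and val :: "nat \<Rightarrow> nat"
  assumes N: "N = 2 ^ W"
    and E_less: "\<And>a b. (a, b) \<in> E \<Longrightarrow> a < N \<and> b < N"
    and E_q: "\<And>a b. (a, b) \<in> E \<Longrightarrow> a \<noteq> q \<and> b \<noteq> q"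
begin

text \<open>In ordinary rows the edge indicator sits at every heap position: 1 is the length of a
  walk from \<open>a\<close> to \<open>b\<close> wherever it is stored. In row \<open>q\<close> only
  the leaves carry values.\<close>

definition base :: "nat \<Rightarrow> nat \<Rightarrow> nat \<Rightarrow> nat" where
  "base a b m = (if a = q then if m < N then 0 else val (m mod N) else of_bool ((a, b) \<in> E))"

text \<open>
  For every pair of nodes, a binary heap with root 1 and with the leaf \<open>N + c\<close> for the middle node \<open>c\<close>
  computes a maximum over the possible middle nodes of a walk. The row of the node \<open>q\<close>, which lies on no
  walk, computes a sum instead. The entry 0 means that there is no walk.
\<close>
fun tab :: "nat \<Rightarrow> nat \<Rightarrow> nat \<Rightarrow> nat \<Rightarrow> nat" where
  "tab 0 a b m = 0"
| "tab (Suc r) a b m = max (base a b m)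
     (if m < N then
        if a = q then tab r a b (2 * m) + tab r a b (2 * m + 1)
        else max (tab r a b (2 * m)) (tab r a b (2 * m + 1))
      else if a = q \<or> tab r a (m mod N) 1 = 0 \<or> tab r (m mod N) b 1 = 0 then 0
      else tab r a (m mod N) 1 + tab r (m mod N) b 1)"

text \<open>Holds for every entry in every round, since each update keeps the length of a walk or
  concatenates two. Rounds therefore need no division into separate squarings.\<close>

lemma tab_sound:
  assumes "a \<noteq> q" "tab r a b m > 0"
  shows "(a, b) \<in> E ^^ tab r a b m"
  using assms
proof (induction r arbitrary: a b m)
  case (Suc r)
  let ?c = "m mod N"
  show ?case
  proof (cases "tab (Suc r) a b m = base a b m")
    case True
    then have "base a b m = 1 \<and> (a, b) \<in> E"
      using Suc.prems by (auto simp: base_def split: if_splits)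
    then show ?thesis using True by simp
  next
    case False
    show ?thesis
    proof (cases "m < N")
      case True
      then have "tab (Suc r) a b m = tab r a b (2 * m) \<or> tab (Suc r) a b m = tab r a b (2 * m + 1)"
        using False Suc.prems(1) by (auto simp: max_def split: if_splits)
      then show ?thesis using Suc.IH Suc.prems by metis
    next
      case m: False
      then have 1: "tab r a ?c 1 > 0" "tab r ?c b 1 > 0" "tab (Suc r) a b m = tab r a ?c 1 + tab r ?c b 1"
        using False Suc.prems by (auto simp: max_def split: if_splits)
      then have ac: "(a, ?c) \<in> E ^^ tab r a ?c 1" using Suc.IH Suc.prems(1) by blast
      \<comment> \<open>The middle node ends a walk of positive length, so it is the end of an edge;
        its row then falls under the induction hypothesis.\<close>
      then have "?c \<noteq> q"
        using 1(1) E_q by (cases "tab r a ?c 1") auto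
      then have "(?c, b) \<in> E ^^ tab r ?c b 1" using Suc.IH 1(2) by blast
      then show ?thesis using ac unfolding 1(3) relpow_add by blast
    qed
  qed
qed simp

text \<open>A value climbs one level of the heap per round. Requiring the bound at the leaf in all
  rounds from \<open>r0\<close> on takes the place of monotonicity of the entries.\<close>

lemma tab_leaf_to_root:
  assumes "a \<noteq> q" "N \<le> m" "m < 2 * N" "\<And>r. r0 \<le> r \<Longrightarrow> s \<le> tab r a b m"
  shows "r0 + W \<le> r \<Longrightarrow> s \<le> tab r a b 1"
proof -
  have "j \<le> W \<Longrightarrow> r0 + j \<le> r \<Longrightarrow> s \<le> tab r a b (m div 2 ^ j)" for j
  proof (induction j arbitrary: r)
    case 0
    then show ?case using assms(4) by simp
  next
    case (Suc j)
    let ?x = "m div 2 ^ j"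
    obtain r' where r': "r = Suc r'" using Suc.prems by (cases r) auto
    then have IH: "s \<le> tab r' a b ?x" using Suc by simp
    have div2: "m div 2 ^ Suc j = ?x div 2" by (metis div_mult2_eq power_Suc2)
    have "2 * N \<le> N * 2 ^ Suc j" by simp
    then have "m < N * 2 ^ Suc j" using assms(3) by linarith
    then have lt: "m div 2 ^ Suc j < N" by (simp add: less_mult_imp_div_less)
    have "y = 2 * (y div 2) \<or> y = 2 * (y div 2) + 1" for y :: nat by presburger
    from this[of ?x] have "s \<le> max (tab r' a b (2 * (?x div 2))) (tab r' a b (2 * (?x div 2) + 1))"
      by (metis IH max.coboundedI1 max.coboundedI2)
    then show ?case using lt assms(1) unfolding r' div2 by auto
  qed
  from this[of W] have "r0 + W \<le> r \<Longrightarrow> s \<le> tab r a b (m div 2 ^ W)" by simp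
  moreover have "m div 2 ^ W = 1"
    using assms(2,3) N by (intro div_nat_eqI) auto
  ultimately show "r0 + W \<le> r \<Longrightarrow> s \<le> tab r a b 1" by simp
qed

text \<open>Halving the walk leaves two walks covered by the previous stage. Their sum reaches the
  leaf of the middle node in one round and the root in \<open>W\<close> more, within the
  \<open>W + 2\<close> rounds allotted to a doubling.\<close>

lemma tab_complete:
  assumes "(a, b) \<in> E ^^ s" "1 \<le> s" "s \<le> 2 ^ k" "(k + 1) * (W + 2) \<le> r"
  shows "s \<le> tab r a b 1"
  using assms
proof (induction k arbitrary: a b s r)
  case (0)
  then have "(a, b) \<in> E" "s = 1" by auto
  moreover obtain r' where "r = Suc r'" using 0 by (cases r) auto
  ultimately show ?case using E_q by (auto simp: base_def le_max_iff_disj)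
next
  case (Suc k)
  show ?case
  proof (cases "s = 1")
    case True
    moreover obtain r' where "r = Suc r'" using Suc by (cases r) auto
    ultimately show ?thesis using E_q Suc.prems by (auto simp: base_def le_max_iff_disj)
  next
    case False
    define s1 s2 where "s1 = s div 2" and "s2 = s - s div 2"
    have s: "s = s1 + s2" "1 \<le> s1" "1 \<le> s2" "s1 \<le> 2 ^ k" "s2 \<le> 2 ^ k"
      using False Suc.prems(2,3) by (auto simp: s1_def s2_def)
    then obtain c where c: "(a, c) \<in> E ^^ s1" "(c, b) \<in> E ^^ s2"
      using Suc.prems(1) by (auto simp: relpow_add)
    have cN: "c < N"
      using c(1) s(2) E_less by (cases s1) auto
    have aq: "a \<noteq> q"
      using c(1) s(2) E_q by (metis Suc_le_D One_nat_def relpow_Suc_D2)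
    have "s \<le> tab r' a b (N + c)" if r': "(k + 1) * (W + 2) + 1 \<le> r'" for r'
    proof -
      obtain r'' where r'': "r' = Suc r''" using r' by (cases r') auto
      then have "s1 \<le> tab r'' a c 1" "s2 \<le> tab r'' c b 1"
        using Suc.IH[OF c(1), of r''] Suc.IH[OF c(2), of r''] s r' by auto
      then show ?thesis using s aq cN by (simp add: r'' le_max_iff_disj)
    qed
    from tab_leaf_to_root[OF aq _ _ this, of "(k + 1) * (W + 2) + 1" r] cN Suc.prems(4)
    show ?thesis by (simp add: algebra_simps)
  qed
qed

text \<open>A position of height \<open>h\<close> lies above the leaves from
  \<open>m * 2 ^ h\<close> on, and subtracting \<open>N\<close> turns leaves into nodes. Inner
  positions have base 0 and are recomputed in each round, so the sum does not accumulate over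
  rounds.\<close>

lemma tab_q:
  assumes "2 ^ (W - h) \<le> m" "m < 2 ^ Suc (W - h)" "h \<le> W" "h < r"
  shows "tab r q b m = (\<Sum>c = m * 2 ^ h - N..<(m + 1) * 2 ^ h - N. val c)"
  using assms
proof (induction h arbitrary: m r)
  case 0
  then obtain r' where "r = Suc r'" by (cases r) auto
  moreover have "N \<le> m" "m < 2 * N" using 0 N by auto
  moreover have "m mod N = m - N" using \<open>N \<le> m\<close> \<open>m < 2 * N\<close> by (simp add: mod_if)
  moreover have "Suc m - N = Suc (m - N)" using \<open>N \<le> m\<close> by simp
  ultimately show ?case by (simp add: base_def)
next
  case (Suc h)
  then obtain r' where r': "r = Suc r'" by (cases r) auto
  have p: "(2::nat) ^ (W - h) = 2 * 2 ^ (W - Suc h)"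
    using Suc.prems(3) by (metis Suc_diff_Suc Suc_le_lessD power_Suc)
  have "(2::nat) ^ (W - h) \<le> 2 ^ W" by simp
  then have mN: "m < N" using Suc.prems(2) p N by simp
  have le: "N \<le> m * 2 ^ Suc h"
  proof -
    have "N = 2 ^ (W - Suc h) * 2 ^ Suc h" using Suc.prems(3) N by (metis le_add_diff_inverse2 power_add)
    then show ?thesis using Suc.prems(1) by (metis mult_le_mono1)
  qed
  have "tab r' q b (2 * m) = (\<Sum>c = 2 * m * 2 ^ h - N..<(2 * m + 1) * 2 ^ h - N. val c)"
    using Suc.prems r' p by (intro Suc.IH) auto
  moreover have "tab r' q b (2 * m + 1) = (\<Sum>c = (2 * m + 1) * 2 ^ h - N..<(2 * m + 1 + 1) * 2 ^ h - N. val c)"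
    using Suc.prems r' p by (intro Suc.IH) auto
  ultimately have "tab r q b m = (\<Sum>c = 2 * m * 2 ^ h - N..<(2 * m + 1 + 1) * 2 ^ h - N. val c)"
    using mN r' by (simp add: base_def) (intro sum.atLeastLessThan_concat diff_le_mono, auto)
  then show ?case by (simp add: algebra_simps)
qed

lemma tab_q_root: "W < r \<Longrightarrow> tab r q b 1 = (\<Sum>c<N. val c)"
  using tab_q[of W 1 r b] N by (simp add: atLeast0LessThan)

end

section \<open>Walks of darts\<close>

text \<open>
  The nodes are the numbers \<open>d * V + v\<close> with \<open>d < 16\<close> and \<open>v < V\<close>. For \<open>d < 4\<close> the node is the dart that leaves
  the cell \<open>v\<close> in direction \<open>d\<close>, provided that both ends are inactive; \<open>d = 4\<close> is a sink, reached from every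
  such dart; \<open>d = 5 + k\<close> is a source whose only successor is the dart of direction \<open>k\<close> at the queried cell.
  A longest walk from this source to the sink thus measures the branch of the queried cell in direction \<open>k\<close>.
  The node \<open>9 * V\<close> is isolated; its row of the table counts the queried cells, active ones twice.
\<close>
definition dart_edge :: "nat \<Rightarrow> (nat \<Rightarrow> bool) \<Rightarrow> (nat \<Rightarrow> bool) \<Rightarrow> nat \<Rightarrow> nat \<Rightarrow> nat \<Rightarrow> nat \<Rightarrow> bool" where
  "dart_edge n X U d v e w \<longleftrightarrow>
     d < 4 \<and> v < n * n \<and> \<not> X v \<and> \<not> X (torus_shift n d v) \<and>
       (e = 4 \<or> e < 4 \<and> d + e \<noteq> 3 \<and> w = torus_shift n d v) \<or>
     5 \<le> d \<and> e < 4 \<and> d = e + 5 \<and> U w"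

definition darts :: "nat \<Rightarrow> nat \<Rightarrow> (nat \<Rightarrow> bool) \<Rightarrow> (nat \<Rightarrow> bool) \<Rightarrow> (nat \<times> nat) set" where
  "darts n V X U = {(a, b). a < 16 * V \<and> b < 16 * V \<and>
     dart_edge n X U (a div V) (a mod V) (b div V) (b mod V)}"

locale dart_walks =
  fixes n V :: nat and X U :: "nat \<Rightarrow> bool"
  assumes V: "n * n < V"
begin

abbreviation "D \<equiv> darts n V X U"

lemma div_mod_node:
  assumes "v < V"
  shows "(d * V + v) div V = d" "(d * V + v) mod V = v"
  using assms by auto

lemma node_less: "v < V \<Longrightarrow> d < 16 \<Longrightarrow> d * V + v < 16 * V"
proof -
  assume "v < V" "d < 16"
  then have "d * V + v < (d + 1) * V" by simp
  also have "\<dots> \<le> 16 * V" using \<open>d < 16\<close> by (intro mult_le_mono1) simp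
  finally show ?thesis .
qed

lemma darts_node_iff:
  assumes "v < V" "d < 16" "w < V" "e < 16"
  shows "(d * V + v, e * V + w) \<in> D \<longleftrightarrow> dart_edge n X U d v e w"
  using assms node_less by (simp add: darts_def div_mod_node)

lemma sink_no_edge: "w < V \<Longrightarrow> (4 * V + w, b) \<notin> D"
  by (simp add: darts_def div_mod_node dart_edge_def)

text \<open>A walk of \<open>s + 1\<close> darts has \<open>s\<close> transitions plus the edge into
  the sink. It cannot meet the sink earlier because no edge leaves it.\<close>

lemma dart_walk_iff:
  "d < 4 \<Longrightarrow> v < n * n \<Longrightarrow> (d * V + v, 4 * V) \<in> D ^^ Suc s \<longleftrightarrow> torus_branch n X (Suc s) v d"
proof (induction s arbitrary: d v)
  case 0
  then show ?case
    using darts_node_iff[of v d 0 4] V by (simp add: dart_edge_def)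
next
  case (Suc s)
  let ?t = "torus_shift n d v"
  have tn: "?t < n * n" using Suc.prems by (simp add: torus_shift_less)
  have vV: "v < V" "?t < V" using Suc.prems V tn by auto
  have "(d * V + v, 4 * V) \<in> D ^^ Suc (Suc s) \<longleftrightarrow> (\<exists>c. (d * V + v, c) \<in> D \<and> (c, 4 * V) \<in> D ^^ Suc s)"
    by (metis relpow_Suc_D2 relpow_Suc_I2)
  also have "\<dots> \<longleftrightarrow> (\<exists>e<4. (d * V + v, e * V + ?t) \<in> D \<and> (e * V + ?t, 4 * V) \<in> D ^^ Suc s)"
  proof
    assume "\<exists>c. (d * V + v, c) \<in> D \<and> (c, 4 * V) \<in> D ^^ Suc s"
    then obtain c where c: "(d * V + v, c) \<in> D" "(c, 4 * V) \<in> D ^^ Suc s" by blast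
    define e w where "e = c div V" and "w = c mod V"
    have cw: "c = e * V + w" "w < V" using V by (auto simp: e_def w_def)
    have de: "dart_edge n X U d v e w"
      using c(1) vV by (simp add: darts_def e_def w_def div_mod_node)
    have "e \<noteq> 4"
      using c(2) sink_no_edge cw by (metis relpow_Suc_D2)
    then have "e < 4" "w = ?t" using de Suc.prems by (auto simp: dart_edge_def)
    then show "\<exists>e<4. (d * V + v, e * V + ?t) \<in> D \<and> (e * V + ?t, 4 * V) \<in> D ^^ Suc s"
      using c cw by blast
  qed blast
  also have "\<dots> \<longleftrightarrow> (\<exists>e<4. dart_edge n X U d v e ?t \<and> torus_branch n X (Suc s) ?t e)"
  proof -
    have "(d * V + v, e * V + ?t) \<in> D \<longleftrightarrow> dart_edge n X U d v e ?t" if "e < 4" for e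
      using Suc.prems that by (intro darts_node_iff[OF vV(1) _ vV(2)]) auto
    then show ?thesis using Suc.IH[OF _ tn] by blast
  qed
  also have "\<dots> \<longleftrightarrow> torus_branch n X (Suc (Suc s)) v d"
    unfolding torus_branch.simps(2)[of n X "Suc s"] using Suc.prems
    by (auto simp: dart_edge_def simp del: torus_branch.simps)
  finally show ?case .
qed

lemma source_no_edge_sink: "k < 4 \<Longrightarrow> ((5 + k) * V, 4 * V) \<notin> D"
  using darts_node_iff[of 0 "5 + k" 0 4] V by (simp add: dart_edge_def)

text \<open>The additional edge is the one out of the source, whose end is forced because exactly
  one cell is queried.\<close>

lemma source_walk_iff:
  assumes k: "k < 4" and u: "u < n * n" and U: "\<And>w. U w \<longleftrightarrow> w = u"
  shows "((5 + k) * V, 4 * V) \<in> D ^^ Suc (Suc s) \<longleftrightarrow> torus_branch n X (Suc s) u k"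
proof -
  have uV: "u < V" using u V by simp
  have "((5 + k) * V, 4 * V) \<in> D ^^ Suc (Suc s) \<longleftrightarrow> (\<exists>c. ((5 + k) * V, c) \<in> D \<and> (c, 4 * V) \<in> D ^^ Suc s)"
    by (metis relpow_Suc_D2 relpow_Suc_I2)
  also have "\<dots> \<longleftrightarrow> (k * V + u, 4 * V) \<in> D ^^ Suc s"
  proof
    assume "(k * V + u, 4 * V) \<in> D ^^ Suc s"
    moreover have "((5 + k) * V, k * V + u) \<in> D"
      using darts_node_iff[of 0 "5 + k" u k] k uV V U by (simp add: dart_edge_def)
    ultimately show "\<exists>c. ((5 + k) * V, c) \<in> D \<and> (c, 4 * V) \<in> D ^^ Suc s" by blast
  next
    assume "\<exists>c. ((5 + k) * V, c) \<in> D \<and> (c, 4 * V) \<in> D ^^ Suc s"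
    then obtain c where c: "((5 + k) * V, c) \<in> D" "(c, 4 * V) \<in> D ^^ Suc s" by blast
    have "dart_edge n X U (5 + k) 0 (c div V) (c mod V)"
      using c(1) div_mod_node[of 0 "5 + k"] V by (simp add: darts_def)
    then have "c div V = k" "c mod V = u" using U by (auto simp: dart_edge_def)
    then have "c = k * V + u" by (metis div_mult_mod_eq)
    then show "(k * V + u, 4 * V) \<in> D ^^ Suc s" using c by simp
  qed
  also have "\<dots> \<longleftrightarrow> torus_branch n X (Suc s) u k" by (rule dart_walk_iff[OF k u])
  finally show ?thesis .
qed

end

text \<open>A maximum attained once is separated from the other values by a threshold, and
  conversely. Excluding the value 1 keeps the threshold positive; in the application, walks from a
  source to the sink have at least two edges.\<close>

lemma unique_max_iff:
  fixes H :: "nat \<Rightarrow> nat"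
  assumes "\<And>k. k < 4 \<Longrightarrow> H k \<noteq> 1 \<and> H k \<le> N"
  shows "(\<exists>k<4. \<forall>l<4. l \<noteq> k \<longrightarrow> H l < H k) \<longleftrightarrow> (\<exists>s. 1 \<le> s \<and> s < N \<and> card {k. k < 4 \<and> s < H k} = 1)"
proof
  assume "\<exists>k<4. \<forall>l<4. l \<noteq> k \<longrightarrow> H l < H k"
  then obtain k where k: "k < 4" "\<And>l. l < 4 \<Longrightarrow> l \<noteq> k \<Longrightarrow> H l < H k" by blast
  obtain l where "l < 4" "l \<noteq> k" using ex_neq_less_4 by blast
  then have H: "2 \<le> H k" "H k \<le> N" using k(2)[of l] assms[OF k(1)] by auto
  \<comment> \<open>The largest threshold below \<open>H k\<close> is the witness: every other value
    is at most \<open>H k - 1\<close>.\<close>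
  have "l < 4 \<and> H k - 1 < H l \<longleftrightarrow> l = k" for l
  proof (cases "l = k")
    case False
    have "\<not> H k - 1 < H l" if "l < 4"
      using k(2)[OF that False] by linarith
    then show ?thesis using False by blast
  next
    case True
    then show ?thesis using k(1) H(1) by simp
  qed
  then have "{l. l < 4 \<and> H k - 1 < H l} = {k}" by blast
  then have "card {l. l < 4 \<and> H k - 1 < H l} = 1" by simp
  moreover have "1 \<le> H k - 1" "H k - 1 < N" using H by linarith+
  ultimately show "\<exists>s. 1 \<le> s \<and> s < N \<and> card {k. k < 4 \<and> s < H k} = 1" by blast
next
  assume "\<exists>s. 1 \<le> s \<and> s < N \<and> card {k. k < 4 \<and> s < H k} = 1"
  then obtain s where "card {k. k < 4 \<and> s < H k} = 1" by blast
  then obtain k where k: "{k. k < 4 \<and> s < H k} = {k}" by (rule card_1_singletonE)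
  have "k < 4" "s < H k" using k by blast+
  moreover have "H l < H k" if "l < 4" "l \<noteq> k" for l
  proof -
    have "\<not> s < H l" using k that by blast
    then show ?thesis using \<open>s < H k\<close> by linarith
  qed
  ultimately show "\<exists>k<4. \<forall>l<4. l \<noteq> k \<longrightarrow> H l < H k" by blast
qed

text \<open>\<open>r\<close> rounds reach all walks of length up to \<open>2 ^ W = 16 * V\<close>.
  Branches stabilize before that length by the bound on \<open>V\<close>, so capping preserves the
  comparison. The bound on \<open>q\<close> separates its row from those of the sources.\<close>

lemma stable_iff_no_unique_max:
  assumes n: "0 < n" and c: "\<And>u. c u = X (torus_index n u)" and V: "2 * (n * n) < V"
    and N: "16 * V = 2 ^ W" and U: "\<And>w. U w \<longleftrightarrow> w = torus_index n u"
    and r: "(W + 1) * (W + 2) \<le> r" and walk: "walk_table W (16 * V) (darts n V X U) q"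
    and q: "9 * V \<le> q"
  shows "stable {3} c u \<longleftrightarrow> \<not> X (torus_index n u) \<and>
    \<not> (\<exists>k<4. \<forall>l<4. l \<noteq> k \<longrightarrow>
        min (16 * V) (walk_table.tab (16 * V) (darts n V X U) q val r ((5 + l) * V) (4 * V) 1)
        < min (16 * V) (walk_table.tab (16 * V) (darts n V X U) q val r ((5 + k) * V) (4 * V) 1))"
proof -
  interpret walk_table W "16 * V" "darts n V X U" q val by (rule walk)
  interpret dart_walks n V X U by standard (use V in simp)
  let ?u = "torus_index n u"
  have u: "?u < n * n" by (rule torus_index_less[OF n])
  define T where "T = (\<lambda>k. tab r ((5 + k) * V) (4 * V) 1)"
  define H where "H = (\<lambda>k. min (16 * V) (T k))"
  have Vpos: "0 < V" using V by simp
  have sound: "T k > 0 \<Longrightarrow> ((5 + k) * V, 4 * V) \<in> D ^^ T k" if "k < 4" for k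
  proof -
    have "(5 + k) * V < 9 * V" using that Vpos by simp
    then show "T k > 0 \<Longrightarrow> ((5 + k) * V, 4 * V) \<in> D ^^ T k"
      unfolding T_def using q by (intro tab_sound) auto
  qed
  have H1: "H k \<noteq> 1" if "k < 4" for k
    using sound[OF that] source_no_edge_sink[OF that] Vpos by (auto simp: H_def min_def)
  \<comment> \<open>A branch of length \<open>s\<close> is a source walk of length
    \<open>s + 1\<close>, hence the strict inequality. The entry may stem from a longer walk, whose
    branch is then shortened.\<close>
  have Hs: "s < H k \<longleftrightarrow> torus_branch n X s ?u k" if k: "k < 4" and s: "1 \<le> s" "s < 16 * V" for k s
  proof
    assume "s < H k"
    then have "s < T k" by (simp add: H_def)
    define j where "j = T k - 2"
    have j: "T k = Suc (Suc j)" "s \<le> Suc j" using \<open>s < T k\<close> s by (auto simp: j_def)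
    have "((5 + k) * V, 4 * V) \<in> D ^^ T k" using sound[OF k] j by simp
    then have b: "torus_branch n X (Suc j) ?u k"
      unfolding j(1) source_walk_iff[OF k u U] .
    show "torus_branch n X s ?u k"
      using j(2) b
    proof (induction rule: inc_induct)
      case (step i)
      show ?case by (rule torus_branch_antimono[OF step.IH[OF b]])
    qed
  next
    assume b: "torus_branch n X s ?u k"
    obtain j where j: "s = Suc j" using s by (cases s) auto
    have "((5 + k) * V, 4 * V) \<in> D ^^ Suc s"
      using b unfolding j source_walk_iff[OF k u U] .
    then have "Suc s \<le> T k"
      unfolding T_def using s r N by (intro tab_complete[where k = W]) auto
    then show "s < H k" using s by (simp add: H_def)
  qed
  have "stable {3} c u \<longleftrightarrow> \<not> X ?u \<and>
    (\<forall>s. 1 \<le> s \<and> s < 16 * V \<longrightarrow> card {d. d < 4 \<and> torus_branch n X s ?u d} \<noteq> 1)"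
    by (rule stable_torus_iff[of n c X, OF n c]) (use V in simp)
  also have "\<dots> \<longleftrightarrow> \<not> X ?u \<and> \<not> (\<exists>s. 1 \<le> s \<and> s < 16 * V \<and> card {k. k < 4 \<and> s < H k} = 1)"
  proof -
    define f g where "f s = card {k. k < 4 \<and> s < H k}"
      and "g s = card {d. d < 4 \<and> torus_branch n X s ?u d}" for s
    have "f s = g s" if "1 \<le> s" "s < 16 * V" for s
      unfolding f_def g_def by (rule arg_cong[where f = card]) (use Hs that in blast)
    then have "(\<forall>s. 1 \<le> s \<and> s < 16 * V \<longrightarrow> g s \<noteq> 1) \<longleftrightarrow> \<not> (\<exists>s. 1 \<le> s \<and> s < 16 * V \<and> f s = 1)"
      by auto
    then show ?thesis unfolding f_def g_def by (rule arg_cong)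
  qed
  also have "\<dots> \<longleftrightarrow> \<not> X ?u \<and> \<not> (\<exists>k<4. \<forall>l<4. l \<noteq> k \<longrightarrow> H l < H k)"
  proof -
    have "H k \<noteq> 1 \<and> H k \<le> 16 * V" if "k < 4" for k
      using H1[OF that] by (simp add: H_def)
    then have "(\<exists>k<4. \<forall>l<4. l \<noteq> k \<longrightarrow> H l < H k) \<longleftrightarrow>
        (\<exists>s. 1 \<le> s \<and> s < 16 * V \<and> card {k. k < 4 \<and> s < H k} = 1)"
      by (rule unique_max_iff)
    then show ?thesis by (simp only:)
  qed
  finally show ?thesis unfolding H_def T_def .
qed

section \<open>Correctness of lockstep programs\<close>

fun instr_target :: "instr \<Rightarrow> nat" where
  "instr_target (Const r k) = r"
| "instr_target (Add r a b) = r"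
| "instr_target (Sub r a b) = r"
| "instr_target (Half r a) = r"
| "instr_target (Load r a) = r"
| "instr_target (Store a b) = 0"
| "instr_target (JumpZ a l) = 0"

fun op_target :: "op \<Rightarrow> nat" where
  "op_target (Op i) = instr_target i"
| "op_target (Sel r c a b) = r"

fun targets :: "com \<Rightarrow> nat set" where
  "targets (Block xs) = set (map op_target xs)"
| "targets (Put v) = {}"
| "targets (c1 ;; c2) = targets c1 \<union> targets c2"
| "targets (While r c) = targets c"

lemma op_sem_frame: "op_ok x \<Longrightarrow> r \<noteq> op_target x \<Longrightarrow> r \<noteq> 1 \<or> \<rho> 1 = 0 \<Longrightarrow> op_sem x m \<rho> r = \<rho> r"
proof (cases x)
  case (Op i)
  then show "op_ok x \<Longrightarrow> r \<noteq> op_target x \<Longrightarrow> ?thesis" by (cases i) auto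
qed auto

lemma block_sem_frame:
  "list_all op_ok xs \<Longrightarrow> 1 \<notin> set (map op_target xs) \<Longrightarrow> r \<notin> set (map op_target xs) \<Longrightarrow> \<rho> 1 = 0 \<Longrightarrow>
   block_sem xs m \<rho> r = \<rho> r"
proof (induction xs arbitrary: \<rho>)
  case (Cons x xs)
  have "op_sem x m \<rho> 1 = \<rho> 1" "op_sem x m \<rho> r = \<rho> r"
    using Cons.prems op_sem_frame[of x] by auto
  then show ?case using Cons by simp
qed simp

lemma exec_frame:
  assumes "exec P c s t s'" "com_ok c" "1 \<notin> targets c" "\<And>p. fst s p 1 = 0" "r \<notin> targets c"
  shows "fst s' p r = fst s p r"
  using assms
proof (induction arbitrary: r p rule: exec.induct)
  case (Block xs R m)
  then show ?case by (simp add: block_sem_frame)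
next
  case (Seq c1 s t1 s' c2 t2 s'')
  then show ?case by simp
next
  case (WhileTrue R i c m t1 R' m' t2 s'')
  then have "R' p r = R p r" by simp
  moreover have "fst s'' p r = ((R' p)(1 := 0)) r"
    using WhileTrue.IH(2)[of r p] WhileTrue.prems by simp
  ultimately show ?case
    using WhileTrue.prems(3) by (auto simp: fun_upd_apply)
qed auto

text \<open>
  The registers 0, 1, 2, 4 and 5 have fixed contents: the index of the processor, the constants 0 and 1,
  and two numbers that are the same for all processors and control the loops. Register 3 is the loop counter.
\<close>
definition good :: "nat \<Rightarrow> nat \<Rightarrow> nat \<Rightarrow> (nat \<Rightarrow> nat) \<Rightarrow> bool" where
  "good W E p \<rho> \<longleftrightarrow> \<rho> 0 = p \<and> \<rho> 1 = 0 \<and> \<rho> 2 = 1 \<and> \<rho> 4 = W \<and> \<rho> 5 = E"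

definition safe :: "com \<Rightarrow> bool" where
  "safe c \<longleftrightarrow> com_ok c \<and> targets c \<inter> {0, 1, 2, 4, 5} = {}"

lemma exec_good:
  assumes "exec P c s t s'" "safe c" "\<And>p. good W E p (fst s p)"
  shows "good W E p (fst s' p)"
  using exec_frame[OF assms(1), of _ p] assms(2,3) unfolding safe_def good_def by auto

text \<open>The memory \<open>m\<close> is the same before and after: triples cover the stretches
  between two writes, where processors only read. Assertions speak of one processor at a
  time.\<close>

definition hoare where
  "hoare P m W E c t A B \<longleftrightarrow> safe c \<and>
     (\<forall>R. (\<forall>p. good W E p (R p)) \<and> (\<forall>p. A p (R p)) \<longrightarrow>
        (\<exists>R'. exec P c (R, m) t (R', m) \<and> (\<forall>p. B p (R' p))))"

lemma hoare_block:
  assumes "safe (Block xs)" "\<And>p \<rho>. good W E p \<rho> \<Longrightarrow> A p \<rho> \<Longrightarrow> B p (block_sem xs m \<rho>)"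
  shows "hoare P m W E (Block xs) (4 * length xs) A B"
  using assms exec.Block[of P xs] unfolding hoare_def by blast

lemma hoare_seq:
  assumes "hoare P m W E c1 t1 A B" "hoare P m W E c2 t2 B C"
  shows "hoare P m W E (c1 ;; c2) (t1 + t2) A C"
  unfolding hoare_def
proof (intro conjI allI impI)
  show "safe (c1 ;; c2)" using assms by (auto simp: hoare_def safe_def)
next
  fix R assume R: "(\<forall>p. good W E p (R p)) \<and> (\<forall>p. A p (R p))"
  obtain R' where R': "exec P c1 (R, m) t1 (R', m)" "\<And>p. B p (R' p)"
    using assms(1) R unfolding hoare_def by blast
  have "good W E p (R' p)" for p
    using exec_good[OF R'(1)] R assms(1) unfolding hoare_def by simp
  then obtain R'' where "exec P c2 (R', m) t2 (R'', m)" "\<And>p. C p (R'' p)"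
    using assms(2) R'(2) unfolding hoare_def by blast
  then show "\<exists>R'. exec P (c1 ;; c2) (R, m) (t1 + t2) (R', m) \<and> (\<forall>p. C p (R' p))"
    using exec.Seq[OF R'(1)] by blast
qed

lemma hoare_conseq:
  assumes "hoare P m W E c t A B" "\<And>p \<rho>. A' p \<rho> \<Longrightarrow> A p \<rho>" "\<And>p \<rho>. B p \<rho> \<Longrightarrow> B' p \<rho>" "t \<le> t'"
  shows "hoare P m W E c t' A' B'"
  using assms exec.Weaken[of P c _ t _ t'] unfolding hoare_def by meson

lemma hoare_frame:
  assumes "hoare P m W E c t A B"
    and F: "\<And>p \<rho> \<rho>'. (\<And>r. r \<notin> targets c \<Longrightarrow> \<rho>' r = \<rho> r) \<Longrightarrow> F p \<rho> \<Longrightarrow> F p \<rho>'"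
  shows "hoare P m W E c t (\<lambda>p \<rho>. F p \<rho> \<and> A p \<rho>) (\<lambda>p \<rho>. F p \<rho> \<and> B p \<rho>)"
  unfolding hoare_def
proof (intro conjI allI impI)
  show s: "safe c" using assms by (simp add: hoare_def)
  fix R assume R: "(\<forall>p. good W E p (R p)) \<and> (\<forall>p. F p (R p) \<and> A p (R p))"
  then obtain R' where R': "exec P c (R, m) t (R', m)" "\<And>p. B p (R' p)"
    using assms(1) unfolding hoare_def by blast
  have "R' p r = R p r" if "r \<notin> targets c" for p r
    using exec_frame[OF R'(1), of r p] s R that by (auto simp: safe_def good_def)
  then have "F p (R' p)" for p using F[of "R' p" "R p" p] R by blast
  then show "\<exists>R'. exec P c (R, m) t (R', m) \<and> (\<forall>p. F p (R' p) \<and> B p (R' p))"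
    using R' by blast
qed

text \<open>Carries everything that \<open>Pre\<close> says about untouched registers across
  \<open>c\<close>, without listing it as a separate frame.\<close>

lemma hoare_extend:
  assumes c: "hoare P m W E c t A B" and A: "\<And>p \<rho>. Pre p \<rho> \<Longrightarrow> A p \<rho>"
    and B: "\<And>p \<rho> \<rho>'. Pre p \<rho> \<Longrightarrow> (\<And>r. r \<notin> targets c \<Longrightarrow> \<rho>' r = \<rho> r) \<Longrightarrow> B p \<rho>' \<Longrightarrow> Post p \<rho>'"
  shows "hoare P m W E c t Pre Post"
proof (rule hoare_conseq)
  \<comment> \<open>The frame remembers that some earlier state satisfied \<open>Pre\<close> and
    agrees outside the targets, a property that \<open>c\<close> preserves by construction.\<close>
  show "hoare P m W E c t (\<lambda>p \<rho>. (\<exists>\<rho>0. Pre p \<rho>0 \<and> (\<forall>r. r \<notin> targets c \<longrightarrow> \<rho> r = \<rho>0 r)) \<and> A p \<rho>)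
      (\<lambda>p \<rho>. (\<exists>\<rho>0. Pre p \<rho>0 \<and> (\<forall>r. r \<notin> targets c \<longrightarrow> \<rho> r = \<rho>0 r)) \<and> B p \<rho>)"
    by (rule hoare_frame[OF c]) auto
qed (use A B in blast)+

definition rep :: "nat \<Rightarrow> op list \<Rightarrow> com" where
  "rep w xs = Block [Op (Add 3 w 1)] ;; While 3 (Block (xs @ [Op (Sub 3 3 2)]))"

lemma block_sem_append: "block_sem (xs @ ys) m \<rho> = block_sem ys m (block_sem xs m \<rho>)"
  by (induction xs arbitrary: \<rho>) auto

text \<open>Overwriting register 3 by an arbitrary \<open>j\<close> in the premises makes the
  invariant independent of the loop counter.\<close>

lemma hoare_rep:
  assumes safe: "safe (Block xs)" "3 \<notin> targets (Block xs)"
    and w: "w = 4 \<and> k = W \<or> w = 5 \<and> k = E"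
    and A: "\<And>p \<rho> j. good W E p \<rho> \<Longrightarrow> A p \<rho> \<Longrightarrow> I 0 p (\<rho>(3 := j))"
    and I: "\<And>i p \<rho> j. i < k \<Longrightarrow> good W E p \<rho> \<Longrightarrow> I i p \<rho> \<Longrightarrow> I (Suc i) p ((block_sem xs m \<rho>)(3 := j))"
  shows "hoare P m W E (rep w xs) (k * (4 * length xs + 7) + 5) A (I k)"
  unfolding hoare_def
proof (intro conjI allI impI)
  show "safe (rep w xs)" using safe by (auto simp: safe_def rep_def)
  fix R assume R: "(\<forall>p. good W E p (R p)) \<and> (\<forall>p. A p (R p))"
  define f where "f = (\<lambda>\<rho>. (block_sem xs m \<rho>)(3 := \<rho> 3 - 1))"
  define S where "S = (\<lambda>i. (\<lambda>p. (f ^^ i) ((R p)(3 := k)), m))"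
  have inv: "i \<le> k \<Longrightarrow> good W E p (fst (S i) p) \<and> fst (S i) p 3 = k - i \<and> I i p (fst (S i) p)" for i p
  proof (induction i)
    case 0
    have "I 0 p ((R p)(3 := k))" using R by (intro A) auto
    then show ?case using R by (simp add: S_def good_def fun_upd_def)
  next
    case (Suc i)
    let ?\<rho> = "fst (S i) p"
    have \<rho>: "good W E p ?\<rho>" "?\<rho> 3 = k - i" "I i p ?\<rho>" using Suc by auto
    have "fst (S (Suc i)) p = (block_sem xs m ?\<rho>)(3 := ?\<rho> 3 - 1)"
      by (simp add: S_def f_def)
    moreover have "good W E p ((block_sem xs m ?\<rho>)(3 := ?\<rho> 3 - 1))"
      using safe \<rho>(1) by (auto simp: good_def safe_def block_sem_frame)
    moreover have "I (Suc i) p ((block_sem xs m ?\<rho>)(3 := ?\<rho> 3 - 1))"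
      using I[OF _ \<rho>(1,3)] Suc.prems by simp
    moreover have "?\<rho> 3 - 1 = k - Suc i" using \<rho>(2) by simp
    ultimately show ?case by (simp only: fun_upd_same simp_thms)
  qed
  have "exec P (Block [Op (Add 3 w 1)]) (R, m) 4 (S 0)"
  proof -
    have "block_sem [Op (Add 3 w 1)] m (R p) = (R p)(3 := k)" for p
      using R w by (auto simp: good_def)
    then show ?thesis using exec.Block[of P "[Op (Add 3 w 1)]" R m] by (simp add: S_def)
  qed
  moreover have "exec P (While 3 (Block (xs @ [Op (Sub 3 3 2)]))) (S 0) (k * (4 * (length xs + 1) + 3) + 1) (S k)"
  proof (rule exec_while)
    show "fst (S i) p 3 \<noteq> 0" if "i < k" for i p using inv[of i p] that by simp
    show "fst (S k) p 3 = 0" for p using inv[of k p] by simp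
    fix i assume i: "i < k"
    let ?R = "\<lambda>p. block_sem (xs @ [Op (Sub 3 3 2)]) m (fst (S i) p)"
    have "?R p = fst (S (Suc i)) p" for p
      using inv[of i p] i safe
      by (simp add: S_def f_def block_sem_append good_def safe_def block_sem_frame)
    moreover have "(fst (S (Suc i)) p)(1 := 0) = fst (S (Suc i)) p" for p
      using inv[of "Suc i" p] i by (simp add: good_def fun_upd_idem)
    moreover have "exec P (Block (xs @ [Op (Sub 3 3 2)])) (S i) (4 * (length xs + 1)) (?R, m)"
      using exec.Block[of P "xs @ [Op (Sub 3 3 2)]" "fst (S i)" m] by (simp add: S_def)
    ultimately show "\<exists>R m. exec P (Block (xs @ [Op (Sub 3 3 2)])) (S i) (4 * (length xs + 1)) (R, m) \<and>
        S (Suc i) = (\<lambda>p. (R p)(1 := 0), m)"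
      by (intro exI[of _ ?R] exI[of _ m]) (simp add: S_def)
  qed
  ultimately have "exec P (rep w xs) (R, m) (4 + (k * (4 * (length xs + 1) + 3) + 1)) (S k)"
    unfolding rep_def by (rule exec.Seq)
  then show "\<exists>R'. exec P (rep w xs) (R, m) (k * (4 * length xs + 7) + 5) (R', m) \<and> (\<forall>p. I k p (R' p))"
    using inv[of k] by (intro exI[of _ "fst (S k)"]) (simp add: S_def algebra_simps)
qed

section \<open>Shifts and bit fields\<close>

definition shl :: "nat \<Rightarrow> nat \<Rightarrow> com" where
  "shl x w = rep w [Op (Add x x x)]"

definition shr :: "nat \<Rightarrow> nat \<Rightarrow> com" where
  "shr x w = rep w [Op (Half x x)]"

lemma hoare_shl:
  assumes "w = 4 \<and> k = W \<or> w = 5 \<and> k = E" "x > 5"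
  shows "hoare P m W E (shl x w) (k * 11 + 5) (\<lambda>p \<rho>. \<rho> x = v p) (\<lambda>p \<rho>. \<rho> x = v p * 2 ^ k)"
  using hoare_rep[of "[Op (Add x x x)]" w k W E "\<lambda>p \<rho>. \<rho> x = v p" "\<lambda>i p \<rho>. \<rho> x = v p * 2 ^ i" m P] assms
  by (simp add: safe_def shl_def)

lemma hoare_shr:
  assumes "w = 4 \<and> k = W \<or> w = 5 \<and> k = E" "x > 5"
  shows "hoare P m W E (shr x w) (k * 11 + 5) (\<lambda>p \<rho>. \<rho> x = v p) (\<lambda>p \<rho>. \<rho> x = v p div 2 ^ k)"
proof -
  have "v p div 2 ^ i div 2 = v p div (2 * 2 ^ i)" for p i
    by (metis div_mult2_eq mult.commute)
  then show ?thesis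
    using hoare_rep[of "[Op (Half x x)]" w k W E "\<lambda>p \<rho>. \<rho> x = v p" "\<lambda>i p \<rho>. \<rho> x = v p div 2 ^ i" m P] assms
    by (simp add: safe_def shr_def)
qed

definition split_field :: "nat \<Rightarrow> nat \<Rightarrow> nat \<Rightarrow> nat \<Rightarrow> com" where
  "split_field s h l w =
     Block [Op (Add h s 1)] ;; shr h w ;; Block [Op (Add l h 1)] ;; shl l w ;; Block [Op (Sub l s l)]"

lemma targets_rep: "targets (rep w xs) = insert 3 (set (map op_target xs))"
  by (auto simp: rep_def)

lemma targets_split_field: "targets (split_field s h l w) = {3, h, l}"
  by (auto simp: split_field_def shl_def shr_def targets_rep)

lemma hoare_split_field:
  assumes w: "w = 4 \<and> k = W \<or> w = 5 \<and> k = E" and h: "h > 5" "l > 5" "h \<noteq> l" "s \<noteq> h" "s \<noteq> l" "s \<noteq> 3"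
  shows "hoare P m W E (split_field s h l w) (k * 22 + 22)
    (\<lambda>p \<rho>. \<rho> s = v p) (\<lambda>p \<rho>. \<rho> h = v p div 2 ^ k \<and> \<rho> l = v p mod 2 ^ k)"
proof -
  let ?S = "\<lambda>p \<rho>. \<rho> s = v p"
  let ?H = "\<lambda>p \<rho>. \<rho> s = v p \<and> \<rho> h = v p div 2 ^ k"
  have 1: "hoare P m W E (Block [Op (Add h s 1)]) 4 ?S (\<lambda>p \<rho>. ?S p \<rho> \<and> \<rho> h = v p)"
    using hoare_block[of "[Op (Add h s 1)]" W E ?S "\<lambda>p \<rho>. ?S p \<rho> \<and> \<rho> h = v p"] h
    by (simp add: safe_def good_def)
  have 2: "hoare P m W E (shr h w) (k * 11 + 5) (\<lambda>p \<rho>. ?S p \<rho> \<and> \<rho> h = v p) ?H"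
    by (rule hoare_frame[OF hoare_shr[OF w h(1)]]) (use h in \<open>auto simp: shr_def targets_rep\<close>)
  have 3: "hoare P m W E (Block [Op (Add l h 1)]) 4 ?H (\<lambda>p \<rho>. ?H p \<rho> \<and> \<rho> l = v p div 2 ^ k)"
    using hoare_block[of "[Op (Add l h 1)]" W E ?H "\<lambda>p \<rho>. ?H p \<rho> \<and> \<rho> l = v p div 2 ^ k"] h
    by (simp add: safe_def good_def)
  have 4: "hoare P m W E (shl l w) (k * 11 + 5) (\<lambda>p \<rho>. ?H p \<rho> \<and> \<rho> l = v p div 2 ^ k)
      (\<lambda>p \<rho>. ?H p \<rho> \<and> \<rho> l = v p div 2 ^ k * 2 ^ k)"
    by (rule hoare_frame[OF hoare_shl[OF w h(2)]]) (use h in \<open>auto simp: shl_def targets_rep\<close>)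
  have 5: "hoare P m W E (Block [Op (Sub l s l)]) 4 (\<lambda>p \<rho>. ?H p \<rho> \<and> \<rho> l = v p div 2 ^ k * 2 ^ k)
      (\<lambda>p \<rho>. \<rho> h = v p div 2 ^ k \<and> \<rho> l = v p mod 2 ^ k)"
    using hoare_block[of "[Op (Sub l s l)]" W E "\<lambda>p \<rho>. ?H p \<rho> \<and> \<rho> l = v p div 2 ^ k * 2 ^ k"
      "\<lambda>p \<rho>. \<rho> h = v p div 2 ^ k \<and> \<rho> l = v p mod 2 ^ k"] h
    by (simp add: safe_def good_def minus_div_mult_eq_mod)
  show ?thesis
    unfolding split_field_def
    by (rule hoare_conseq[OF hoare_seq[OF 1 hoare_seq[OF 2 hoare_seq[OF 3 hoare_seq[OF 4 5]]]]]) auto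
qed

section \<open>Arithmetic on the machine\<close>

text \<open>The pair \<open>(a, b)\<close> owns a block of \<open>N * N\<close> cells, and position
  1 of the block is the root of its heap.\<close>

definition root_cell :: "nat \<Rightarrow> nat \<Rightarrow> nat \<Rightarrow> nat" where
  "root_cell N a b = (a * N + b) * N * N + 1"

definition root_addr :: "nat \<Rightarrow> nat \<Rightarrow> nat \<Rightarrow> com" where
  "root_addr x a b =
     Block [Op (Add x a 1)] ;; shl x 4 ;; Block [Op (Add x x b)] ;; shl x 4 ;; shl x 4 ;; Block [Op (Add x x 2)]"

lemma targets_shl: "targets (shl x w) = {3, x}"
  by (simp add: shl_def targets_rep)

lemma targets_root_addr: "targets (root_addr x a b) = {3, x}"
  by (auto simp: root_addr_def targets_shl)

lemma hoare_root_addr: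
  assumes x: "x > 5" "a \<noteq> x" "b \<noteq> x" "b \<noteq> 3"
  shows "hoare P m W E (root_addr x a b) (W * 33 + 27)
    (\<lambda>p \<rho>. \<rho> a = u p \<and> \<rho> b = v p) (\<lambda>p \<rho>. \<rho> x = root_cell (2 ^ W) (u p) (v p))"
proof -
  let ?b = "\<lambda>p \<rho>. \<rho> b = v p"
  note shl = hoare_frame[where F = ?b, OF hoare_shl[where w = 4 and x = x and k = W and E = E]]
  have 1: "hoare P m W E (Block [Op (Add x a 1)]) 4 (\<lambda>p \<rho>. \<rho> a = u p \<and> \<rho> b = v p) (\<lambda>p \<rho>. ?b p \<rho> \<and> \<rho> x = u p)"
    using hoare_block[of "[Op (Add x a 1)]" W E "\<lambda>p \<rho>. \<rho> a = u p \<and> \<rho> b = v p" "\<lambda>p \<rho>. ?b p \<rho> \<and> \<rho> x = u p"] x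
    by (simp add: safe_def good_def)
  have 2: "hoare P m W E (shl x 4) (W * 11 + 5) (\<lambda>p \<rho>. ?b p \<rho> \<and> \<rho> x = u p) (\<lambda>p \<rho>. ?b p \<rho> \<and> \<rho> x = u p * 2 ^ W)"
    by (rule shl) (use x in \<open>auto simp: targets_shl\<close>)
  have 3: "hoare P m W E (Block [Op (Add x x b)]) 4 (\<lambda>p \<rho>. ?b p \<rho> \<and> \<rho> x = u p * 2 ^ W)
      (\<lambda>p \<rho>. ?b p \<rho> \<and> \<rho> x = u p * 2 ^ W + v p)"
    using hoare_block[of "[Op (Add x x b)]" W E "\<lambda>p \<rho>. ?b p \<rho> \<and> \<rho> x = u p * 2 ^ W"
      "\<lambda>p \<rho>. ?b p \<rho> \<and> \<rho> x = u p * 2 ^ W + v p"] x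
    by (simp add: safe_def good_def)
  have 4: "hoare P m W E (shl x 4) (W * 11 + 5) (\<lambda>p \<rho>. ?b p \<rho> \<and> \<rho> x = u p * 2 ^ W + v p)
      (\<lambda>p \<rho>. ?b p \<rho> \<and> \<rho> x = (u p * 2 ^ W + v p) * 2 ^ W)"
    by (rule shl) (use x in \<open>auto simp: targets_shl\<close>)
  have 5: "hoare P m W E (shl x 4) (W * 11 + 5) (\<lambda>p \<rho>. ?b p \<rho> \<and> \<rho> x = (u p * 2 ^ W + v p) * 2 ^ W)
      (\<lambda>p \<rho>. ?b p \<rho> \<and> \<rho> x = (u p * 2 ^ W + v p) * 2 ^ W * 2 ^ W)"
    by (rule shl) (use x in \<open>auto simp: targets_shl\<close>)
  have 6: "hoare P m W E (Block [Op (Add x x 2)]) 4 (\<lambda>p \<rho>. ?b p \<rho> \<and> \<rho> x = (u p * 2 ^ W + v p) * 2 ^ W * 2 ^ W)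
      (\<lambda>p \<rho>. \<rho> x = root_cell (2 ^ W) (u p) (v p))"
    using hoare_block[of "[Op (Add x x 2)]" W E "\<lambda>p \<rho>. ?b p \<rho> \<and> \<rho> x = (u p * 2 ^ W + v p) * 2 ^ W * 2 ^ W"
      "\<lambda>p \<rho>. \<rho> x = root_cell (2 ^ W) (u p) (v p)"] x
    by (simp add: safe_def good_def root_cell_def)
  show ?thesis
    unfolding root_addr_def
    by (rule hoare_conseq[OF hoare_seq[OF 1 hoare_seq[OF 2 hoare_seq[OF 3 hoare_seq[OF 4 hoare_seq[OF 5 6]]]]]]) auto
qed

text \<open>Binary square root without multiplication. Besides the root \<open>r\<close> in 13 and
  the current power \<open>b\<close> in 16, registers 14, 15 and 8 maintain \<open>r * r\<close>,
  \<open>r * b\<close> and \<open>b * b\<close>, from which the square of the candidate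
  \<open>r + b\<close> is a sum. Register 19 is 0 exactly if this square is at most the
  radicand.\<close>

definition sqrt_ops :: "op list" where
  "sqrt_ops =
    [Op (Half 16 16), Op (Half 8 8), Op (Half 8 8), Op (Half 15 15),
     Op (Add 18 14 15), Op (Add 18 18 15), Op (Add 18 18 8), Op (Sub 19 18 9),
     Op (Add 20 13 16), Op (Add 21 15 8),
     Sel 14 19 18 14, Sel 13 19 20 13, Sel 15 19 21 15]"

definition sqrt_com :: com where
  "sqrt_com = Block [Op (Const 13 0), Op (Const 14 0), Op (Const 15 0), Op (Add 16 7 1)] ;; rep 5 sqrt_ops"

lemma hoare_sqrt:
  assumes K: "K < 2 ^ E * 2 ^ E"
  shows "hoare P m W E sqrt_com (E * 59 + 21)
    (\<lambda>p \<rho>. \<rho> 7 = 2 ^ E \<and> \<rho> 8 = 2 ^ E * 2 ^ E \<and> \<rho> 9 = K)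
    (\<lambda>p \<rho>. \<rho> 13 = floor_sqrt K \<and> \<rho> 14 = floor_sqrt K * floor_sqrt K)"
proof -
  \<comment> \<open>After \<open>i\<close> rounds register 13 is the root rounded down to a multiple
    of \<open>2 ^ (E - i)\<close>; the last two conjuncts say so.\<close>
  define I where "I = (\<lambda>i (p :: nat) (\<rho> :: nat \<Rightarrow> nat). \<rho> 9 = K \<and> \<rho> 16 = 2 ^ (E - i) \<and> \<rho> 8 = 2 ^ (E - i) * 2 ^ (E - i) \<and>
    \<rho> 15 = \<rho> 13 * 2 ^ (E - i) \<and> \<rho> 14 = \<rho> 13 * \<rho> 13 \<and> \<rho> 13 * \<rho> 13 \<le> K \<and>
    K < (\<rho> 13 + 2 ^ (E - i)) * (\<rho> 13 + 2 ^ (E - i)))"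
  have 1: "hoare P m W E (Block [Op (Const 13 0), Op (Const 14 0), Op (Const 15 0), Op (Add 16 7 1)]) (4 * 4)
    (\<lambda>p \<rho>. \<rho> 7 = 2 ^ E \<and> \<rho> 8 = 2 ^ E * 2 ^ E \<and> \<rho> 9 = K) (I 0)"
    using hoare_block[of "[Op (Const 13 0), Op (Const 14 0), Op (Const 15 0), Op (Add 16 7 1)]" W E
      "\<lambda>p \<rho>. \<rho> 7 = 2 ^ E \<and> \<rho> 8 = 2 ^ E * 2 ^ E \<and> \<rho> 9 = K" "I 0"] K
    by (simp add: safe_def good_def I_def)
  have 2: "hoare P m W E (rep 5 sqrt_ops) (E * (4 * length sqrt_ops + 7) + 5) (I 0) (I E)"
  proof (rule hoare_rep)
    show "safe (Block sqrt_ops)" "3 \<notin> targets (Block sqrt_ops)"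
      by (simp_all add: safe_def sqrt_ops_def)
    show "I 0 p (\<rho>(3 := j))" if "I 0 p \<rho>" for p \<rho> j
      using that by (simp add: I_def)
    fix i p \<rho> j assume i: "i < E" and g: "good W E p \<rho>" and inv: "I i p \<rho>"
    define r b where "r = \<rho> 13" and "b = (2::nat) ^ (E - Suc i)"
    have b2: "(2::nat) ^ (E - i) = 2 * b"
      unfolding b_def using i by (metis Suc_diff_Suc power_Suc)
    have \<rho>: "\<rho> 1 = 0" "\<rho> 9 = K" "\<rho> 16 = 2 * b" "\<rho> 8 = 2 * b * (2 * b)" "\<rho> 15 = r * (2 * b)" "\<rho> 14 = r * r"
      "\<rho> 13 = r" "r * r \<le> K" "K < (r + 2 * b) * (r + 2 * b)"
      using inv g unfolding I_def b2 r_def good_def by auto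
    have c: "\<rho> 15 div 2 = r * b" "\<rho> 8 div 2 div 2 = b * b" "\<rho> 16 div 2 = b" unfolding \<rho> by auto
    have s: "r * r + r * b + r * b + b * b = (r + b) * (r + b)" by (simp add: algebra_simps)
    have s': "r * b + b * b = (r + b) * b" by (simp add: algebra_simps)
    have "block_sem sqrt_ops m \<rho> 9 = K" "block_sem sqrt_ops m \<rho> 16 = b" "block_sem sqrt_ops m \<rho> 8 = b * b"
      "block_sem sqrt_ops m \<rho> 13 = (if (r + b) * (r + b) \<le> K then r + b else r)"
      "block_sem sqrt_ops m \<rho> 14 = (if (r + b) * (r + b) \<le> K then (r + b) * (r + b) else r * r)"
      "block_sem sqrt_ops m \<rho> 15 = (if (r + b) * (r + b) \<le> K then (r + b) * b else r * b)"
      by (simp_all add: sqrt_ops_def c s s' \<rho>(1,2,6,7))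
    then show "I (Suc i) p ((block_sem sqrt_ops m \<rho>)(3 := j))"
      using \<rho>(8,9) by (simp add: I_def b_def[symmetric] not_le algebra_simps)
  qed simp
  have I: "\<rho> 13 = floor_sqrt K \<and> \<rho> 14 = floor_sqrt K * floor_sqrt K" if "I E p \<rho>" for p \<rho>
  proof -
    have "\<rho> 13 = floor_sqrt K"
      using that by (intro floor_sqrt_unique[symmetric]) (simp_all add: I_def power2_eq_square)
    then show ?thesis using that by (simp add: I_def)
  qed
  show ?thesis
    unfolding sqrt_com_def
    by (rule hoare_conseq[OF hoare_seq[OF 1 2]]) (assumption, erule I, simp add: sqrt_ops_def)
qed

text \<open>Long division: register 36 runs through \<open>n * 2 ^ k\<close> for decreasing
  \<open>k\<close> and is subtracted from the remainder in 37 whenever it fits.\<close>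

definition mod_ops :: "op list" where
  "mod_ops = [Op (Half 36 36), Op (Sub 38 36 37), Op (Sub 39 37 36), Sel 37 38 39 37]"

definition mod_com :: com where
  "mod_com = Block [Op (Add 36 13 1), Op (Add 37 29 1)] ;; shl 36 5 ;; rep 5 mod_ops"

lemma hoare_mod:
  assumes v: "\<And>p. v p < 2 ^ E"
  shows "hoare P m W E mod_com (E * 34 + 18)
    (\<lambda>p \<rho>. \<rho> 13 = n \<and> \<rho> 29 = v p) (\<lambda>p \<rho>. 0 < n \<longrightarrow> \<rho> 37 = v p mod n)"
proof -
  define I where "I = (\<lambda>i p (\<rho> :: nat \<Rightarrow> nat). \<rho> 36 = n * 2 ^ (E - i) \<and> (0 < n \<longrightarrow> \<rho> 37 < n * 2 ^ (E - i)) \<and> \<rho> 37 mod n = v p mod n)"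
  have 1: "hoare P m W E (Block [Op (Add 36 13 1), Op (Add 37 29 1)]) (4 * 2)
    (\<lambda>p \<rho>. \<rho> 13 = n \<and> \<rho> 29 = v p) (\<lambda>p \<rho>. \<rho> 37 = v p \<and> \<rho> 36 = n)"
    using hoare_block[of "[Op (Add 36 13 1), Op (Add 37 29 1)]" W E
      "\<lambda>p \<rho>. \<rho> 13 = n \<and> \<rho> 29 = v p" "\<lambda>p \<rho>. \<rho> 37 = v p \<and> \<rho> 36 = n"]
    by (simp add: safe_def good_def)
  have 2: "hoare P m W E (shl 36 5) (E * 11 + 5) (\<lambda>p \<rho>. \<rho> 37 = v p \<and> \<rho> 36 = n) (\<lambda>p \<rho>. \<rho> 37 = v p \<and> \<rho> 36 = n * 2 ^ E)"
    by (rule hoare_frame[OF hoare_shl]) (auto simp: targets_shl)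
  have 3: "hoare P m W E (rep 5 mod_ops) (E * (4 * length mod_ops + 7) + 5) (I 0) (I E)"
  proof (rule hoare_rep)
    show "safe (Block mod_ops)" "3 \<notin> targets (Block mod_ops)"
      by (simp_all add: safe_def mod_ops_def)
    show "I 0 p (\<rho>(3 := j))" if "I 0 p \<rho>" for p \<rho> j
      using that by (simp add: I_def)
    fix i p \<rho> j assume i: "i < E" and g: "good W E p \<rho>" and inv: "I i p \<rho>"
    define b where "b = n * (2::nat) ^ (E - Suc i)"
    have b2: "n * (2::nat) ^ (E - i) = 2 * b"
      unfolding b_def using i by (metis Suc_diff_Suc mult.left_commute power_Suc)
    have \<rho>: "\<rho> 1 = 0" "\<rho> 36 = 2 * b" "0 < n \<Longrightarrow> \<rho> 37 < 2 * b" "\<rho> 37 mod n = v p mod n"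
      using inv g unfolding I_def b2 good_def by auto
    have "(\<rho> 37 - b) mod n = \<rho> 37 mod n" if "b \<le> \<rho> 37"
      using that mod_mult_self2[of "\<rho> 37 - b" n "2 ^ (E - Suc i)"] by (simp add: b_def)
    moreover have "block_sem mod_ops m \<rho> 36 = b" "block_sem mod_ops m \<rho> 37 = (if b \<le> \<rho> 37 then \<rho> 37 - b else \<rho> 37)"
      using \<rho>(1,2) by (simp_all add: mod_ops_def)
    ultimately show "I (Suc i) p ((block_sem mod_ops m \<rho>)(3 := j))"
      using \<rho>(3,4) by (auto simp: I_def b_def[symmetric])
  qed simp
  show ?thesis
    unfolding mod_com_def
  proof (rule hoare_conseq[OF hoare_seq[OF 1 hoare_seq[OF 2 hoare_conseq[OF 3]]]])
    show "I 0 p \<rho>" if "\<rho> 37 = v p \<and> \<rho> 36 = n * 2 ^ E" for p \<rho>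
    proof -
      have "v p < n * 2 ^ E" if "0 < n"
      proof -
        have "2 ^ E \<le> n * 2 ^ E" using that by simp
        then show ?thesis using v[of p] by linarith
      qed
      then show ?thesis using that unfolding I_def by simp
    qed
    show "0 < n \<longrightarrow> \<rho> 37 = v p mod n" if "I E p \<rho>" for p \<rho>
    proof
      assume "0 < n"
      then have "\<rho> 37 < n" "\<rho> 37 mod n = v p mod n" using that by (simp_all add: I_def)
      then show "\<rho> 37 = v p mod n" by simp
    qed
  qed (auto simp: mod_ops_def)
qed

section \<open>Preparing the table\<close>

definition fields_com :: com where
  "fields_com = split_field 0 22 23 4 ;; split_field 22 24 25 4 ;; split_field 24 26 27 4 ;;
     split_field 26 28 29 5 ;; split_field 27 30 31 5"

lemma targets_fields: "targets fields_com = {3, 22, 23, 24, 25, 26, 27, 28, 29, 30, 31}"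
  by (auto simp: fields_com_def targets_split_field)

lemma hoare_fields:
  fixes W E :: nat
  defines "N \<equiv> 2 ^ W" and "V \<equiv> 2 ^ E"
  shows "hoare P m W E fields_com (W * 66 + E * 44 + 110) (\<lambda>p \<rho>. \<rho> 0 = p)
    (\<lambda>p \<rho>. \<rho> 23 = p mod N \<and> \<rho> 25 = p div N mod N \<and> \<rho> 27 = p div N div N mod N \<and> \<rho> 26 = p div N div N div N \<and>
       \<rho> 28 = p div N div N div N div V \<and> \<rho> 29 = p div N div N div N mod V \<and>
       \<rho> 30 = p div N div N mod N div V \<and> \<rho> 31 = p div N div N mod N mod V)"
proof -
  let ?A1 = "\<lambda>p \<rho>. \<rho> 23 = p mod N"
  let ?A2 = "\<lambda>p \<rho>. ?A1 p \<rho> \<and> \<rho> 25 = p div N mod N"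
  let ?A3 = "\<lambda>p \<rho>. ?A2 p \<rho> \<and> \<rho> 27 = p div N div N mod N \<and> \<rho> 26 = p div N div N div N"
  let ?A4 = "\<lambda>p \<rho>. ?A3 p \<rho> \<and> \<rho> 28 = p div N div N div N div V \<and> \<rho> 29 = p div N div N div N mod V"
  have 1: "hoare P m W E (split_field 0 22 23 4) (W * 22 + 22) (\<lambda>p \<rho>. \<rho> 0 = p)
      (\<lambda>p \<rho>. ?A1 p \<rho> \<and> \<rho> 22 = p div N)"
    by (rule hoare_conseq[OF hoare_split_field[where k = W]]) (auto simp: N_def)
  have 2: "hoare P m W E (split_field 22 24 25 4) (W * 22 + 22) (\<lambda>p \<rho>. ?A1 p \<rho> \<and> \<rho> 22 = p div N)
      (\<lambda>p \<rho>. ?A2 p \<rho> \<and> \<rho> 24 = p div N div N)"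
    by (rule hoare_extend[OF hoare_split_field[where k = W]]) (auto simp: N_def targets_split_field)
  have 3: "hoare P m W E (split_field 24 26 27 4) (W * 22 + 22) (\<lambda>p \<rho>. ?A2 p \<rho> \<and> \<rho> 24 = p div N div N) ?A3"
    by (rule hoare_extend[OF hoare_split_field[where k = W]]) (auto simp: N_def targets_split_field)
  have 4: "hoare P m W E (split_field 26 28 29 5) (E * 22 + 22) ?A3 ?A4"
    by (rule hoare_extend[OF hoare_split_field[where k = E]]) (auto simp: V_def targets_split_field)
  have 5: "hoare P m W E (split_field 27 30 31 5) (E * 22 + 22) ?A4
      (\<lambda>p \<rho>. ?A4 p \<rho> \<and> \<rho> 30 = p div N div N mod N div V \<and> \<rho> 31 = p div N div N mod N mod V)"
    by (rule hoare_extend[OF hoare_split_field[where k = E]]) (auto simp: V_def targets_split_field)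
  show ?thesis
    unfolding fields_com_def
    by (rule hoare_conseq[OF hoare_seq[OF 1 hoare_seq[OF 2 hoare_seq[OF 3 hoare_seq[OF 4 5]]]]]) auto
qed

text \<open>An inner position has \<open>t = 0\<close>, so it is \<open>c\<close> itself. Adding
  \<open>c\<close> once more to the own address \<open>p\<close> gives position \<open>2 * c\<close>
  in the same block, the left child; the right child is next to it.\<close>

definition select_ops :: "op list" where
  "select_ops = [Op (Add 34 0 23), Op (Add 35 34 2), Sel 32 25 34 32, Sel 33 25 35 33]"

definition addr_com :: com where
  "addr_com = root_addr 32 26 23 ;; root_addr 33 23 27 ;; Block select_ops"

lemma hoare_addr:
  "hoare P m W E addr_com (W * 66 + 70) (\<lambda>p \<rho>. \<rho> 26 = a p \<and> \<rho> 27 = b p \<and> \<rho> 25 = t p \<and> \<rho> 23 = c p)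
    (\<lambda>p \<rho>. \<rho> 32 = (if t p = 0 then p + c p else root_cell (2 ^ W) (a p) (c p)) \<and>
           \<rho> 33 = (if t p = 0 then p + c p + 1 else root_cell (2 ^ W) (c p) (b p)))"
proof -
  let ?A = "\<lambda>p \<rho>. \<rho> 25 = t p \<and> \<rho> 23 = c p \<and> \<rho> 27 = b p"
  have 1: "hoare P m W E (root_addr 32 26 23) (W * 33 + 27) (\<lambda>p \<rho>. \<rho> 26 = a p \<and> \<rho> 27 = b p \<and> \<rho> 25 = t p \<and> \<rho> 23 = c p)
     (\<lambda>p \<rho>. ?A p \<rho> \<and> \<rho> 32 = root_cell (2 ^ W) (a p) (c p))"
    by (rule hoare_extend[OF hoare_root_addr]) (auto simp: targets_root_addr)
  have 2: "hoare P m W E (root_addr 33 23 27) (W * 33 + 27) (\<lambda>p \<rho>. ?A p \<rho> \<and> \<rho> 32 = root_cell (2 ^ W) (a p) (c p))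
     (\<lambda>p \<rho>. ?A p \<rho> \<and> \<rho> 32 = root_cell (2 ^ W) (a p) (c p) \<and> \<rho> 33 = root_cell (2 ^ W) (c p) (b p))"
    by (rule hoare_extend[OF hoare_root_addr]) (auto simp: targets_root_addr)
  have 3: "hoare P m W E (Block select_ops) (4 * length select_ops)
     (\<lambda>p \<rho>. ?A p \<rho> \<and> \<rho> 32 = root_cell (2 ^ W) (a p) (c p) \<and> \<rho> 33 = root_cell (2 ^ W) (c p) (b p))
     (\<lambda>p \<rho>. \<rho> 32 = (if t p = 0 then p + c p else root_cell (2 ^ W) (a p) (c p)) \<and>
           \<rho> 33 = (if t p = 0 then p + c p + 1 else root_cell (2 ^ W) (c p) (b p)))"
    by (rule hoare_block) (simp_all add: safe_def good_def select_ops_def)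
  show ?thesis
    unfolding addr_com_def
    by (rule hoare_conseq[OF hoare_seq[OF 1 hoare_seq[OF 2 3]]]) (auto simp: select_ops_def)
qed

section \<open>Heads of darts and the edge test in registers\<close>

definition wrap_ops :: "nat \<Rightarrow> op list" where
  "wrap_ops r = [Op (Add 45 r 2), Op (Sub 45 45 9), Op (Sub 46 r 9), Sel r 45 r 46]"

text \<open>The shifts in directions 0, 3, 1 and 2 are computed in registers 41 to 44 by every
  processor; the selections at the end pick the one for the kind in register 28.\<close>

definition target_ops :: "op list" where
  "target_ops = Op (Add 41 29 13) # wrap_ops 41 @ [Op (Add 42 29 9), Op (Sub 42 42 13)] @ wrap_ops 42 @
    [Op (Add 43 29 2), Op (Sub 46 43 13), Op (Add 45 37 2), Op (Sub 47 13 45), Sel 43 47 46 43,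
     Op (Add 44 29 13), Op (Sub 44 44 2), Op (Sub 46 29 2), Sel 44 37 44 46,
     Op (Sub 49 28 2), Op (Sub 50 49 2), Sel 40 28 41 43, Sel 51 50 44 42, Sel 40 49 40 51]"

lemma target_ops_sem:
  assumes "good W E p \<rho>" "\<rho> 13 = n" "\<rho> 9 = n * n" "\<rho> 28 = d" "\<rho> 29 = v" "\<rho> 37 = v mod n" "0 < n"
  shows "block_sem target_ops m \<rho> 40 = torus_shift n d v"
proof -
  have \<rho>: "\<rho> 1 = 0" "\<rho> 2 = 1" "\<rho> 13 = n" "\<rho> 9 = n * n" "\<rho> 28 = d" "\<rho> 29 = v" "\<rho> 37 = v mod n"
    using assms by (auto simp: good_def)
  have "v mod n < n" using assms(7) by simp
  then have e: "n \<le> Suc (v mod n) \<longleftrightarrow> Suc (v mod n) = n" by linarith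
  have w: "Suc z - n * n = 0 \<longleftrightarrow> z < n * n" for z by linarith
  have d: "d - Suc 0 = 0 \<longleftrightarrow> d = 0 \<or> d = 1" "d - Suc 0 - Suc 0 = 0 \<longleftrightarrow> d \<le> 2" by auto
  show ?thesis
    by (simp add: target_ops_def wrap_ops_def \<rho> torus_shift_def wrap_def e w d)
      (auto simp: numeral_eq_Suc)
qed

text \<open>The input starts at cell 1, and the indicator of the queried cell follows the states at
  distance \<open>n * n\<close>, held in register 9.\<close>

definition load_ops :: "op list" where
  "load_ops =
    [Op (Add 57 29 2), Op (Load 52 57), Op (Add 57 40 2), Op (Load 53 57),
     Op (Add 57 31 9), Op (Add 57 57 2), Op (Load 54 57),
     Op (Add 57 23 2), Op (Load 55 57), Op (Add 57 57 9), Op (Load 56 57)]"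

text \<open>A conjunction is a sum of defects that vanishes iff all conditions hold: truncated
  \<open>a - b\<close> for \<open>a <= b\<close>, both differences for equality, and 1 minus those
  for inequality. Subtracting the sum from 1 yields the truth value.\<close>

definition edge_ops :: "op list" where
  "edge_ops =
    [Op (Add 58 52 53), Op (Add 57 29 2), Op (Sub 57 57 9), Op (Add 58 58 57),
     Op (Const 60 3), Op (Const 61 4), Op (Const 62 5),
     Op (Sub 63 31 40), Op (Sub 64 40 31), Op (Add 59 63 64),
     Op (Add 63 28 30), Op (Sub 64 63 60), Op (Sub 65 60 63), Op (Add 64 64 65),
     Op (Sub 64 2 64), Op (Add 59 59 64), Op (Sub 64 30 60), Op (Add 59 59 64),
     Op (Sub 63 30 61), Op (Sub 64 61 30), Op (Add 63 63 64), Sel 59 63 1 59,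
     Op (Add 59 59 58), Op (Sub 66 2 59)]"

definition source_ops :: "op list" where
  "source_ops =
    [Op (Add 63 30 62), Op (Sub 64 28 63), Op (Sub 65 63 28), Op (Add 67 64 65),
     Op (Sub 64 30 60), Op (Add 67 67 64), Op (Sub 64 2 54), Op (Add 67 67 64), Op (Sub 67 2 67),
     Op (Sub 64 28 60), Sel 66 64 66 67]"

definition sum_ops :: "op list" where
  "sum_ops =
    [Op (Add 69 7 7), Op (Add 69 69 69), Op (Add 70 69 1), Op (Add 69 69 69), Op (Add 69 69 7),
     Op (Sub 63 26 69), Op (Sub 64 69 26), Op (Add 68 63 64),
     Op (Add 63 55 2), Sel 63 56 1 63, Sel 63 25 1 63, Sel 66 68 63 66]"

lemma load_ops_sem:
  assumes "good W E p \<rho>" "\<rho> 29 = v" "\<rho> 40 = t" "\<rho> 31 = w" "\<rho> 9 = K" "\<rho> 23 = c"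
  shows "block_sem load_ops m \<rho> 52 = m (v + 1)" "block_sem load_ops m \<rho> 53 = m (t + 1)"
    "block_sem load_ops m \<rho> 54 = m (w + K + 1)" "block_sem load_ops m \<rho> 55 = m (c + 1)"
    "block_sem load_ops m \<rho> 56 = m (c + K + 1)"
  using assms by (simp_all add: load_ops_def good_def)

lemma edge_ops_sem:
  assumes "good W E p \<rho>" "\<rho> 28 = d" "\<rho> 29 = v" "\<rho> 30 = e" "\<rho> 31 = w" "\<rho> 40 = t" "\<rho> 9 = K"
    "\<rho> 52 = x" "\<rho> 53 = y"
  shows "block_sem edge_ops m \<rho> 66 =
      of_bool (x = 0 \<and> y = 0 \<and> v < K \<and> (e = 4 \<or> e < 4 \<and> d + e \<noteq> 3 \<and> w = t))"
    "block_sem edge_ops m \<rho> 60 = 3" "block_sem edge_ops m \<rho> 62 = 5"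
proof -
  have \<rho>: "\<rho> 1 = 0" "\<rho> 2 = 1"
    using assms by (auto simp: good_def)
  show "block_sem edge_ops m \<rho> 60 = 3" "block_sem edge_ops m \<rho> 62 = 5"
    by (simp_all add: edge_ops_def)
  have 1: "block_sem edge_ops m \<rho> 66 = 1 - ((if e - 4 + (4 - e) = 0 then 0 else
     w - t + (t - w) + (1 - (d + e - 3 + (3 - (d + e)))) + (e - 3)) + (x + y + (v + 1 - K)))"
    by (simp add: edge_ops_def \<rho> assms)
  have 2: "1 - z = of_bool (z = 0)" for z :: nat by (cases z) auto
  show "block_sem edge_ops m \<rho> 66 =
      of_bool (x = 0 \<and> y = 0 \<and> v < K \<and> (e = 4 \<or> e < 4 \<and> d + e \<noteq> 3 \<and> w = t))"
    unfolding 1 by (subst 2, rule arg_cong[where f = of_bool]) auto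
qed

lemma source_ops_sem:
  assumes "good W E p \<rho>" "\<rho> 28 = d" "\<rho> 30 = e" "\<rho> 60 = 3" "\<rho> 62 = 5" "\<rho> 54 = u" "\<rho> 66 = z"
  shows "block_sem source_ops m \<rho> 66 = (if d < 4 then z else of_bool (d = e + 5 \<and> e < 4 \<and> u \<noteq> 0))"
proof -
  have \<rho>: "\<rho> 1 = 0" "\<rho> 2 = 1"
    using assms by (auto simp: good_def)
  have 1: "block_sem source_ops m \<rho> 66 = (if d - 3 = 0 then z else
     1 - (d - (e + 5) + (e + 5 - d) + (e - 3) + (1 - u)))"
    by (simp add: source_ops_def \<rho> assms)
  have 2: "1 - z = of_bool (z = 0)" for z :: nat by (cases z) auto
  have 3: "(d - (e + 5) + (e + 5 - d) + (e - 3) + (1 - u) = 0) \<longleftrightarrow> d = e + 5 \<and> e < 4 \<and> u \<noteq> 0"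
    by auto
  show ?thesis unfolding 1 2 3 by auto
qed

lemma sum_ops_sem:
  assumes "good W E p \<rho>" "\<rho> 7 = V" "\<rho> 26 = a" "\<rho> 25 = t" "\<rho> 55 = x" "\<rho> 56 = u" "\<rho> 66 = z"
  shows "block_sem sum_ops m \<rho> 66 = (if a = 9 * V then if t = 0 then 0 else if u = 0 then 0 else x + 1 else z)"
    "block_sem sum_ops m \<rho> 68 = 0 \<longleftrightarrow> a = 9 * V"
    "block_sem sum_ops m \<rho> 69 = 9 * V" "block_sem sum_ops m \<rho> 70 = 4 * V"
proof -
  have \<rho>: "\<rho> 1 = 0" "\<rho> 2 = 1"
    using assms by (auto simp: good_def)
  have 1: "block_sem sum_ops m \<rho> 68 = a - 9 * V + (9 * V - a)"
    "block_sem sum_ops m \<rho> 66 = (if a - 9 * V + (9 * V - a) = 0 then if t = 0 then 0 else if u = 0 then 0 else x + 1 else z)"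
    by (simp_all add: sum_ops_def \<rho> assms)
  have 2: "a - 9 * V + (9 * V - a) = 0 \<longleftrightarrow> a = 9 * V" by auto
  show "block_sem sum_ops m \<rho> 68 = 0 \<longleftrightarrow> a = 9 * V" unfolding 1 2 ..
  show "block_sem sum_ops m \<rho> 66 = (if a = 9 * V then if t = 0 then 0 else if u = 0 then 0 else x + 1 else z)"
    unfolding 1 2 ..
  show "block_sem sum_ops m \<rho> 69 = 9 * V" "block_sem sum_ops m \<rho> 70 = 4 * V"
    by (simp_all add: sum_ops_def \<rho>[simplified] assms)
qed

lemma targets_mod_com: "targets mod_com = {3, 36, 37, 38, 39}"
  by (auto simp: mod_com_def mod_ops_def targets_shl targets_rep)

lemma targets_sqrt_com: "targets sqrt_com = {3, 8, 13, 14, 15, 16, 18, 19, 20, 21}"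
  by (auto simp: sqrt_com_def sqrt_ops_def targets_rep)

lemma targets_addr_com: "targets addr_com = {3, 32, 33, 34, 35}"
  by (auto simp: addr_com_def select_ops_def targets_root_addr)

text \<open>
  Register 6 holds the input length, 7 holds \<open>V\<close>, 9 and 13 hold \<open>n\<^sup>2\<close> and \<open>n\<close> for a
  valid input. The processor with index
  \<open>((a * N + b) * N + t) * N + c\<close> keeps its fields in registers 26, 27, 25 and 23, and the kinds and cells of the
  nodes \<open>a\<close> and \<open>b\<close> in registers 28 to 31. Register 40 is the head of the dart \<open>a\<close>, registers 32 and 33 are the
  two addresses read in every round, register 66 is the constant entry of the table, and register 68 is 0 in the
  row that computes a sum.
\<close>
definition prep_com :: com where
  "prep_com = sqrt_com ;; fields_com ;; addr_com ;; mod_com ;; Block target_ops ;; Block load_ops ;;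
     Block edge_ops ;; Block source_ops ;; Block sum_ops"

definition table_base :: "(nat \<Rightarrow> nat) \<Rightarrow> nat \<Rightarrow> nat \<Rightarrow> nat \<Rightarrow> nat \<Rightarrow> nat \<Rightarrow> nat \<Rightarrow> nat" where
  "table_base m n V a b c t =
     (if a = 9 * V then if t = 0 then 0 else if m (c + n * n + 1) = 0 then 0 else m (c + 1) + 1
      else of_bool (dart_edge n (\<lambda>v. m (v + 1) \<noteq> 0) (\<lambda>w. m (w + n * n + 1) \<noteq> 0)
             (a div V) (a mod V) (b div V) (b mod V)))"

text \<open>Only the table entry is conditional on a valid length. The remaining facts are also
  needed on malformed inputs, which run the same rounds until the final test rejects them.\<close>

definition prep_post ::
  "(nat \<Rightarrow> nat) \<Rightarrow> nat \<Rightarrow> nat \<Rightarrow> nat \<Rightarrow> nat \<Rightarrow> (nat \<Rightarrow> nat) \<Rightarrow> bool" where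
  "prep_post m N V L p \<rho> \<longleftrightarrow>
     (let c = p mod N; t = p div N mod N; b = p div N div N mod N; a = p div N div N div N;
          n = floor_sqrt (L div 2) in
      \<rho> 6 = L \<and> \<rho> 7 = V \<and> \<rho> 9 = L div 2 \<and> \<rho> 14 = n * n \<and> \<rho> 25 = t \<and>
      \<rho> 32 = (if t = 0 then p + c else root_cell N a c) \<and>
      \<rho> 33 = (if t = 0 then p + c + 1 else root_cell N c b) \<and>
      (\<rho> 68 = 0 \<longleftrightarrow> a = 9 * V) \<and> \<rho> 69 = 9 * V \<and> \<rho> 70 = 4 * V \<and>
      (L = 2 * (n * n) \<longrightarrow> \<rho> 66 = table_base m n V a b c t))"

lemma hoare_block_extend:
  assumes "safe (Block xs)"
    and "\<And>p \<rho> \<rho>'. good W E p \<rho> \<Longrightarrow> Pre p \<rho> \<Longrightarrow> (\<And>r. r \<notin> targets (Block xs) \<Longrightarrow> \<rho>' r = \<rho> r) \<Longrightarrow>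
       \<rho>' = block_sem xs m \<rho> \<Longrightarrow> Post p \<rho>'"
  shows "hoare P m W E (Block xs) (4 * length xs) Pre Post"
proof (rule hoare_block[OF assms(1)])
  fix p \<rho> assume "good W E p \<rho>" "Pre p \<rho>"
  moreover have "block_sem xs m \<rho> r = \<rho> r" if "r \<notin> targets (Block xs)" for r
    using assms(1) that \<open>good W E p \<rho>\<close> by (intro block_sem_frame) (auto simp: safe_def good_def)
  ultimately show "Post p (block_sem xs m \<rho>)" using assms(2) by blast
qed

lemma hoare_prep:
  fixes W E L :: nat
  defines "N \<equiv> 2 ^ W" and "V \<equiv> 2 ^ E"
  assumes L: "L div 2 < V * V"
  shows "hoare P m W E prep_com (E * 137 + W * 132 + 551)
    (\<lambda>p \<rho>. \<rho> 6 = L \<and> \<rho> 7 = V \<and> \<rho> 8 = V * V \<and> \<rho> 9 = L div 2) (prep_post m N V L)"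
proof -
  define K n where "K = L div 2" and "n = floor_sqrt K"
  define a b c t where "a p = p div N div N div N" and "b p = p div N div N mod N"
    and "c p = p mod N" and "t p = p div N mod N" for p
  define d v e w where "d p = a p div V" and "v p = a p mod V" and "e p = b p div V" and "w p = b p mod V" for p
  let ?A1 = "\<lambda>p \<rho>. \<rho> 6 = L \<and> \<rho> 7 = V \<and> \<rho> 9 = K \<and> \<rho> 13 = n \<and> \<rho> 14 = n * n"
  let ?A2 = "\<lambda>p \<rho>. ?A1 p \<rho> \<and> \<rho> 23 = c p \<and> \<rho> 25 = t p \<and> \<rho> 26 = a p \<and>
    \<rho> 28 = d p \<and> \<rho> 29 = v p \<and> \<rho> 30 = e p \<and> \<rho> 31 = w p"
  let ?A3 = "\<lambda>p \<rho>. ?A2 p \<rho> \<and> \<rho> 32 = (if t p = 0 then p + c p else root_cell N (a p) (c p)) \<and>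
           \<rho> 33 = (if t p = 0 then p + c p + 1 else root_cell N (c p) (b p))"
  let ?A4 = "\<lambda>p \<rho>. ?A3 p \<rho> \<and> (0 < n \<longrightarrow> \<rho> 37 = v p mod n)"
  let ?T = "\<lambda>p s. 0 < n \<and> K = n * n \<longrightarrow> s = torus_shift n (d p) (v p)"
  let ?A5 = "\<lambda>p \<rho>. ?A3 p \<rho> \<and> ?T p (\<rho> 40)"
  let ?A6 = "\<lambda>p \<rho>. ?A5 p \<rho> \<and> \<rho> 52 = m (v p + 1) \<and> \<rho> 53 = m (\<rho> 40 + 1) \<and> \<rho> 54 = m (w p + K + 1) \<and>
    \<rho> 55 = m (c p + 1) \<and> \<rho> 56 = m (c p + K + 1)"
  let ?e = "\<lambda>p s. m (v p + 1) = 0 \<and> m (s + 1) = 0 \<and> v p < K \<and> (e p = 4 \<or> e p < 4 \<and> d p + e p \<noteq> 3 \<and> w p = s)"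
  \<comment> \<open>On malformed lengths the head in register 40 is unspecified; \<open>s\<close>
    stands for it once the register is forgotten.\<close>
  let ?A7 = "\<lambda>p \<rho>. ?A3 p \<rho> \<and> \<rho> 54 = m (w p + K + 1) \<and> \<rho> 55 = m (c p + 1) \<and> \<rho> 56 = m (c p + K + 1) \<and>
    \<rho> 60 = 3 \<and> \<rho> 62 = 5 \<and> (\<exists>s. ?T p s \<and> \<rho> 66 = of_bool (?e p s))"
  let ?D = "\<lambda>p. dart_edge n (\<lambda>v. m (v + 1) \<noteq> 0) (\<lambda>w. m (w + n * n + 1) \<noteq> 0) (d p) (v p) (e p) (w p)"
  let ?A8 = "\<lambda>p \<rho>. ?A3 p \<rho> \<and> \<rho> 55 = m (c p + 1) \<and> \<rho> 56 = m (c p + K + 1) \<and>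
    (K = n * n \<longrightarrow> \<rho> 66 = of_bool (?D p))"
  have 1: "hoare P m W E sqrt_com (E * 59 + 21)
      (\<lambda>p \<rho>. \<rho> 6 = L \<and> \<rho> 7 = V \<and> \<rho> 8 = V * V \<and> \<rho> 9 = L div 2) ?A1"
    by (rule hoare_extend[OF hoare_sqrt[of K E]])
      (use L in \<open>auto simp: V_def K_def n_def targets_sqrt_com\<close>)
  have 2: "hoare P m W E fields_com (W * 66 + E * 44 + 110) (\<lambda>p \<rho>. \<rho> 0 = p \<and> ?A1 p \<rho>) 
     (\<lambda>p \<rho>. ?A2 p \<rho> \<and> \<rho> 27 = b p)"
    by (rule hoare_extend[OF hoare_fields])
      (auto simp: V_def N_def a_def b_def c_def t_def d_def v_def e_def w_def targets_fields)
  have 3: "hoare P m W E addr_com (W * 66 + 70) (\<lambda>p \<rho>. ?A2 p \<rho> \<and> \<rho> 27 = b p) ?A3"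
    by (rule hoare_extend[OF hoare_addr[of P m W E a b t c]]) (auto simp: targets_addr_com N_def)
  have 4: "hoare P m W E mod_com (E * 34 + 18) ?A3 ?A4"
    by (rule hoare_extend[OF hoare_mod[of v]]) (auto simp: v_def V_def targets_mod_com)
  have 5: "hoare P m W E (Block target_ops) (4 * length target_ops) ?A4 ?A5"
  proof (rule hoare_block_extend)
    show "safe (Block target_ops)" by (auto simp: safe_def target_ops_def wrap_ops_def)
    fix p \<rho> \<rho>' assume g: "good W E p \<rho>" and A: "?A4 p \<rho>"
      and fr: "\<And>r. r \<notin> targets (Block target_ops) \<Longrightarrow> \<rho>' r = \<rho> r" and \<rho>': "\<rho>' = block_sem target_ops m \<rho>"
    have "?T p (\<rho>' 40)"
      using target_ops_sem[OF g, of n "d p" "v p"] A \<rho>' by auto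
    then show "?A5 p \<rho>'"
      using A by (simp add: fr target_ops_def wrap_ops_def)
  qed
  have 6: "hoare P m W E (Block load_ops) (4 * length load_ops) ?A5 ?A6"
  proof (rule hoare_block_extend)
    show "safe (Block load_ops)" by (auto simp: safe_def load_ops_def)
    fix p \<rho> \<rho>' assume g: "good W E p \<rho>" and A: "?A5 p \<rho>"
      and fr: "\<And>r. r \<notin> targets (Block load_ops) \<Longrightarrow> \<rho>' r = \<rho> r" and \<rho>': "\<rho>' = block_sem load_ops m \<rho>"
    have 40: "\<rho>' 40 = \<rho> 40" by (simp add: fr load_ops_def)
    have "\<rho>' 52 = m (v p + 1) \<and> \<rho>' 53 = m (\<rho>' 40 + 1) \<and> \<rho>' 54 = m (w p + K + 1) \<and>
      \<rho>' 55 = m (c p + 1) \<and> \<rho>' 56 = m (c p + K + 1)"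
      unfolding 40 unfolding \<rho>' using load_ops_sem[OF g, of "v p" "\<rho> 40" "w p" K "c p"] A by auto
    then show "?A6 p \<rho>'" using A by (simp add: 40) (simp add: fr load_ops_def)
  qed
  have 7: "hoare P m W E (Block edge_ops) (4 * length edge_ops) ?A6 ?A7"
  proof (rule hoare_block_extend)
    show "safe (Block edge_ops)" by (auto simp: safe_def edge_ops_def)
    fix p \<rho> \<rho>' assume g: "good W E p \<rho>" and A: "?A6 p \<rho>"
      and fr: "\<And>r. r \<notin> targets (Block edge_ops) \<Longrightarrow> \<rho>' r = \<rho> r" and \<rho>': "\<rho>' = block_sem edge_ops m \<rho>"
    have "\<rho>' 66 = of_bool (?e p (\<rho> 40)) \<and> \<rho>' 60 = 3 \<and> \<rho>' 62 = 5"
      unfolding \<rho>'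
      using edge_ops_sem[OF g, of "d p" "v p" "e p" "w p" "\<rho> 40" K "m (v p + 1)" "m (\<rho> 40 + 1)"] A
      by blast
    then have "\<rho>' 60 = 3 \<and> \<rho>' 62 = 5 \<and> (\<exists>s. ?T p s \<and> \<rho>' 66 = of_bool (?e p s))" using A by blast
    moreover have "?A3 p \<rho>' \<and> \<rho>' 54 = m (w p + K + 1) \<and> \<rho>' 55 = m (c p + 1) \<and> \<rho>' 56 = m (c p + K + 1)"
      using A by (simp add: fr edge_ops_def)
    ultimately show "?A7 p \<rho>'" by blast
  qed
  have 8: "hoare P m W E (Block source_ops) (4 * length source_ops) ?A7 ?A8"
  proof (rule hoare_block_extend)
    show "safe (Block source_ops)" by (auto simp: safe_def source_ops_def)
    fix p \<rho> \<rho>' assume g: "good W E p \<rho>" and A: "?A7 p \<rho>"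
      and fr: "\<And>r. r \<notin> targets (Block source_ops) \<Longrightarrow> \<rho>' r = \<rho> r" and \<rho>': "\<rho>' = block_sem source_ops m \<rho>"
    obtain s where s: "?T p s" "\<rho> 66 = of_bool (?e p s)" using A by blast
    have s66: "\<rho>' 66 = (if d p < 4 then of_bool (?e p s) else of_bool (d p = e p + 5 \<and> e p < 4 \<and> m (w p + K + 1) \<noteq> 0))"
      unfolding \<rho>'
      using source_ops_sem[OF g, of "d p" "e p" "m (w p + K + 1)" "of_bool (?e p s)"] A s by blast
    have "\<rho>' 66 = of_bool (?D p)" if "K = n * n"
      using s(1) that unfolding s66 dart_edge_def by (cases "0 < n") auto
    moreover have "?A3 p \<rho>' \<and> \<rho>' 55 = m (c p + 1) \<and> \<rho>' 56 = m (c p + K + 1)"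
      using A by (simp add: fr source_ops_def)
    ultimately show "?A8 p \<rho>'" by blast
  qed
  have 9: "hoare P m W E (Block sum_ops) (4 * length sum_ops) ?A8 (prep_post m N V L)"
  proof (rule hoare_block_extend)
    show "safe (Block sum_ops)" by (auto simp: safe_def sum_ops_def)
    fix p \<rho> \<rho>' assume g: "good W E p \<rho>" and A: "?A8 p \<rho>"
      and fr: "\<And>r. r \<notin> targets (Block sum_ops) \<Longrightarrow> \<rho>' r = \<rho> r" and \<rho>': "\<rho>' = block_sem sum_ops m \<rho>"
    have s: "\<rho>' 66 = (if a p = 9 * V then if t p = 0 then 0 else if m (c p + K + 1) = 0 then 0 else m (c p + 1) + 1 else \<rho> 66)"
      "\<rho>' 68 = 0 \<longleftrightarrow> a p = 9 * V" "\<rho>' 69 = 9 * V" "\<rho>' 70 = 4 * V"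
      unfolding \<rho>'
      using sum_ops_sem[OF g, of V "a p" "t p" "m (c p + 1)" "m (c p + K + 1)" "\<rho> 66"] A by blast+
    have "\<rho>' 66 = table_base m n V (a p) (b p) (c p) (t p)" if "L = 2 * (n * n)"
    proof -
      have "K = n * n" using that by (simp add: K_def)
      then show ?thesis
        using A unfolding s table_base_def d_def v_def e_def w_def by simp
    qed
    moreover have "\<rho>' 6 = L \<and> \<rho>' 7 = V \<and> \<rho>' 9 = K \<and> \<rho>' 14 = n * n \<and> \<rho>' 25 = t p \<and>
      \<rho>' 32 = (if t p = 0 then p + c p else root_cell N (a p) (c p)) \<and>
      \<rho>' 33 = (if t p = 0 then p + c p + 1 else root_cell N (c p) (b p))"
      using A by (simp add: fr sum_ops_def)
    ultimately show "prep_post m N V L p \<rho>'"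
      using s(2-4) unfolding prep_post_def Let_def a_def b_def c_def t_def n_def K_def by blast
  qed
  \<comment> \<open>That register 0 holds the index is part of \<open>good\<close>, so it may be
    dropped from the precondition.\<close>
  have f2: "hoare P m W E fields_com (W * 66 + E * 44 + 110) ?A1 (\<lambda>p \<rho>. ?A2 p \<rho> \<and> \<rho> 27 = b p)"
    using 2 unfolding hoare_def good_def by blast
  show ?thesis
    unfolding prep_com_def
    by (rule hoare_conseq[OF hoare_seq[OF 1 hoare_seq[OF f2 hoare_seq[OF 3 hoare_seq[OF 4 hoare_seq[OF 5
          hoare_seq[OF 6 hoare_seq[OF 7 hoare_seq[OF 8 9]]]]]]]]])
      (assumption, assumption, simp add: target_ops_def wrap_ops_def load_ops_def edge_ops_def source_ops_def sum_ops_def)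
qed

definition rounds_com :: com where
  "rounds_com = Block [Op (Const 71 0), Op (Add 72 4 2), Op (Add 72 72 2)] ;; rep 4 [Op (Add 71 71 72)] ;;
     Block [Op (Add 71 71 72)]"

lemma hoare_rounds:
  "hoare P m W E rounds_com (W * 11 + 21) (\<lambda>p \<rho>. True) (\<lambda>p \<rho>. \<rho> 71 = (W + 1) * (W + 2))"
proof -
  let ?I = "\<lambda>i p \<rho>. \<rho> 72 = W + 2 \<and> \<rho> 71 = i * (W + 2)"
  have 1: "hoare P m W E (Block [Op (Const 71 0), Op (Add 72 4 2), Op (Add 72 72 2)])
      (4 * length [Op (Const 71 0), Op (Add 72 4 2), Op (Add 72 72 2)]) (\<lambda>p \<rho>. True) (?I 0)"
    by (rule hoare_block) (simp_all add: safe_def good_def)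
  have 2: "hoare P m W E (rep 4 [Op (Add 71 71 72)]) (W * (4 * length [Op (Add 71 71 72)] + 7) + 5) (?I 0) (?I W)"
    by (rule hoare_rep) (simp_all add: safe_def)
  have 3: "hoare P m W E (Block [Op (Add 71 71 72)]) (4 * length [Op (Add 71 71 72)]) (?I W)
      (\<lambda>p \<rho>. \<rho> 71 = (W + 1) * (W + 2))"
    by (rule hoare_block) (simp_all add: safe_def)
  show ?thesis
    unfolding rounds_com_def
    by (rule hoare_conseq[OF hoare_seq[OF 1 hoare_seq[OF 2 3]]]) auto
qed

section \<open>Filling the table\<close>

text \<open>All cases are computed and then selected, so that every processor executes the same
  code. Truncated subtraction followed by addition computes a maximum.\<close>

definition main_ops :: "op list" where
  "main_ops =
    [Op (Load 73 32), Op (Load 74 33), Op (Add 75 73 74), Op (Sub 76 73 74), Op (Add 76 76 74),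
     Sel 77 68 75 76, Sel 78 73 1 75, Sel 78 74 1 78, Sel 78 68 1 78, Sel 77 25 77 78,
     Op (Sub 78 77 66), Op (Add 77 78 66)]"

definition main_com :: com where
  "main_com = While 71 (Block main_ops ;; Put 77 ;; Block [Op (Sub 71 71 2)])"

definition cell_step :: "(nat \<Rightarrow> nat) \<Rightarrow> (nat \<Rightarrow> nat) \<Rightarrow> nat" where
  "cell_step \<rho> m = max (\<rho> 66)
     (if \<rho> 25 = 0 then if \<rho> 68 = 0 then m (\<rho> 32) + m (\<rho> 33) else max (m (\<rho> 32)) (m (\<rho> 33))
      else if \<rho> 68 = 0 \<or> m (\<rho> 32) = 0 \<or> m (\<rho> 33) = 0 then 0 else m (\<rho> 32) + m (\<rho> 33))"

text \<open>All processors read the previous memory and write simultaneously, so one round is a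
  simultaneous update. The registers on which \<open>cell_step\<close> depends do not change during
  the loop.\<close>

fun mem_seq :: "nat \<Rightarrow> (nat \<Rightarrow> nat \<Rightarrow> nat) \<Rightarrow> (nat \<Rightarrow> nat) \<Rightarrow> nat \<Rightarrow> nat \<Rightarrow> nat" where
  "mem_seq P R m 0 = m"
| "mem_seq P R m (Suc i) = (\<lambda>a. if a < P then cell_step (R a) (mem_seq P R m i) else mem_seq P R m i a)"

lemma diff_add_max: "(x :: nat) - y + y = max x y"
  by simp

lemma main_ops_sem: "\<rho> 1 = 0 \<Longrightarrow> block_sem main_ops m \<rho> 77 = cell_step \<rho> m"
  by (simp add: main_ops_def cell_step_def diff_add_max max.commute)

lemma cell_step_cong: "(\<And>r. r \<in> {25, 32, 33, 66, 68} \<Longrightarrow> \<rho>' r = \<rho> r) \<Longrightarrow> cell_step \<rho>' m = cell_step \<rho> m"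
  by (simp add: cell_step_def)

lemma exec_main:
  assumes g: "\<And>p. good W E p (R p)" and k: "\<And>p. R p 71 = k"
  shows "\<exists>R'. exec P main_com (R, m) (k * 56 + 1) (R', mem_seq P R m k) \<and>
    (\<forall>p. good W E p (R' p)) \<and> (\<forall>p r. r \<notin> {71, 73, 74, 75, 76, 77, 78} \<longrightarrow> R' p r = R p r)"
proof -
  define Rs where "Rs = rec_nat R (\<lambda>i Q p. (block_sem main_ops (mem_seq P R m i) (Q p))(71 := Q p 71 - 1))"
  have Rs: "Rs 0 = R" "Rs (Suc i) p = (block_sem main_ops (mem_seq P R m i) (Rs i p))(71 := Rs i p 71 - 1)" for i p
    by (simp_all add: Rs_def)
  have frame: "block_sem main_ops m \<rho> r = \<rho> r" if "\<rho> 1 = 0" "r \<notin> {73, 74, 75, 76, 77, 78}" for m \<rho> r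
    using that by (intro block_sem_frame) (auto simp: main_ops_def)
  have inv: "good W E p (Rs i p) \<and> Rs i p 71 = k - i \<and>
    (\<forall>r. r \<notin> {71, 73, 74, 75, 76, 77, 78} \<longrightarrow> Rs i p r = R p r)" for i p
  proof (induction i)
    case 0
    then show ?case using g k by (simp add: Rs)
  next
    case (Suc i)
    then have "Rs i p 1 = 0" by (simp add: good_def)
    then show ?case using Suc by (simp add: Rs(2) good_def frame)
  qed
  define S where "S = (\<lambda>i. (Rs i, mem_seq P R m i))"
  have "exec P (While 71 (Block main_ops ;; Put 77 ;; Block [Op (Sub 71 71 2)])) (S 0) (k * (53 + 3) + 1) (S k)"
  proof (rule exec_while)
    show "fst (S i) p 71 \<noteq> 0" if "i < k" for i p using inv[of p i] that by (simp add: S_def)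
    show "fst (S k) p 71 = 0" for p using inv[of p k] by (simp add: S_def)
    fix i assume "i < k"
    let ?m = "mem_seq P R m i"
    let ?R1 = "\<lambda>p. block_sem main_ops ?m (Rs i p)"
    have z: "Rs i p 1 = 0" "Rs i p 0 = p" "Rs i p 2 = 1" for p using inv[of p i] by (auto simp: good_def)
    have 1: "exec P (Block main_ops) (S i) (4 * length main_ops) (?R1, ?m)"
      unfolding S_def by (rule exec.Block)
    have "?R1 p 77 = cell_step (R p) ?m" for p
      unfolding main_ops_sem[of "Rs i p", OF z(1)]
      by (rule cell_step_cong) (use inv[of p i] in auto)
    then have "(\<lambda>a. if a < P then ?R1 a 77 else ?m a) = mem_seq P R m (Suc i)"
      by (simp only: mem_seq.simps)
    moreover have "exec P (Put 77) (?R1, ?m) 1 (?R1, \<lambda>a. if a < P then ?R1 a 77 else ?m a)"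
      by (rule exec.Put) (simp add: frame z z[simplified])
    ultimately have 2: "exec P (Put 77) (?R1, ?m) 1 (?R1, mem_seq P R m (Suc i))" by simp
    have "block_sem [Op (Sub 71 71 2)] (mem_seq P R m (Suc i)) (?R1 p) = Rs (Suc i) p" for p
      by (simp add: Rs(2) frame z z[simplified])
    then have 3: "exec P (Block [Op (Sub 71 71 2)]) (?R1, mem_seq P R m (Suc i)) 4 (Rs (Suc i), mem_seq P R m (Suc i))"
      using exec.Block[of P "[Op (Sub 71 71 2)]" ?R1 "mem_seq P R m (Suc i)"] by simp
    have "(Rs (Suc i) p)(1 := 0) = Rs (Suc i) p" for p
      using inv[of p "Suc i"] by (simp add: good_def fun_upd_idem)
    then have "S (Suc i) = (\<lambda>p. (Rs (Suc i) p)(1 := 0), mem_seq P R m (Suc i))"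
      by (simp add: S_def)
    moreover have "exec P (Block main_ops ;; Put 77 ;; Block [Op (Sub 71 71 2)]) (S i) 53 (Rs (Suc i), mem_seq P R m (Suc i))"
      using exec.Seq[OF 1 exec.Seq[OF 2 3]] by (simp add: main_ops_def)
    ultimately show "\<exists>R m. exec P (Block main_ops ;; Put 77 ;; Block [Op (Sub 71 71 2)]) (S i) 53 (R, m) \<and>
        S (Suc i) = (\<lambda>p. (R p)(1 := 0), m)"
      by blast
  qed
  then show ?thesis
    using inv[of _ k] unfolding main_com_def S_def Rs(1) mem_seq.simps(1)
    by (intro exI[of _ "Rs k"]) simp
qed

text \<open>An inactive queried cell weighs 1 and an active one 2, so the total is 1 iff exactly one
  cell is queried and it is inactive.\<close>

definition leaf_val :: "(nat \<Rightarrow> nat) \<Rightarrow> nat \<Rightarrow> nat \<Rightarrow> nat" where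
  "leaf_val m n c = (if m (c + n * n + 1) = 0 then 0 else m (c + 1) + 1)"

abbreviation input_darts :: "(nat \<Rightarrow> nat) \<Rightarrow> nat \<Rightarrow> nat \<Rightarrow> (nat \<times> nat) set" where
  "input_darts m n V \<equiv> darts n V (\<lambda>v. m (v + 1) \<noteq> 0) (\<lambda>w. m (w + n * n + 1) \<noteq> 0)"

lemma walk_table_input:
  assumes "16 * V = 2 ^ W" "0 < V"
  shows "walk_table W (16 * V) (input_darts m n V) (9 * V)"
proof
  show "a < 16 * V \<and> b < 16 * V" if "(a, b) \<in> input_darts m n V" for a b
    using that by (simp add: darts_def)
  show "a \<noteq> 9 * V \<and> b \<noteq> 9 * V" if "(a, b) \<in> input_darts m n V" for a b
    using that assms(2) by (auto simp: darts_def dart_edge_def)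
qed (use assms in simp)

text \<open>Position \<open>t * N + c\<close> of the pair \<open>(a, b)\<close> is kept in the cell
  whose base-\<open>N\<close> digits are \<open>a\<close>, \<open>b\<close>, \<open>t\<close>,
  \<open>c\<close>. Processors within the table read only cells within the table, so those beyond
  \<open>N ^ 4\<close> do not influence it.\<close>

lemma mem_seq_tab:
  assumes V: "N = 16 * V" "N = 2 ^ W" "0 < V" and P: "N * N * N * N \<le> P"
    and L: "L = 2 * (n * n)" and R: "\<And>p. prep_post m N V L p (R p)"
    and z: "\<And>p. p < P \<Longrightarrow> m' p = 0"
  shows "a < N \<Longrightarrow> b < N \<Longrightarrow> x < N * N \<Longrightarrow>
    mem_seq P R m' i ((a * N + b) * N * N + x) =
      walk_table.tab N (input_darts m n V) (9 * V) (leaf_val m n) i a b x"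
proof -
  interpret walk_table W N "input_darts m n V" "9 * V" "leaf_val m n"
    using walk_table_input[of V W n m] V by simp
  have less: "(a * N + b) * N * N + x < P" if "a < N" "b < N" "x < N * N" for a b x
  proof -
    have "a * N + b < (a + 1) * N" using that by simp
    also have "\<dots> \<le> N * N" using that by (intro mult_le_mono1) simp
    finally have "(a * N + b + 1) * (N * N) \<le> (N * N) * (N * N)" by (intro mult_le_mono1) simp
    then have "(a * N + b) * N * N + N * N \<le> P" using P by (simp add: algebra_simps)
    then show ?thesis using that by linarith
  qed
  show "a < N \<Longrightarrow> b < N \<Longrightarrow> x < N * N \<Longrightarrow>
    mem_seq P R m' i ((a * N + b) * N * N + x) = tab i a b x"
  proof (induction i arbitrary: a b x)
    case 0
    then show ?case using less[OF 0] z by (simp only: mem_seq.simps tab.simps)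
  next
    case (Suc i)
    define p where "p = (a * N + b) * N * N + x"
    let ?M = "mem_seq P R m' i"
    have Npos: "0 < N" using V by simp
    have c: "p mod N = x mod N" by (simp add: p_def)
    have pN: "p div N = (a * N + b) * N + x div N" using Npos by (simp add: p_def)
    have xN: "x div N < N" using Suc.prems(3) by (simp add: less_mult_imp_div_less)
    have t: "p div N mod N = x div N" using xN by (simp add: pN)
    have pNN: "p div N div N = a * N + b" using Npos xN by (simp add: pN)
    have b: "p div N div N mod N = b" using Suc.prems by (simp add: pNN)
    have a: "p div N div N div N = a" using Suc.prems Npos by (simp add: pNN)
    have sq: "floor_sqrt (L div 2) = n" using L by (simp flip: power2_eq_square)
    have t0: "x div N = 0 \<longleftrightarrow> x < N" using Npos by (simp add: div_eq_0_iff)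
    have post: "R p 25 = x div N" "R p 32 = (if x < N then p + x mod N else root_cell N a (x mod N))"
      "R p 33 = (if x < N then p + x mod N + 1 else root_cell N (x mod N) b)" "R p 68 = 0 \<longleftrightarrow> a = 9 * V"
      "R p 66 = table_base m n V a b (x mod N) (x div N)"
      using R[of p] L unfolding prep_post_def Let_def a b c t sq t0 by auto
    have "a < 16 * V" "b < 16 * V" using Suc.prems(1,2) unfolding V(1) by simp_all
    then have base: "R p 66 = base a b x"
      unfolding post(5) table_base_def base_def t0 leaf_val_def
      by (simp add: darts_def)
    have "2 \<le> N" using V(1,3) by simp
    then have N2: "2 * N \<le> N * N" by (intro mult_le_mono1)
    have int: "?M (R p 32) = tab i a b (2 * x)" "?M (R p 33) = tab i a b (2 * x + 1)" if "x < N"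
    proof -
      have "R p 32 = (a * N + b) * N * N + 2 * x" "R p 33 = (a * N + b) * N * N + (2 * x + 1)"
        unfolding post using that by (simp_all add: p_def)
      moreover have "2 * x < N * N" "2 * x + 1 < N * N" using that N2 by linarith+
      ultimately show "?M (R p 32) = tab i a b (2 * x)" "?M (R p 33) = tab i a b (2 * x + 1)"
        using Suc.IH[OF Suc.prems(1,2)] by metis+
    qed
    have leaf: "?M (R p 32) = tab i a (x mod N) 1" "?M (R p 33) = tab i (x mod N) b 1" if "\<not> x < N"
      using Suc.IH[of a "x mod N" 1] Suc.IH[of "x mod N" b 1] Suc.prems Npos N2 that
      unfolding post root_cell_def by auto
    have "mem_seq P R m' (Suc i) p = cell_step (R p) ?M"
      using less[OF Suc.prems] by (simp add: p_def)
    also have "\<dots> = tab (Suc i) a b x"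
    proof (cases "x < N")
      case True
      then show ?thesis
        unfolding cell_step_def tab.simps base post(1) t0 post(4) int[OF True] by (simp only: if_True)
    next
      case False
      then show ?thesis
        unfolding cell_step_def tab.simps base post(1) t0 post(4) leaf[OF False] by (simp only: if_False)
    qed
    finally show ?case by (simp only: p_def)
  qed
qed

section \<open>Reading off the answer\<close>

text \<open>The minimum with the cutoff is \<open>x - (x - N)\<close> in truncated
  arithmetic.\<close>

definition cap_ops :: "nat \<Rightarrow> op list" where
  "cap_ops r = [Op (Load r r), Op (Sub 86 r 85), Op (Sub r r 86)]"

definition excess_ops :: "nat \<Rightarrow> nat \<Rightarrow> nat \<Rightarrow> op list" where
  "excess_ops r a b =
     [Op (Sub 88 a b), Op (Add 88 88 b), Op (Sub 90 r 88), Op (Add 89 89 90)]"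

text \<open>Register 89 collects defects: the excess of each branch over the maximum of the other
  three, positive only at a unique maximum, the distance of the sum in row \<open>9 * V\<close> from
  1, and the failure of the length to be twice a square. It is finally turned into a truth
  value.\<close>

definition answer_ops :: "op list" where
  "answer_ops = cap_ops 80 @ cap_ops 81 @ cap_ops 82 @ cap_ops 83 @
    [Op (Load 84 84), Op (Sub 86 80 81), Op (Add 86 86 81), Op (Sub 87 82 83), Op (Add 87 87 83), Op (Const 89 0)] @
    excess_ops 80 81 87 @ excess_ops 81 80 87 @ excess_ops 82 83 86 @ excess_ops 83 82 86 @
    [Op (Sub 90 84 2), Op (Add 89 89 90), Op (Sub 90 2 84), Op (Add 89 89 90),
     Op (Add 90 9 9), Op (Sub 90 6 90), Op (Add 89 89 90), Op (Sub 90 9 14), Op (Add 89 89 90),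
     Op (Sub 89 2 89)]"

lemma ex_less_4_iff: "(\<exists>k<4. Q k) \<longleftrightarrow> Q (0::nat) \<or> Q 1 \<or> Q 2 \<or> Q 3"
  unfolding less_4_cases by auto

lemma all_less_4_iff: "(\<forall>k<4. Q k) \<longleftrightarrow> Q (0::nat) \<and> Q 1 \<and> Q 2 \<and> Q 3"
  using ex_less_4_iff[of "\<lambda>k. \<not> Q k"] by blast

lemma answer_arith:
  "(1::nat) - ((a - a') + (b - b') + (c - c') + (d - d') + (q - 1) + (1 - q) + e + (f - s)) = 1 \<longleftrightarrow>
     \<not> (a' < a \<or> b' < b \<or> c' < c \<or> d' < d) \<and> q = 1 \<and> e = 0 \<and> f \<le> s"
  by auto

lemma unique_max_4_iff:
  fixes h :: "nat \<Rightarrow> nat"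
  shows "(\<exists>k<4. \<forall>l<4. l \<noteq> k \<longrightarrow> h l < h k) \<longleftrightarrow>
      h 0 > max (h 1) (max (h 2) (h 3)) \<or> h 1 > max (h 0) (max (h 2) (h 3)) \<or>
      h 2 > max (h 3) (max (h 0) (h 1)) \<or> h 3 > max (h 2) (max (h 0) (h 1))"
proof -
  have "(\<forall>l<4. l \<noteq> 0 \<longrightarrow> h l < h 0) \<longleftrightarrow> h 0 > max (h 1) (max (h 2) (h 3))"
    "(\<forall>l<4. l \<noteq> 1 \<longrightarrow> h l < h 1) \<longleftrightarrow> h 1 > max (h 0) (max (h 2) (h 3))"
    "(\<forall>l<4. l \<noteq> 2 \<longrightarrow> h l < h 2) \<longleftrightarrow> h 2 > max (h 3) (max (h 0) (h 1))"
    "(\<forall>l<4. l \<noteq> 3 \<longrightarrow> h l < h 3) \<longleftrightarrow> h 3 > max (h 2) (max (h 0) (h 1))"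
    unfolding all_less_4_iff by auto
  then show ?thesis unfolding ex_less_4_iff by (simp only:)
qed

lemma answer_ops_sem:
  assumes g: "good W E p \<rho>" and \<rho>: "\<rho> 6 = L" "\<rho> 9 = L div 2" "\<rho> 14 = s" "\<rho> 85 = N"
    and h: "\<And>k. k < 4 \<Longrightarrow> h k = min N (m (\<rho> (80 + k)))"
  shows "block_sem answer_ops m \<rho> 89 = 1 \<longleftrightarrow>
    \<not> (\<exists>k<4. \<forall>l<4. l \<noteq> k \<longrightarrow> h l < h k) \<and> m (\<rho> 84) = 1 \<and> even L \<and> L div 2 \<le> s"
proof -
  have \<rho>': "\<rho> 1 = 0" "\<rho> 2 = 1" using g by (auto simp: good_def)
  have mn: "x - (x - N) = min N x" for x :: nat by auto
  have h': "min N (m (\<rho> 80)) = h 0" "min N (m (\<rho> 81)) = h 1" "min N (m (\<rho> 82)) = h 2" "min N (m (\<rho> 83)) = h 3"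
    using h[of 0] h[of 1] h[of 2] h[of 3] by simp_all
  have "block_sem answer_ops m \<rho> 89 = 1 -
     (h 0 - max (h 1) (max (h 2) (h 3)) + (h 1 - max (h 0) (max (h 2) (h 3))) +
      (h 2 - max (h 3) (max (h 0) (h 1))) + (h 3 - max (h 2) (max (h 0) (h 1))) +
      (m (\<rho> 84) - 1) + (1 - m (\<rho> 84)) + (L - (L div 2 + L div 2)) + (L div 2 - s))"
    by (simp add: answer_ops_def cap_ops_def excess_ops_def \<rho> \<rho>' \<rho>'[simplified] diff_add_max mn h')
  then have "block_sem answer_ops m \<rho> 89 = 1 \<longleftrightarrow>
      \<not> (h 0 > max (h 1) (max (h 2) (h 3)) \<or> h 1 > max (h 0) (max (h 2) (h 3)) \<or>
         h 2 > max (h 3) (max (h 0) (h 1)) \<or> h 3 > max (h 2) (max (h 0) (h 1))) \<and>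
      m (\<rho> 84) = 1 \<and> L - (L div 2 + L div 2) = 0 \<and> L div 2 \<le> s"
    by (simp only: answer_arith)
  moreover have "L - (L div 2 + L div 2) = 0 \<longleftrightarrow> even L" by presburger
  ultimately show ?thesis unfolding unique_max_4_iff by blast
qed

definition final_com :: com where
  "final_com = Block [Op (Add 79 69 1), Op (Sub 79 79 70)] ;; root_addr 80 79 70 ;;
     Block [Op (Add 79 79 7)] ;; root_addr 81 79 70 ;; Block [Op (Add 79 79 7)] ;; root_addr 82 79 70 ;;
     Block [Op (Add 79 79 7)] ;; root_addr 83 79 70 ;; root_addr 84 69 1 ;;
     Block [Op (Const 85 1)] ;; shl 85 4 ;; Block answer_ops"

lemma hoare_final:
  fixes W E :: nat
  defines "N \<equiv> 2 ^ W"
  shows "hoare P m W E final_com (W * 176 + 340)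
    (\<lambda>p \<rho>. \<rho> 6 = L \<and> \<rho> 7 = V \<and> \<rho> 9 = L div 2 \<and> \<rho> 14 = s \<and> \<rho> 69 = 9 * V \<and> \<rho> 70 = 4 * V \<and> \<rho> 1 = 0)
    (\<lambda>p \<rho>. \<rho> 89 = 1 \<longleftrightarrow>
       \<not> (\<exists>k<4. \<forall>l<4. l \<noteq> k \<longrightarrow> min N (m (root_cell N ((5 + l) * V) (4 * V))) < min N (m (root_cell N ((5 + k) * V) (4 * V)))) \<and>
       m (root_cell N (9 * V) 0) = 1 \<and> even L \<and> L div 2 \<le> s)"
proof -
  let ?F = "\<lambda>(p::nat) \<rho>. \<rho> 6 = L \<and> \<rho> 7 = V \<and> \<rho> 9 = L div 2 \<and> \<rho> 14 = s \<and> \<rho> 69 = 9 * V \<and> \<rho> 70 = 4 * V \<and> \<rho> 1 = (0::nat)"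
  let ?A = "\<lambda>j p \<rho>. ?F p \<rho> \<and> (\<forall>k<j. \<rho> (80 + k) = root_cell N ((5 + k) * V) (4 * V))"
  have 0: "hoare P m W E (Block [Op (Add 79 69 1), Op (Sub 79 79 70)]) (4 * length [Op (Add 79 69 1), Op (Sub 79 79 70)])
      ?F (\<lambda>p \<rho>. ?A 0 p \<rho> \<and> \<rho> 79 = (5 + 0) * V)"
    by (rule hoare_block) (simp_all add: safe_def)
  have r: "hoare P m W E (root_addr z 79 70) (W * 33 + 27) (\<lambda>p \<rho>. ?A j p \<rho> \<and> \<rho> 79 = (5 + j) * V)
      (\<lambda>p \<rho>. ?A (Suc j) p \<rho> \<and> \<rho> 79 = (5 + j) * V)"
    if "z = 80 + j" "j < 4" for z j
    by (rule hoare_extend[OF hoare_root_addr[where u = "\<lambda>_. (5 + j) * V" and v = "\<lambda>_. 4 * V"]])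
      (use that in \<open>auto simp: targets_root_addr N_def less_Suc_eq\<close>)
  have i: "hoare P m W E (Block [Op (Add 79 79 7)]) (4 * length [Op (Add 79 79 7)]) (\<lambda>p \<rho>. ?A (Suc j) p \<rho> \<and> \<rho> 79 = (5 + j) * V)
      (\<lambda>p \<rho>. ?A (Suc j) p \<rho> \<and> \<rho> 79 = (5 + Suc j) * V)" for j
    by (rule hoare_block) (simp_all add: safe_def algebra_simps)
  let ?B = "\<lambda>p \<rho>. ?A 4 p \<rho> \<and> \<rho> 84 = root_cell N (9 * V) 0"
  have q: "hoare P m W E (root_addr 84 69 1) (W * 33 + 27) (\<lambda>p \<rho>. ?A (Suc (Suc (Suc (Suc 0)))) p \<rho> \<and> \<rho> 79 = (5 + Suc (Suc (Suc 0))) * V) ?B"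
    by (rule hoare_extend[OF hoare_root_addr[where u = "\<lambda>_. 9 * V" and v = "\<lambda>_. 0"]])
      (auto simp: targets_root_addr N_def)
  have c: "hoare P m W E (Block [Op (Const 85 1)]) (4 * length [Op (Const 85 1)]) ?B (\<lambda>p \<rho>. ?B p \<rho> \<and> \<rho> 85 = 1)"
    by (rule hoare_block) (auto simp: safe_def)
  have s: "hoare P m W E (shl 85 4) (W * 11 + 5) (\<lambda>p \<rho>. ?B p \<rho> \<and> \<rho> 85 = 1) (\<lambda>p \<rho>. ?B p \<rho> \<and> \<rho> 85 = N)"
    by (rule hoare_extend[OF hoare_shl[where v = "\<lambda>_. 1"]]) (auto simp: targets_shl N_def)
  have a: "hoare P m W E (Block answer_ops) (4 * length answer_ops) (\<lambda>p \<rho>. ?B p \<rho> \<and> \<rho> 85 = N)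
    (\<lambda>p \<rho>. \<rho> 89 = 1 \<longleftrightarrow>
       \<not> (\<exists>k<4. \<forall>l<4. l \<noteq> k \<longrightarrow> min N (m (root_cell N ((5 + l) * V) (4 * V))) < min N (m (root_cell N ((5 + k) * V) (4 * V)))) \<and>
       m (root_cell N (9 * V) 0) = 1 \<and> even L \<and> L div 2 \<le> s)"
  proof (rule hoare_block)
    show "safe (Block answer_ops)" by (simp add: safe_def answer_ops_def cap_ops_def excess_ops_def)
    fix p \<rho> assume g: "good W E p \<rho>" and B: "?B p \<rho> \<and> \<rho> 85 = N"
    have B84: "\<rho> 84 = root_cell N (9 * V) 0" using B by blast
    show "block_sem answer_ops m \<rho> 89 = 1 \<longleftrightarrow>
       \<not> (\<exists>k<4. \<forall>l<4. l \<noteq> k \<longrightarrow> min N (m (root_cell N ((5 + l) * V) (4 * V))) < min N (m (root_cell N ((5 + k) * V) (4 * V)))) \<and>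
       m (root_cell N (9 * V) 0) = 1 \<and> even L \<and> L div 2 \<le> s"
      unfolding B84[symmetric]
      by (rule answer_ops_sem[OF g, where h = "\<lambda>k. min N (m (root_cell N ((5 + k) * V) (4 * V)))"]) (use B in auto)
  qed
  show ?thesis
    unfolding final_com_def
    by (rule hoare_conseq[OF hoare_seq[OF 0 hoare_seq[OF r[of 80 0] hoare_seq[OF i[of 0]
      hoare_seq[OF r[of 81 "Suc 0"] hoare_seq[OF i hoare_seq[OF r[of 82 "Suc (Suc 0)"] hoare_seq[OF i
      hoare_seq[OF r[of 83 "Suc (Suc (Suc 0))"] hoare_seq[OF q hoare_seq[OF c hoare_seq[OF s a]]]]]]]]]]]])
      (simp_all add: answer_ops_def cap_ops_def excess_ops_def)
qed

section \<open>Encoded instances\<close>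

lemma length_encode: "length (encode n x u) = 2 * (n * n)"
  by (simp add: encode_def)

lemma nth_encode:
  assumes "v < n * n"
  shows "encode n x u ! v = x (v div n, v mod n)" "encode n x u ! (n * n + v) = ((v div n, v mod n) = u)"
proof -
  have n: "0 < n" using assms by (cases n) auto
  have "List.product [0..<n] [0..<n] ! v = (v div n, v mod n)"
    using product_nth[of v "[0..<n]" "[0..<n]"] assms n by (simp add: less_mult_imp_div_less)
  then show "encode n x u ! v = x (v div n, v mod n)" "encode n x u ! (n * n + v) = ((v div n, v mod n) = u)"
    using assms by (simp_all add: encode_def nth_append)
qed

lemma encode_eqI:
  assumes "length w = 2 * (n * n)" "\<And>v. v < n * n \<Longrightarrow> w ! v = x (v div n, v mod n)"
    "\<And>v. v < n * n \<Longrightarrow> w ! (n * n + v) = ((v div n, v mod n) = u)"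
  shows "w = encode n x u"
proof (rule nth_equalityI)
  show "length w = length (encode n x u)" using assms by (simp add: length_encode)
  fix i assume i: "i < length w"
  show "w ! i = encode n x u ! i"
  proof (cases "i < n * n")
    case True
    then show ?thesis using assms nth_encode by simp
  next
    case False
    then have "i = n * n + (i - n * n)" "i - n * n < n * n" using i assms(1) by auto
    then show ?thesis using assms(3) nth_encode(2) by metis
  qed
qed

lemma torus_index_nat:
  assumes "i < n" "j < n"
  shows "torus_index n (int i, int j) = i * n + j"
  using assms by (simp add: torus_index_def)

lemma periodic_torus_index:
  assumes "0 < n"
  shows "periodic n x u = x (torus_index n u div n, torus_index n u mod n)"
proof -
  have "nat (fst u mod int n) < n" "nat (snd u mod int n) < n" using assms by (auto simp: nat_less_iff)
  then show ?thesis by (simp add: torus_index_def periodic_def split_beta)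
qed

lemma input_bits:
  assumes w: "length w = 2 * (n * n)"
  shows "v < n * n \<Longrightarrow> shared (initial w) (v + 1) = of_bool (w ! v)"
    "shared (initial w) (v + n * n + 1) = of_bool (v < n * n \<and> w ! (n * n + v))"
  using w by (auto simp: initial_def add.commute)

text \<open>The sum has to be tested together with the maximum: it certifies that the second half of
  the word marks a single cell, and only then do the sources measure the branches of that
  cell.\<close>

lemma accept_iff:
  fixes n E :: nat
  defines "V \<equiv> 2 ^ E" and "N \<equiv> 2 ^ (E + 4)"
  assumes w: "length w = 2 * (n * n)" and V: "2 * (n * n) < V" and r: "(E + 5) * (E + 6) \<le> r"
    and m: "m = shared (initial w)"
    and T: "T = walk_table.tab N (input_darts m n V) (9 * V) (leaf_val m n) r"
  shows "\<not> (\<exists>k<4. \<forall>l<4. l \<noteq> k \<longrightarrow> min N (T ((5 + l) * V) (4 * V) 1) < min N (T ((5 + k) * V) (4 * V) 1)) \<and>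
     T (9 * V) 0 1 = 1 \<longleftrightarrow> w \<in> stability {3}"
proof -
  have NV: "N = 16 * V" by (simp add: N_def V_def power_add)
  have N2: "16 * V = 2 ^ (E + 4)" using NV by (simp add: N_def)
  have "0 < V" by (simp add: V_def)
  interpret walk_table "E + 4" N "input_darts m n V" "9 * V" "leaf_val m n"
    using walk_table_input[OF N2 \<open>0 < V\<close>] unfolding NV .
  have "E + 4 < r" using r by (rule less_le_trans[rotated]) (simp add: algebra_simps)
  then have Tq: "T (9 * V) 0 1 = (\<Sum>c<N. leaf_val m n c)"
    unfolding T by (rule tab_q_root)
  have leaf: "leaf_val m n c = (if c < n * n \<and> w ! (n * n + c) then of_bool (w ! c) + 1 else 0)" for c
    using input_bits[OF w, of c] by (auto simp: leaf_val_def m)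
  let ?max = "\<exists>k<4. \<forall>l<4. l \<noteq> k \<longrightarrow> min N (T ((5 + l) * V) (4 * V) 1) < min N (T ((5 + k) * V) (4 * V) 1)"
  have enc: "\<not> ?max \<and> T (9 * V) 0 1 = 1 \<longleftrightarrow> \<not> x (i, j) \<and> stable {3} (periodic n x) (int i, int j)"
    if e: "w = encode n x (i, j)" and ij: "i < n" "j < n" for x i j
  proof -
    define u where "u = i * n + j"
    have u: "torus_index n (int i, int j) = u" using ij by (simp add: torus_index_nat u_def)
    have n: "0 < n" using ij by simp
    have un: "u < n * n" using torus_index_less[OF n, of "(int i, int j)"] u by simp
    have U: "(c div n, c mod n) = (i, j) \<longleftrightarrow> c = u" for c
      using ij by (auto simp: u_def)
    have leaf': "leaf_val m n c = (if c = u then of_bool (x (i, j)) + 1 else 0)" for c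
    proof -
      have "leaf_val m n c = (if c < n * n \<and> c = u then of_bool (w ! c) + 1 else 0)"
        unfolding leaf using nth_encode(2)[of c n x "(i, j)"] U[of c] unfolding e by metis
      moreover have "w ! u = x (i, j)"
        using nth_encode(1)[OF un, of x "(i, j)"] U[of u] unfolding e by simp
      ultimately show ?thesis using un by auto
    qed
    have "u < N" using un V NV by simp
    then have q: "T (9 * V) 0 1 = of_bool (x (i, j)) + 1"
      unfolding Tq leaf' by (simp add: sum.delta)
    have "stable {3} (periodic n x) (int i, int j) \<longleftrightarrow> \<not> (m (torus_index n (int i, int j) + 1) \<noteq> 0) \<and>
      \<not> (\<exists>k<4. \<forall>l<4. l \<noteq> k \<longrightarrow>
        min (16 * V) (walk_table.tab (16 * V) (input_darts m n V) (9 * V) (leaf_val m n) r ((5 + l) * V) (4 * V) 1)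
        < min (16 * V) (walk_table.tab (16 * V) (input_darts m n V) (9 * V) (leaf_val m n) r ((5 + k) * V) (4 * V) 1))"
    proof (rule stable_iff_no_unique_max[OF n _ V N2])
      show "periodic n x v \<longleftrightarrow> m (torus_index n v + 1) \<noteq> 0" for v
        using nth_encode(1)[OF torus_index_less[OF n], of x "(i, j)"] input_bits(1)[OF w torus_index_less[OF n]]
          periodic_torus_index[OF n] unfolding m e by simp
      show "m (c + n * n + 1) \<noteq> 0 \<longleftrightarrow> c = torus_index n (int i, int j)" for c
      proof -
        have "m (c + n * n + 1) \<noteq> 0 \<longleftrightarrow> c < n * n \<and> (c div n, c mod n) = (i, j)"
          using input_bits(2)[OF w, of c] nth_encode(2)[of c n x "(i, j)"] unfolding m e by auto
        then show ?thesis using un U u by auto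
      qed
      show "walk_table (E + 4) (16 * V) (input_darts m n V) (9 * V)"
        by (rule walk_table_input[OF N2 \<open>0 < V\<close>])
      show "(E + 4 + 1) * (E + 4 + 2) \<le> r" using r by (simp add: add.commute)
    qed simp
    moreover have "m (torus_index n (int i, int j) + 1) = of_bool (x (i, j))"
      using input_bits(1)[OF w un] nth_encode(1)[OF un, of x "(i, j)"] U[of u] unfolding m u e by simp
    ultimately have "stable {3} (periodic n x) (int i, int j) \<longleftrightarrow> \<not> x (i, j) \<and> \<not> ?max"
      unfolding T NV by simp
    then show ?thesis using q by auto
  qed
  show ?thesis
  proof
    assume acc: "\<not> ?max \<and> T (9 * V) 0 1 = 1"
    then have "(\<Sum>c<N. leaf_val m n c) = 1" using Tq by simp
    \<comment> \<open>A sum of naturals equal to 1 has a single nonzero term, equal to 1; this term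
      is the queried cell and shows it inactive.\<close>
    then obtain u where u: "u < N" "leaf_val m n u = 1" "\<And>c. c < N \<Longrightarrow> c \<noteq> u \<Longrightarrow> leaf_val m n c = 0"
      by (subst (asm) sum_eq_1_iff) auto
    then have un: "u < n * n" by (auto simp: leaf split: if_splits)
    have n: "0 < n" using un by (cases n) auto
    define x where "x = (\<lambda>(a, b). w ! (a * n + b))"
    have wU: "w ! (n * n + v) \<longleftrightarrow> v = u" if "v < n * n" for v
      using u(2) u(3)[of v] that V NV leaf[of v] by (cases "v = u") (auto split: if_splits)
    have "w = encode n x (u div n, u mod n)"
    proof (rule encode_eqI[OF w])
      show "w ! v = x (v div n, v mod n)" for v by (simp add: x_def)
      show "w ! (n * n + v) = ((v div n, v mod n) = (u div n, u mod n))" if "v < n * n" for v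
        unfolding wU[OF that] by (metis div_mult_mod_eq prod.inject)
    qed
    moreover have "u div n < n" "u mod n < n" using un n by (simp_all add: less_mult_imp_div_less)
    ultimately show "w \<in> stability {3}"
      using enc acc unfolding stability_def by blast
  next
    assume "w \<in> stability {3}"
    then obtain n' x i j where e: "w = encode n' x (i, j)" "i < n'" "j < n'" "\<not> x (i, j)"
      "stable {3} (periodic n' x) (int i, int j)"
      unfolding stability_def by blast
    have "n' * n' = n * n" using w length_encode[of n' x "(i, j)"] e(1) by simp
    then have "n' = n" using power2_eq_square power2_eq_imp_eq by (metis zero_le)
    then show "\<not> ?max \<and> T (9 * V) 0 1 = 1"
      using enc e by blast
  qed
qed

section \<open>The program\<close>

text \<open>\<open>Load 6 1\<close> reads cell 0, the input length, because register 1 is initially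
  0. Register 11 is the truncated difference of length plus one and the current power of two,
  nonzero as long as that power does not exceed the length.\<close>

definition init_ops :: "op list" where
  "init_ops = [Op (Const 2 1), Op (Load 6 1), Op (Half 9 6), Op (Const 7 1), Op (Const 8 1),
     Op (Add 10 6 2), Op (Sub 11 10 7)]"

definition double_ops :: "op list" where
  "double_ops = [Op (Add 7 7 7), Op (Add 8 8 8), Op (Add 8 8 8), Op (Add 5 5 2), Op (Sub 11 10 7)]"

definition init_com :: com where
  "init_com = Block init_ops ;; While 11 (Block double_ops) ;; Block [Op (Const 12 4), Op (Add 4 5 12)]"

definition bit_size :: "nat \<Rightarrow> nat" where
  "bit_size L = (LEAST e. L < 2 ^ e)"

lemma less_bit_size: "L < 2 ^ bit_size L"
  unfolding bit_size_def by (rule LeastI[of _ L]) (rule less_exp)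

lemma bit_size_bound: "2 ^ bit_size L \<le> 2 * (L + 1)"
proof (cases "bit_size L")
  case (Suc e)
  then have "\<not> L < 2 ^ e" using not_less_Least[of e "\<lambda>e. L < 2 ^ e"] by (simp add: bit_size_def)
  then show ?thesis by (simp add: Suc)
qed simp

text \<open>The constants demanded by \<open>good\<close> are only being set up here, so this
  stretch is executed directly instead of through triples.\<close>

lemma exec_init:
  assumes L: "m 0 = L" and E: "E = bit_size L"
  shows "\<exists>R. exec P init_com (\<lambda>p r. if r = 0 then p else 0, m) (E * 23 + 37) (R, m) \<and>
    (\<forall>p. good (E + 4) E p (R p)) \<and>
    (\<forall>p. R p 6 = L \<and> R p 7 = 2 ^ E \<and> R p 8 = 2 ^ E * 2 ^ E \<and> R p 9 = L div 2)"
proof -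
  let ?I = "\<lambda>p r. if r = 0 then p else (0::nat)"
  let ?R = "\<lambda>p. block_sem init_ops m (?I p)"
  define S where "S = (\<lambda>i. (\<lambda>p. (?R p)(7 := 2 ^ i, 8 := 2 ^ i * 2 ^ i, 5 := i, 11 := L + 1 - 2 ^ i), m))"
  have R: "?R p r = (if r = 0 then p else if r = 2 then 1 else if r = 6 then L else if r = 9 then L div 2
     else if r = 7 then 1 else if r = 8 then 1 else if r = 10 then L + 1 else if r = 11 then L else 0)" for p r
    by (simp add: init_ops_def L)
  have R0: "S 0 = (?R, m)"
    by (auto simp: S_def fun_eq_iff R)
  have 1: "exec P (Block init_ops) (?I, m) 28 (S 0)"
    using exec.Block[of P init_ops ?I m] unfolding R0 by (simp add: init_ops_def)
  have 2: "exec P (While 11 (Block double_ops)) (S 0) (E * (20 + 3) + 1) (S E)"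
  proof (rule exec_while)
    show "fst (S E) p 11 = 0" for p using less_bit_size[of L] by (simp add: S_def E)
    fix i assume "i < E"
    then have "\<not> L < 2 ^ i" unfolding E bit_size_def by (rule not_less_Least)
    then show "fst (S i) p 11 \<noteq> 0" for p by (simp add: S_def)
    have "block_sem double_ops m (fst (S i) p) = fst (S (Suc i)) p" for p
      by (rule ext) (simp add: double_ops_def S_def R mult_2[symmetric])
    then have "exec P (Block double_ops) (S i) 20 (fst (S (Suc i)), m)"
      using exec.Block[of P double_ops "fst (S i)" m] by (simp add: S_def double_ops_def)
    moreover have "(fst (S (Suc i)) p)(1 := 0) = fst (S (Suc i)) p" for p
      by (rule fun_upd_idem) (simp add: S_def R)
    ultimately show "\<exists>R m'. exec P (Block double_ops) (S i) 20 (R, m') \<and> S (Suc i) = (\<lambda>p. (R p)(1 := 0), m')"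
      by (intro exI[of _ "fst (S (Suc i))"] exI[of _ m]) (simp add: S_def)
  qed
  let ?R' = "\<lambda>p. block_sem [Op (Const 12 4), Op (Add 4 5 12)] m (fst (S E) p)"
  have 3: "exec P (Block [Op (Const 12 4), Op (Add 4 5 12)]) (S E) 8 (?R', m)"
    using exec.Block[of P "[Op (Const 12 4), Op (Add 4 5 12)]" "fst (S E)" m] by (simp add: S_def)
  have "exec P init_com (?I, m) (E * 23 + 37) (?R', m)"
    using exec.Seq[OF 1 exec.Seq[OF 2 3]] by (simp add: init_com_def add.commute)
  moreover have "good (E + 4) E p (?R' p)" for p
    by (simp add: good_def S_def R)
  moreover have "?R' p 6 = L \<and> ?R' p 7 = 2 ^ E \<and> ?R' p 8 = 2 ^ E * 2 ^ E \<and> ?R' p 9 = L div 2" for p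
    by (simp add: S_def R)
  ultimately show ?thesis by (intro exI[of _ ?R']) blast
qed

text \<open>\<open>Put 1\<close> fills the memory of all processors with zeros, the state of the
  table before round 1; the input has been read into registers by then. The last \<open>Put\<close>
  leaves the answer in every such cell, in particular in cell 0.\<close>

definition stability_com :: com where
  "stability_com = init_com ;; (prep_com ;; rounds_com) ;; Put 1 ;; main_com ;; final_com ;; Put 89"

lemma hoare_com_ok: "hoare P m W E c t A B \<Longrightarrow> com_ok c"
  by (simp add: hoare_def safe_def)

lemma stability_com_ok: "com_ok stability_com"
proof -
  have "com_ok init_com" by (simp add: init_com_def init_ops_def double_ops_def)
  moreover have "com_ok prep_com" using hoare_prep[of 0 0] by (intro hoare_com_ok) simp
  moreover have "com_ok main_com" by (simp add: main_com_def main_ops_def)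
  ultimately show ?thesis
    using hoare_rounds[THEN hoare_com_ok] hoare_final[THEN hoare_com_ok]
    by (simp add: stability_com_def)
qed

lemma exec_stability_com:
  fixes w :: "bool list"
  defines "E \<equiv> bit_size (length w)"
  assumes P: "(2 ^ (E + 4)) ^ 4 \<le> P"
  shows "\<exists>R m. exec P stability_com (\<lambda>p r. if r = 0 then p else 0, shared (initial w)) (200 * (E + 6) ^ 2) (R, m) \<and>
    (m 0 = 1 \<longleftrightarrow> w \<in> stability {3})"
proof -
  define W N V where "W = E + 4" and "N = (2::nat) ^ W" and "V = (2::nat) ^ E"
  define L K n where "L = length w" and "K = L div 2" and "n = floor_sqrt K"
  define m0 where "m0 = shared (initial w)"
  define k where "k = (W + 1) * (W + 2)"
  let ?I = "\<lambda>p r. if r = 0 then p else (0::nat)"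
  have NV: "N = 16 * V" by (simp add: N_def V_def W_def power_add)
  have V0: "0 < V" by (simp add: V_def)
  have P4: "N * N * N * N \<le> P" using P by (simp add: N_def W_def power4_eq_xxxx mult.assoc)
  have P0: "0 < P" using P4 NV V0 by (intro gr0I) auto
  have LV: "L < V" using less_bit_size[of L] by (simp add: V_def E_def L_def)
  have m00: "m0 0 = L" by (simp add: m0_def initial_def L_def)
  obtain R1 where R1: "exec P init_com (?I, m0) (E * 23 + 37) (R1, m0)" "\<And>p. good W E p (R1 p)"
    "\<And>p. R1 p 6 = L \<and> R1 p 7 = V \<and> R1 p 8 = V * V \<and> R1 p 9 = L div 2"
    using exec_init[of m0 L E P] m00 unfolding E_def W_def V_def L_def by blast
  have "1 \<le> V" using V0 by simp
  then have "V * 1 \<le> V * V" by (intro mult_le_mono2)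
  then have "L div 2 < V * V" using LV by linarith
  from hoare_prep[OF this[unfolded V_def], of P m0 W]
  have prep: "hoare P m0 W E prep_com (E * 137 + W * 132 + 551)
    (\<lambda>p \<rho>. \<rho> 6 = L \<and> \<rho> 7 = V \<and> \<rho> 8 = V * V \<and> \<rho> 9 = L div 2) (prep_post m0 N V L)"
    unfolding N_def V_def .
  have rounds: "hoare P m0 W E rounds_com (W * 11 + 21) (prep_post m0 N V L)
    (\<lambda>p \<rho>. prep_post m0 N V L p \<rho> \<and> \<rho> 71 = k)"
    by (rule hoare_extend[OF hoare_rounds]) (auto simp: k_def rounds_com_def targets_rep prep_post_def Let_def)
  have "hoare P m0 W E (prep_com ;; rounds_com) (E * 137 + W * 132 + 551 + (W * 11 + 21))
    (\<lambda>p \<rho>. \<rho> 6 = L \<and> \<rho> 7 = V \<and> \<rho> 8 = V * V \<and> \<rho> 9 = L div 2)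
    (\<lambda>p \<rho>. prep_post m0 N V L p \<rho> \<and> \<rho> 71 = k)"
    by (rule hoare_seq[OF prep rounds])
  then obtain R2 where s: "safe (prep_com ;; rounds_com)" and
    R2: "exec P (prep_com ;; rounds_com) (R1, m0) (E * 137 + W * 132 + 551 + (W * 11 + 21)) (R2, m0)"
    and R2_post: "\<And>p. prep_post m0 N V L p (R2 p)" "\<And>p. R2 p 71 = k"
    using R1(2,3) unfolding hoare_def by blast
  have g2: "good W E p (R2 p)" for p
    using exec_good[OF R2 s, of W E p] R1(2) by simp
  define m1 where "m1 = (\<lambda>a. if a < P then 0 else m0 a)"
  have put: "exec P (Put 1) (R2, m0) 1 (R2, m1)"
    using exec.Put[of R2 P 1 m0] g2 by (simp add: good_def m1_def cong: if_cong)
  obtain R3 where R3: "exec P main_com (R2, m1) (k * 56 + 1) (R3, mem_seq P R2 m1 k)"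
    "\<And>p. good W E p (R3 p)" "\<And>p r. r \<notin> {71, 73, 74, 75, 76, 77, 78} \<Longrightarrow> R3 p r = R2 p r"
    using exec_main[of W E R2 k P m1] g2 R2_post(2) by blast
  define m2 where "m2 = mem_seq P R2 m1 k"
  let ?max = "\<exists>k<4. \<forall>l<4. l \<noteq> k \<longrightarrow> min N (m2 (root_cell N ((5 + l) * V) (4 * V))) < min N (m2 (root_cell N ((5 + k) * V) (4 * V)))"
  let ?acc = "\<not> ?max \<and> m2 (root_cell N (9 * V) 0) = 1 \<and> even L \<and> L div 2 \<le> n * n"
  have pre: "R3 p 6 = L \<and> R3 p 7 = V \<and> R3 p 9 = L div 2 \<and> R3 p 14 = n * n \<and> R3 p 69 = 9 * V \<and> R3 p 70 = 4 * V \<and> R3 p 1 = 0"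
    for p
    using R2_post(1)[of p] R3(2)[of p] by (simp add: R3(3) prep_post_def Let_def good_def n_def K_def)
  obtain R4 where R4: "exec P final_com (R3, m2) (W * 176 + 340) (R4, m2)" "\<And>p. R4 p 89 = 1 \<longleftrightarrow> ?acc"
    and s4: "safe final_com"
    using hoare_final[of P m2 W E L V "n * n"] R3(2) pre unfolding hoare_def N_def by blast
  have g4: "good W E p (R4 p)" for p
    using exec_good[OF R4(1) s4, of W E p] R3(2) by simp
  have fin: "exec P (Put 89) (R4, m2) 1 (R4, \<lambda>a. if a < P then R4 a 89 else m2 a)"
    using g4 by (intro exec.Put) (simp add: good_def)
  have "exec P stability_com (?I, m0)
     (E * 23 + 37 + (E * 137 + W * 132 + 551 + (W * 11 + 21) + (1 + ((k * 56 + 1) + ((W * 176 + 340) + 1)))))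
     (R4, \<lambda>a. if a < P then R4 a 89 else m2 a)"
    unfolding stability_com_def
    by (intro exec.Seq[OF R1(1)] exec.Seq[OF R2] exec.Seq[OF put] exec.Seq[OF R3(1)[folded m2_def]] exec.Seq[OF R4(1)] fin)
  moreover have "E * 23 + 37 + (E * 137 + W * 132 + 551 + (W * 11 + 21) + (1 + ((k * 56 + 1) + ((W * 176 + 340) + 1))))
     \<le> 200 * (E + 6) ^ 2"
    by (simp add: k_def W_def power2_eq_square algebra_simps)
  ultimately have "exec P stability_com (?I, m0) (200 * (E + 6) ^ 2) (R4, \<lambda>a. if a < P then R4 a 89 else m2 a)"
    by (rule exec.Weaken)
  moreover have "?acc \<longleftrightarrow> w \<in> stability {3}"
  proof (cases "L = 2 * (n * n)")
    case True
    have tab: "m2 (root_cell N a b) = walk_table.tab N (input_darts m0 n V) (9 * V) (leaf_val m0 n) k a b 1"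
      if "a < N" "b < N" for a b
    proof -
      have "2 \<le> N" using NV V0 by simp
      then have "2 * 2 \<le> N * N" by (intro mult_le_mono)
      then have "1 < N * N" by simp
      then show ?thesis
        unfolding root_cell_def m2_def using NV V0 P4 True R2_post(1) that
        by (intro mem_seq_tab[where W = W and L = L]) (simp_all add: N_def m1_def)
    qed
    have lt: "(5 + j) * V < N" if "j < 4" for j
    proof -
      have "(5 + j) * V < 16 * V" using that V0 by simp
      then show ?thesis unfolding NV .
    qed
    let ?T = "\<lambda>a b x. walk_table.tab N (input_darts m0 n V) (9 * V) (leaf_val m0 n) k a b x"
    have source: "m2 (root_cell N ((5 + j) * V) (4 * V)) = ?T ((5 + j) * V) (4 * V) 1" if "j < 4" for j
      by (rule tab[OF lt[OF that]]) (use NV V0 in simp)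
    have "?max \<longleftrightarrow> (\<exists>k<4. \<forall>l<4. l \<noteq> k \<longrightarrow> min N (?T ((5 + l) * V) (4 * V) 1) < min N (?T ((5 + k) * V) (4 * V) 1))"
      by (intro ex_cong1 conj_cong refl all_cong1 imp_cong) (simp only: source)
    moreover have "m2 (root_cell N (9 * V) 0) = ?T (9 * V) 0 1"
      using NV V0 by (intro tab) auto
    moreover have "even L" "L div 2 \<le> n * n" using True by auto
    moreover have "\<not> (\<exists>k<4. \<forall>l<4. l \<noteq> k \<longrightarrow> min N (?T ((5 + l) * V) (4 * V) 1) < min N (?T ((5 + k) * V) (4 * V) 1)) \<and>
      ?T (9 * V) 0 1 = 1 \<longleftrightarrow> w \<in> stability {3}"
      unfolding N_def V_def W_def
      by (rule accept_iff[where r = k and m = m0, OF _ _ _ _ refl])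
        (use True LV in \<open>simp_all add: L_def V_def k_def W_def m0_def add.commute\<close>)
    ultimately show ?thesis by (simp only: simp_thms)
  next
    case False
    have "n * n \<le> K" using floor_sqrt_power2_le[of K] by (simp add: n_def power2_eq_square)
    then have "\<not> (even L \<and> L div 2 \<le> n * n)" using False K_def by auto
    moreover have "w \<notin> stability {3}"
    proof
      assume "w \<in> stability {3}"
      then obtain n' x u where "w = encode n' x u" unfolding stability_def by blast
      then have "L = 2 * (n' * n')" by (simp add: L_def length_encode)
      moreover from this have "n = n'" by (simp add: n_def K_def flip: power2_eq_square)
      ultimately show False using False by simp
    qed
    ultimately show ?thesis by blast
  qed
  ultimately show ?thesis
    using R4(2) P0 unfolding m0_def by (intro exI[of _ R4] exI[of _ "\<lambda>a. if a < P then R4 a 89 else m2 a"]) simp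
qed

section \<open>Resource bounds\<close>

lemma processors_bound: "(2 ^ (bit_size L + 4)) ^ 4 \<le> L ^ (64 ^ 4) + 64 ^ 4"
proof -
  \<comment> \<open>One number serves as exponent and as additive constant. Lengths 0 and 1 need
    \<open>(32 * 2) ^ 4 = 64 ^ 4\<close>; from length 2 on, \<open>32 <= L ^ 5\<close> and
    \<open>L + 1 <= L ^ 2\<close> make the exponent 28 sufficient.\<close>
  define d :: nat where "d = 64 ^ 4"
  have d: "28 \<le> d" by (simp add: d_def)
  have "2 ^ (bit_size L + 4) \<le> 32 * (L + 1)"
    using bit_size_bound[of L] by (simp add: power_add)
  then have le: "(2 ^ (bit_size L + 4)) ^ 4 \<le> (32 * (L + 1)) ^ 4" by (rule power_mono) simp
  also have "\<dots> \<le> L ^ d + d"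
  proof (cases "L \<le> 1")
    case True
    then have "(32 * (L + 1)) ^ 4 \<le> (64::nat) ^ 4" by (intro power_mono) auto
    then show ?thesis unfolding d_def by (rule trans_le_add2)
  next
    case False
    then have "2 ^ 5 \<le> L ^ 5" by (intro power_mono) auto
    moreover have "L + 1 \<le> L ^ 2"
    proof -
      have "2 * L \<le> L * L" using False by (intro mult_le_mono1) simp
      then show ?thesis using False unfolding power2_eq_square by linarith
    qed
    ultimately have "2 ^ 5 * (L + 1) \<le> L ^ 5 * L ^ 2" by (rule mult_le_mono)
    then have "32 * (L + 1) \<le> L ^ 7" by (simp flip: power_add)
    then have "(32 * (L + 1)) ^ 4 \<le> (L ^ 7) ^ 4" by (rule power_mono) simp
    also have "\<dots> = L ^ 28" by (simp flip: power_mult)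
    also have "\<dots> \<le> L ^ d" using False d by (intro power_increasing) auto
    finally show ?thesis by simp
  qed
  finally show ?thesis unfolding d_def .
qed

lemma bit_size_le_log: "real (bit_size L) \<le> log 2 (real L) + 2"
\<comment> \<open>For the empty word the logarithm is 0 by the convention
  \<open>ln 0 = 0\<close>.\<close>
proof (cases "L = 0")
  case True
  then have "bit_size L = 0" unfolding bit_size_def by (intro Least_equality) auto
  then show ?thesis using True by (simp add: log_def)
next
  case False
  then have "2 ^ bit_size L \<le> 4 * L" using bit_size_bound[of L] by simp
  then have "real (2 ^ bit_size L) \<le> real (4 * L)" by (rule of_nat_mono)
  then have "2 powr real (bit_size L) \<le> 4 * real L" by (simp add: powr_realpow)
  then have "real (bit_size L) \<le> log 2 (4 * real L)" using False by (simp add: le_log_iff)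
  also have "\<dots> = log 2 (2 ^ 2) + log 2 (real L)" using False by (simp add: log_mult)
  also have "log 2 (2 ^ 2) = (2::real)" by (subst log_nat_power) auto
  finally show ?thesis by simp
qed

lemma time_bound: "real (200 * (bit_size L + 6) ^ 2) \<le> real 25600 * log 2 (real L) ^ 2 + real 25600"
proof -
  define l where "l = log 2 (real L)"
  have "0 \<le> l"
    by (cases "L = 0") (simp_all add: l_def log_def)
  have "real (bit_size L + 6) \<le> l + 8" using bit_size_le_log[of L] by (simp add: l_def)
  then have "real (bit_size L + 6) ^ 2 \<le> (l + 8) ^ 2" by (rule power_mono) simp
  \<comment> \<open>The squares of \<open>l + 8\<close> and \<open>l - 8\<close> add up to the right
    side. The factor 200 turns 128 into the constant 25600.\<close>
  also have "\<dots> \<le> 2 * l ^ 2 + 128"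
    using zero_le_power2[of "l - 8"] by (simp add: power2_eq_square algebra_simps)
  finally have "200 * real (bit_size L + 6) ^ 2 \<le> 400 * l ^ 2 + 25600" by simp
  also have "\<dots> \<le> 25600 * l ^ 2 + 25600" by simp
  finally show ?thesis by (simp add: l_def)
qed

theorem theorem5:
  shows "stability {3} \<in> NC"
proof -
  have "decides_input (code 0 stability_com) (length w ^ (64 ^ 4) + 64 ^ 4)
     (real 25600 * log 2 (real (length w)) ^ 2 + real 25600) w (w \<in> stability {3})" for w
  proof -
    obtain R m where "exec (length w ^ (64 ^ 4) + 64 ^ 4) stability_com (\<lambda>p r. if r = 0 then p else 0, shared (initial w))
        (200 * (bit_size (length w) + 6) ^ 2) (R, m)" "m 0 = 1 \<longleftrightarrow> w \<in> stability {3}"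
      using exec_stability_com[OF processors_bound] by blast
    then show ?thesis
      by (intro decides_input_code[OF _ stability_com_ok time_bound])
  qed
  then show ?thesis unfolding NC_def by blast
qed

end
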